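(* Let $M$ be an oriented riemannian manifold of dimension $n\ge 2$. Let $c:I\to M$ be a regular curve in $M$ with curvatures $\kappa_1,\dots,\kappa_{n-1}$, and for $1\le i\le n$ let $c^{(i)}(t)\in T_{c(t)}M$ be the consecutive covariant derivatives. Then for $1\le r\le n-2$, $$\kappa_r=\frac{\mathrm{vol}(c',\dots,c^{(r-1)})\,\mathrm{vol}(c',\dots,c^{(r+1)})}{\mathrm{vol}(c',\dots,c^{(r)})^2}\,\|c'\|^{-1},$$ and the torsion, i.e. the top curvature, satisfies $$\kappa_{n-1}=\frac{\mathrm{vol}(c',\dots,c^{(n-2)})\,\det(c',\dots,c^{(n)})}{\mathrm{vol}(c',\dots,c^{(n-1)})^2}\,\|c'\|^{-1}.$$ (All identities hold at every $t\in I$.)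
   Context: Riemannian manifolds are connected and $C^\infty$; curves are differentiable as many times as needed. $I\subset\mathbb{R}$ is an interval. For a curve $c:I\to M$ with $c'(t)\ne0$, let $D$ denote the (Levi-Civita) covariant differentiation along $c$ with respect to $c'(t)$; set $c^{(1)}=c'$ and $c^{(k+1)}=Dc^{(k)}$, so $c^{(k)}(t)\in T_{c(t)}M$. The curve is regular if $c'(t),\dots,c^{(n-1)}(t)$ are linearly independent for every $t\in I$. Each tangent space $T_{c(t)}M$ is an oriented inner product space. $\mathrm{vol}(v_1,\dots,v_k)$ is the $k$-dimensional volume of the parallelepiped spanned by $v_1,\dots,v_k\in T_{c(t)}M$ (square root of the Gram determinant), equal to $1$ for the empty collection. $\det(v_1,\dots,v_n)$ is the determinant of the coordinate matrix of $v_1,\dots,v_n$ in any positive orthonormal basis of $T_{c(t)}M$. The Frenet-Serret frame $e(t)=(e_1(t),\dots,e_n(t))$, $e_i(t)\in T_{c(t)}M$: $e_1,\dots,e_{n-1}$ is the Gram-Schmidt orthonormalization of $c',\dots,c^{(n-1)}$ ($e_i$ is a combination of $c',\dots,c^{(i)}$ with positive coefficient at $c^{(i)}$) and $e_n$ completes it to a positive orthonormal basis. The curvatures are the functions $\kappa_1,\dots,\kappa_{n-1}$ determined by $De_i=\|c'\|(-\kappa_{i-1}e_{i-1}+\kappa_ie_{i+1})$, $1\le i\le n$ (terms with $e_0$ or $e_{n+1}$ absent); equivalently $\kappa_r=\langle De_r,e_{r+1}\rangle/\|c'\|$. *)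

theory Defs
  imports
    "HOL-Analysis.Analysis"
    "HOL-Library.Function_Algebras"
    "Jordan_Normal_Form.Determinant"
begin

text \<open>
  Two determinants occur below: \<open>Determinants.det\<close> is the one of HOL-Analysis, for
  matrices of type \<open>real ^ 'n ^ 'n\<close>; \<open>Determinant.det\<close> is the one of
  Jordan_Normal_Form, for matrices whose size is a natural number, with indices starting at 0
  and value 1 on the empty matrix.
\<close>

no_notation vec_index (infixl \<open>$\<close> 100)

instantiation "fun" :: (type, real_vector) real_vector
begin

definition scaleR_fun :: "real \<Rightarrow> ('a \<Rightarrow> 'b) \<Rightarrow> 'a \<Rightarrow> 'b" where
  "scaleR_fun r f = (\<lambda>x. r *\<^sub>R f x)"

instance
  by standard (auto simp: scaleR_fun_def fun_eq_iff scaleR_add_right scaleR_add_left)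

end

text \<open>
  Differentiability of class $C^k$. It is used only on open sets and on relatively open subsets
  of nondegenerate intervals, where the derivative within the set is unique (one-sided at an
  end point that belongs to the interval).
\<close>

primrec Ck_on :: "nat \<Rightarrow> 'v::real_normed_vector set \<Rightarrow> ('v \<Rightarrow> 'w::real_normed_vector) \<Rightarrow> bool"
  where
    "Ck_on 0 S f \<longleftrightarrow> continuous_on S f"
  | "Ck_on (Suc k) S f \<longleftrightarrow> f differentiable_on S \<and>
       (\<forall>v. Ck_on k S (\<lambda>x. frechet_derivative f (at x within S) v))"

definition smooth_on :: "'v::real_normed_vector set \<Rightarrow> ('v \<Rightarrow> 'w::real_normed_vector) \<Rightarrow> bool" where
  "smooth_on S f \<longleftrightarrow> (\<forall>k. Ck_on k S f)"

type_synonym ('a, 'n) chart = "'a set \<times> ('a \<Rightarrow> real ^ 'n)"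

text \<open>
  A tangent vector is represented by the family of its coordinate vectors in all charts of the
  atlas around its base point, and is 0 at all other charts; the vector space structure is the
  pointwise one.
\<close>

type_synonym ('a, 'n) tangent = "('a, 'n) chart \<Rightarrow> real ^ 'n"

text \<open>
  The orientation is the one for which all charts of \<open>atlas\<close> are positive. As the index type
  \<open>'n\<close> of the coordinates carries no order, \<open>coord M\<close> enumerates the coordinates as the 1st,
  ..., \<open>n\<close>-th one.
\<close>

record ('a, 'n::finite) riem =
  underlying :: "'a topology"
  atlas :: "('a, 'n) chart set"
  coord :: "nat \<Rightarrow> 'n"
  metric :: "'a \<Rightarrow> ('a, 'n) tangent \<Rightarrow> ('a, 'n) tangent \<Rightarrow> real"

definition is_chart :: "'a topology \<Rightarrow> ('a, 'n::finite) chart \<Rightarrow> bool" where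
  "is_chart X a \<longleftrightarrow> openin X (fst a) \<and> open (snd a ` fst a) \<and>
     homeomorphic_map (subtopology X (fst a)) (top_of_set (snd a ` fst a)) (snd a)"

definition chart_inv :: "('a, 'n::finite) chart \<Rightarrow> real ^ 'n \<Rightarrow> 'a" where
  "chart_inv a = inv_into (fst a) (snd a)"

definition transition :: "('a, 'n::finite) chart \<Rightarrow> ('a, 'n) chart \<Rightarrow> real ^ 'n \<Rightarrow> real ^ 'n" where
  "transition a b = snd b \<circ> chart_inv a"

definition transition_deriv ::
    "('a, 'n::finite) chart \<Rightarrow> ('a, 'n) chart \<Rightarrow> 'a \<Rightarrow> real ^ 'n \<Rightarrow> real ^ 'n" where
  "transition_deriv a b p = frechet_derivative (transition a b) (at (snd a p))"

definition oriented_atlas :: "'a topology \<Rightarrow> ('a, 'n::finite) chart set \<Rightarrow> bool" where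
  "oriented_atlas X A \<longleftrightarrow>
     (\<forall>a\<in>A. is_chart X a) \<and> topspace X = (\<Union>a\<in>A. fst a) \<and>
     (\<forall>a\<in>A. \<forall>b\<in>A. smooth_on (snd a ` (fst a \<inter> fst b)) (transition a b) \<and>
        (\<forall>p\<in>fst a \<inter> fst b. Determinants.det (matrix (transition_deriv a b p)) > 0))"

definition charts_at :: "('a, 'n::finite) riem \<Rightarrow> 'a \<Rightarrow> ('a, 'n) chart set" where
  "charts_at M p = {a \<in> atlas M. p \<in> fst a}"

definition tangent_space :: "('a, 'n::finite) riem \<Rightarrow> 'a \<Rightarrow> ('a, 'n) tangent set" where
  "tangent_space M p =
     {v. (\<forall>a\<in>charts_at M p. \<forall>b\<in>charts_at M p. v b = transition_deriv a b p (v a)) \<and>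
         (\<forall>a. a \<notin> charts_at M p \<longrightarrow> v a = 0)}"

text \<open>The vector $\partial/\partial x^i$ at \<open>p\<close>, with respect to the chart \<open>a\<close>.\<close>

definition coord_vector ::
    "('a, 'n::finite) riem \<Rightarrow> ('a, 'n) chart \<Rightarrow> 'a \<Rightarrow> 'n \<Rightarrow> ('a, 'n) tangent" where
  "coord_vector M a p i =
     (\<lambda>b. if b \<in> charts_at M p then transition_deriv a b p (axis i 1) else 0)"

definition metric_coeff ::
    "('a, 'n::finite) riem \<Rightarrow> ('a, 'n) chart \<Rightarrow> real ^ 'n \<Rightarrow> real ^ 'n ^ 'n" where
  "metric_coeff M a x = (let p = chart_inv a x in
     (\<chi> i j. metric M p (coord_vector M a p i) (coord_vector M a p j)))"

definition inner_product_on :: "'v::real_vector set \<Rightarrow> ('v \<Rightarrow> 'v \<Rightarrow> real) \<Rightarrow> bool" where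
  "inner_product_on T g \<longleftrightarrow>
     (\<forall>u\<in>T. \<forall>v\<in>T. \<forall>w\<in>T. g (u + v) w = g u w + g v w) \<and>
     (\<forall>r. \<forall>u\<in>T. \<forall>w\<in>T. g (r *\<^sub>R u) w = r * g u w) \<and>
     (\<forall>u\<in>T. \<forall>w\<in>T. g u w = g w u) \<and>
     (\<forall>u\<in>T. u \<noteq> 0 \<longrightarrow> g u u > 0)"

definition oriented_riemannian_manifold :: "('a, 'n::finite) riem \<Rightarrow> bool" where
  "oriented_riemannian_manifold M \<longleftrightarrow>
     Hausdorff_space (underlying M) \<and> second_countable (underlying M) \<and> connected_space (underlying M) \<and>
     oriented_atlas (underlying M) (atlas M) \<and>
     bij_betw (coord M) {1..CARD('n)} UNIV \<and>
     (\<forall>p\<in>topspace (underlying M). inner_product_on (tangent_space M p) (metric M p)) \<and>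
     (\<forall>a\<in>atlas M. smooth_on (snd a ` fst a) (metric_coeff M a))"

definition tangent_norm :: "('a, 'n::finite) riem \<Rightarrow> 'a \<Rightarrow> ('a, 'n) tangent \<Rightarrow> real" where
  "tangent_norm M p v = sqrt (metric M p v v)"

definition positive_orthonormal_basis ::
    "('a, 'n::finite) riem \<Rightarrow> 'a \<Rightarrow> (nat \<Rightarrow> ('a, 'n) tangent) \<Rightarrow> bool" where
  "positive_orthonormal_basis M p b \<longleftrightarrow>
     (\<forall>i\<in>{1..CARD('n)}. b i \<in> tangent_space M p) \<and>
     (\<forall>i\<in>{1..CARD('n)}. \<forall>j\<in>{1..CARD('n)}. metric M p (b i) (b j) = (if i = j then 1 else 0)) \<and>
     (\<forall>a\<in>charts_at M p.
        Determinant.det (Matrix.mat CARD('n) CARD('n)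
          (\<lambda>(i, j). b (j + 1) a $ coord M (i + 1))) > 0)"

definition vol ::
    "('a, 'n::finite) riem \<Rightarrow> 'a \<Rightarrow> nat \<Rightarrow> (nat \<Rightarrow> ('a, 'n) tangent) \<Rightarrow> real" where
  "vol M p k v =
     sqrt (Determinant.det (Matrix.mat k k (\<lambda>(i, j). metric M p (v (i + 1)) (v (j + 1)))))"

definition tangent_det ::
    "('a, 'n::finite) riem \<Rightarrow> 'a \<Rightarrow> (nat \<Rightarrow> ('a, 'n) tangent) \<Rightarrow> real" where
  "tangent_det M p v = (THE d. \<forall>b x. positive_orthonormal_basis M p b \<and>
       (\<forall>j\<in>{1..CARD('n)}. v j = (\<Sum>i=1..CARD('n). x i j *\<^sub>R b i)) \<longrightarrow>
       d = Determinant.det (Matrix.mat CARD('n) CARD('n) (\<lambda>(i, j). x (i + 1) (j + 1))))"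

definition partial :: "'n::finite \<Rightarrow> (real ^ 'n \<Rightarrow> real) \<Rightarrow> real ^ 'n \<Rightarrow> real" where
  "partial i f x = frechet_derivative f (at x) (axis i 1)"

text \<open>The Christoffel symbol $\Gamma^k_{ij}$ of the Levi-Civita connection at the point with
  coordinates \<open>x\<close> in the chart \<open>a\<close>.\<close>

definition christoffel ::
    "('a, 'n::finite) riem \<Rightarrow> ('a, 'n) chart \<Rightarrow> real ^ 'n \<Rightarrow> 'n \<Rightarrow> 'n \<Rightarrow> 'n \<Rightarrow> real" where
  "christoffel M a x k i j = (let g = (\<lambda>r s y. metric_coeff M a y $ r $ s) in
     (\<Sum>l\<in>UNIV. matrix_inv (metric_coeff M a x) $ k $ l *
        (partial i (g j l) x + partial j (g i l) x - partial l (g i j) x)) / 2)"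

definition velocity ::
    "('a, 'n::finite) riem \<Rightarrow> real set \<Rightarrow> (real \<Rightarrow> 'a) \<Rightarrow> real \<Rightarrow> ('a, 'n) tangent" where
  "velocity M I c t = (\<lambda>a. if a \<in> charts_at M (c t)
     then vector_derivative (\<lambda>s. snd a (c s)) (at t within I) else 0)"

text \<open>The coordinates of $DV$ in any chart are
  $(DV)^k = (V^k)' + \sum_{i,j} \Gamma^k_{ij}(c)\, (c^i)'\, V^j$.\<close>

definition cov_deriv ::
    "('a, 'n::finite) riem \<Rightarrow> real set \<Rightarrow> (real \<Rightarrow> 'a) \<Rightarrow> (real \<Rightarrow> ('a, 'n) tangent) \<Rightarrow>
     real \<Rightarrow> ('a, 'n) tangent" where
  "cov_deriv M I c V t = (\<lambda>a. if a \<in> charts_at M (c t)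
     then vector_derivative (\<lambda>s. V s a) (at t within I) +
       (\<chi> k. \<Sum>i\<in>UNIV. \<Sum>j\<in>UNIV. christoffel M a (snd a (c t)) k i j *
          velocity M I c t a $ i * V t a $ j)
     else 0)"

text \<open>\<open>curve_deriv M I c k\<close> is $c^{(k)}$ for \<open>k \<ge> 1\<close>; the value at \<open>k = 0\<close> is a dummy.\<close>

primrec curve_deriv ::
    "('a, 'n::finite) riem \<Rightarrow> real set \<Rightarrow> (real \<Rightarrow> 'a) \<Rightarrow> nat \<Rightarrow> real \<Rightarrow> ('a, 'n) tangent" where
  "curve_deriv M I c 0 = (\<lambda>t. 0)"
| "curve_deriv M I c (Suc k) =
     (if k = 0 then velocity M I c else cov_deriv M I c (curve_deriv M I c k))"

definition Ck_curve ::
    "nat \<Rightarrow> ('a, 'n::finite) riem \<Rightarrow> real set \<Rightarrow> (real \<Rightarrow> 'a) \<Rightarrow> bool" where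
  "Ck_curve k M I c \<longleftrightarrow> continuous_map (top_of_set I) (underlying M) c \<and>
     (\<forall>a\<in>atlas M. Ck_on k {t \<in> I. c t \<in> fst a} (\<lambda>t. snd a (c t)))"

definition regular_curve ::
    "('a, 'n::finite) riem \<Rightarrow> real set \<Rightarrow> (real \<Rightarrow> 'a) \<Rightarrow> bool" where
  "regular_curve M I c \<longleftrightarrow> (\<forall>t\<in>I.
     inj_on (\<lambda>k. curve_deriv M I c k t) {1..CARD('n) - 1} \<and>
     independent ((\<lambda>k. curve_deriv M I c k t) ` {1..CARD('n) - 1}))"

fun gram_schmidt_onb ::
    "('v::real_vector \<Rightarrow> 'v \<Rightarrow> real) \<Rightarrow> (nat \<Rightarrow> 'v) \<Rightarrow> nat \<Rightarrow> 'v" where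
  "gram_schmidt_onb g v i =
     (let w = v i - (\<Sum>j\<in>{1..<i}. g (v i) (gram_schmidt_onb g v j) *\<^sub>R gram_schmidt_onb g v j)
      in (1 / sqrt (g w w)) *\<^sub>R w)"

declare gram_schmidt_onb.simps [simp del]

definition frenet ::
    "('a, 'n::finite) riem \<Rightarrow> real set \<Rightarrow> (real \<Rightarrow> 'a) \<Rightarrow> nat \<Rightarrow> real \<Rightarrow> ('a, 'n) tangent" where
  "frenet M I c i t =
     (let e = gram_schmidt_onb (metric M (c t)) (\<lambda>k. curve_deriv M I c k t) in
      if i < CARD('n) then e i
      else (THE u. positive_orthonormal_basis M (c t) (e(CARD('n) := u))))"

text \<open>
  $\kappa_r = \langle De_r, e_{r+1}\rangle / \|c'\|$: this is the Frenet equation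
  $De_r = \|c'\|(-\kappa_{r-1}e_{r-1} + \kappa_r e_{r+1})$ paired with $e_{r+1}$.
\<close>

definition curvature ::
    "('a, 'n::finite) riem \<Rightarrow> real set \<Rightarrow> (real \<Rightarrow> 'a) \<Rightarrow> nat \<Rightarrow> real \<Rightarrow> real" where
  "curvature M I c r t =
     metric M (c t) (cov_deriv M I c (frenet M I c r) t) (frenet M I c (r + 1) t) /
     tangent_norm M (c t) (velocity M I c t)"

end

(*
  Write v_k = c^(k). Since e_1, ..., e_{n-1} is the Gram-Schmidt frame, e_r = sum_{k <= r} a_k v_k with
  differentiable coefficients a_k and a_r = 1 / <v_r, e_r>. Hence D e_r is a_r v_{r+1} plus a combination of
  v_1, ..., v_r, and pairing with e_{r+1}, which is orthogonal to v_1, ..., v_r, gives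
  <D e_r, e_{r+1}> = <v_{r+1}, e_{r+1}> / <v_r, e_r>. On the other hand the matrix <v_i, e_j> is triangular,
  so vol(v_1, ..., v_k) and det(v_1, ..., v_n) are the products of the diagonal entries <v_i, e_i>, and the
  quotients of the theorem telescope.

  The coordinates of the v_k depend on the chart. That they define tangent vectors is the transformation law
  of the Christoffel symbols, which rests on the symmetry of the second derivative of the transition maps.
*)
theory Submission
  imports Defs
begin

subsection \<open>Determinants and orthonormal bases\<close>

text \<open>Two features of the setting shape the proof. Tangent spaces are subsets of one large
  function type, and the metric obeys its axioms only there, so every use of bilinearity needs a
  proof of tangency. And the Frenet vectors are defined pointwise, by Gram-Schmidt and, for e_n, by
  \<open>THE\<close>, so that nothing is known beforehand about their dependence on t. The
  coefficients of e_r over the c^(k) are built from the Gram entries <c^(i), c^(j)>; these are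
  functions on all of I not tied to a chart, and their differentiability can be checked near each t
  in any chart. The vector e_n is never differentiated, since the curvatures involve D e_r for r <=
  n - 1 only. Orders of differentiability are counted exactly: along a curve of class C^n, the field
  c^(k) keeps n - k orders, so that c^(n) still exists. Finally, <c^(n), e_n> has no prescribed
  sign, whereas the earlier <c^(i), e_i> are positive; this is why a signed determinant replaces the
  volume in the top formula.\<close>

lemma prod_list_diag_mat_mat:
  "prod_list (diag_mat (Matrix.mat n n f)) = (\<Prod>i=1..n. f (i - 1, i - 1))"
proof -
  have "prod_list (diag_mat (Matrix.mat n n f)) = (\<Prod>i=0..<n. f (i, i))"
    by (simp add: prod_list_diag_prod)
  also have "\<dots> = (\<Prod>i=1..n. f (i - 1, i - 1))"
    by (rule prod.reindex_bij_witness[of _ "\<lambda>i. i - 1" Suc]) auto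
  finally show ?thesis .
qed

text \<open>Serves every later factorisation (Gram matrix, change of basis, change of chart):
  families of vectors are indexed from 1, whereas \<open>Matrix.mat\<close> counts from 0, and the
  shift is absorbed here once.\<close>

lemma det_mat_mult:
  fixes f h :: "nat \<Rightarrow> nat \<Rightarrow> real"
  shows "Determinant.det (Matrix.mat n n (\<lambda>(i, j). \<Sum>k=1..n. f (i + 1) k * h k (j + 1))) =
    Determinant.det (Matrix.mat n n (\<lambda>(i, j). f (i + 1) (j + 1))) *
    Determinant.det (Matrix.mat n n (\<lambda>(i, j). h (i + 1) (j + 1)))"
proof -
  let ?F = "Matrix.mat n n (\<lambda>(i, j). f (i + 1) (j + 1))"
  let ?H = "Matrix.mat n n (\<lambda>(i, j). h (i + 1) (j + 1))"
  have "Matrix.mat n n (\<lambda>(i, j). \<Sum>k=1..n. f (i + 1) k * h k (j + 1)) = ?F * ?H"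
  proof (rule eq_matI)
    fix i j assume "i < dim_row (?F * ?H)" "j < dim_col (?F * ?H)"
    then have ij: "i < n" "j < n" by auto
    have "(\<Sum>k=1..n. f (i + 1) k * h k (j + 1)) = (\<Sum>k=0..<n. f (i + 1) (k + 1) * h (k + 1) (j + 1))"
      by (rule sum.reindex_bij_witness[of _ Suc "\<lambda>k. k - 1"]) auto
    then show "Matrix.mat n n (\<lambda>(i, j). \<Sum>k=1..n. f (i + 1) k * h k (j + 1)) $$ (i, j) = (?F * ?H) $$ (i, j)"
      using ij by (simp add: scalar_prod_def)
  qed auto
  then show ?thesis
    by (simp add: det_mult[of _ n])
qed

lemma det_mat_transpose:
  fixes f :: "nat \<Rightarrow> nat \<Rightarrow> real"
  shows "Determinant.det (Matrix.mat n n (\<lambda>(i, j). f j i)) =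
    Determinant.det (Matrix.mat n n (\<lambda>(i, j). f i j))"
proof -
  have "Matrix.mat n n (\<lambda>(i, j). f j i) = transpose_mat (Matrix.mat n n (\<lambda>(i, j). f i j))"
    by (rule eq_matI) auto
  then show ?thesis
    by (simp add: Determinant.det_transpose[of _ n])
qed

lemma det_mat_lower_triangular:
  fixes f :: "nat \<Rightarrow> nat \<Rightarrow> real"
  assumes "\<And>i j. 1 \<le> i \<Longrightarrow> i < j \<Longrightarrow> j \<le> n \<Longrightarrow> f i j = 0"
  shows "Determinant.det (Matrix.mat n n (\<lambda>(i, j). f (i + 1) (j + 1))) = (\<Prod>i=1..n. f i i)"
proof -
  have "Determinant.det (Matrix.mat n n (\<lambda>(i, j). f (i + 1) (j + 1))) =
      prod_list (diag_mat (Matrix.mat n n (\<lambda>(i, j). f (i + 1) (j + 1))))"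
    using assms by (intro det_lower_triangular[of n]) auto
  also have "\<dots> = (\<Prod>i=1..n. f i i)"
    unfolding prod_list_diag_mat_mat by (rule prod.cong) auto
  finally show ?thesis .
qed

lemma det_mat_upper_triangular:
  fixes f :: "nat \<Rightarrow> nat \<Rightarrow> real"
  assumes "\<And>i j. 1 \<le> j \<Longrightarrow> j < i \<Longrightarrow> i \<le> n \<Longrightarrow> f i j = 0"
  shows "Determinant.det (Matrix.mat n n (\<lambda>(i, j). f (i + 1) (j + 1))) = (\<Prod>i=1..n. f i i)"
  using det_mat_lower_triangular[of n "\<lambda>i j. f j i"] assms
    det_mat_transpose[of n "\<lambda>i j. f (i + 1) (j + 1)"] by simp

lemma permutes_nat_less: "p permutes {0..<n} \<Longrightarrow> i < n \<Longrightarrow> p i < (n::nat)"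
  using permutes_in_image[of p "{0..<n}" i] by simp

text \<open>Both sides are Leibniz sums, and conjugation by the enumeration \<open>f\<close> matches
  the permutations of the two index sets, preserving signs. It links the positivity of transition
  maps in \<open>oriented_atlas\<close>, stated with one determinant, to the positivity of bases,
  stated with the other.\<close>

lemma det_jordan_normal_form:
  fixes A :: "real ^ 'n::finite ^ 'n" and f :: "nat \<Rightarrow> 'n"
  assumes f: "bij_betw f {1..CARD('n)} UNIV"
  shows "Determinant.det (Matrix.mat CARD('n) CARD('n) (\<lambda>(i, j). A $ f (i + 1) $ f (j + 1))) =
    Determinants.det A"
proof -
  define h where "h = (\<lambda>i. f (i + 1))"
  let ?N = "{0..<CARD('n)}"
  have bS: "bij_betw Suc ?N {1..CARD('n)}"
    by (rule bij_betwI[where g = "\<lambda>i. i - 1"]) auto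
  have h: "bij_betw h ?N UNIV"
    using bij_betw_trans[OF bS f] by (simp add: h_def o_def)
  then have inj: "inj_on h ?N" by (rule bij_betw_imp_inj_on)
  define h' where "h' = inv_into ?N h"
  have h': "\<And>i. i \<in> ?N \<Longrightarrow> h' (h i) = i" "bij_betw h' UNIV ?N" "\<And>x. h (h' x) = x"
    using bij_betw_inv_into_left[OF h] bij_betw_inv_into[OF h] bij_betw_inv_into_right[OF h]
    by (simp_all add: h'_def)
  have "Determinant.det (Matrix.mat CARD('n) CARD('n) (\<lambda>(i, j). A $ h i $ h j)) =
      (\<Sum>p | p permutes ?N. of_int (sign p) * (\<Prod>i=0..<CARD('n). A $ h i $ h (p i)))"
    by (subst det_def'[of _ "CARD('n)"])
      (auto intro!: sum.cong prod.cong simp: permutes_nat_less)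
  also have "\<dots> = (\<Sum>q | q permutes (UNIV :: 'n set). of_int (sign q) * (\<Prod>i\<in>UNIV. A $ i $ q i))"
  proof (rule sum.reindex_bij_witness[of _ "map_permutation UNIV h'" "map_permutation ?N h"])
    fix p assume "p \<in> {p. p permutes ?N}"
    then have p: "p permutes ?N" by simp
    show "map_permutation UNIV h' (map_permutation ?N h p) = p"
      by (rule map_permutation_compose_inv[OF h p]) (use h' in auto)
    show "map_permutation ?N h p \<in> {q. q permutes UNIV}"
      using map_permutation_permutes[OF h p] by simp
    have "(\<Prod>i\<in>UNIV. A $ i $ map_permutation ?N h p i) = (\<Prod>i\<in>?N. A $ h i $ map_permutation ?N h p (h i))"
      using prod.reindex_bij_betw[OF h, of "\<lambda>i. A $ i $ map_permutation ?N h p i"] by simp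
    also have "\<dots> = (\<Prod>i=0..<CARD('n). A $ h i $ h (p i))"
      by (rule prod.cong) (auto simp: map_permutation_apply[OF inj])
    finally show "of_int (sign (map_permutation ?N h p)) * (\<Prod>i\<in>UNIV. A $ i $ map_permutation ?N h p i) =
        of_int (sign p) * (\<Prod>i=0..<CARD('n). A $ h i $ h (p i))"
      by (simp add: sign_map_permutation[OF inj p])
  next
    fix q assume "q \<in> {q. q permutes (UNIV :: 'n set)}"
    then have q: "q permutes UNIV" by simp
    show "map_permutation ?N h (map_permutation UNIV h' q) = q"
      by (rule map_permutation_compose_inv[OF h'(2) q]) (use h' in auto)
    show "map_permutation UNIV h' q \<in> {p. p permutes ?N}"
      using map_permutation_permutes[OF h'(2) q] by simp
  qed
  also have "\<dots> = Determinants.det A"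
    by (simp add: Determinants.det_def)
  finally show ?thesis by (simp add: h_def)
qed

text \<open>An inner product on a subset \<open>T\<close> instead of on a type: tangent spaces vary
  with the point while their elements share one function type. The basis \<open>B\<close> makes
  \<open>T\<close> a subspace of dimension \<open>card B\<close>.\<close>

locale inner_product_with_basis =
  fixes B T :: "'v::real_vector set" and g :: "'v \<Rightarrow> 'v \<Rightarrow> real"
  assumes basis: "independent B" "finite B" "span B = T"
    and inner_product: "inner_product_on T g"
begin

section \<open>Orthonormal families and the Gram-Schmidt process\<close>

lemma subspace_T: "subspace T"
  using basis(3) subspace_span by blast

lemma add_in [simp, intro]: "u \<in> T \<Longrightarrow> v \<in> T \<Longrightarrow> u + v \<in> T"
  and diff_in [simp, intro]: "u \<in> T \<Longrightarrow> v \<in> T \<Longrightarrow> u - v \<in> T"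
  and scaleR_in [simp, intro]: "v \<in> T \<Longrightarrow> r *\<^sub>R v \<in> T"
  and zero_in [simp, intro]: "0 \<in> T"
  using subspace_T by (auto simp: subspace_add subspace_diff subspace_scale subspace_0)

lemma sum_in [intro]: "(\<And>i. i \<in> A \<Longrightarrow> f i \<in> T) \<Longrightarrow> sum f A \<in> T"
  using subspace_T by (rule subspace_sum)

lemma inner_commute: "u \<in> T \<Longrightarrow> v \<in> T \<Longrightarrow> g u v = g v u"
  and inner_add_left: "u \<in> T \<Longrightarrow> v \<in> T \<Longrightarrow> w \<in> T \<Longrightarrow> g (u + v) w = g u w + g v w"
  and inner_scaleR_left: "u \<in> T \<Longrightarrow> w \<in> T \<Longrightarrow> g (r *\<^sub>R u) w = r * g u w"
  and inner_pos: "u \<in> T \<Longrightarrow> u \<noteq> 0 \<Longrightarrow> g u u > 0"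
proof -
  have "\<forall>u\<in>T. \<forall>w\<in>T. g u w = g w u"
    using inner_product unfolding inner_product_on_def by (elim conjE)
  then show "u \<in> T \<Longrightarrow> v \<in> T \<Longrightarrow> g u v = g v u" by (elim ballE) auto
  have "\<forall>u\<in>T. \<forall>v\<in>T. \<forall>w\<in>T. g (u + v) w = g u w + g v w"
    using inner_product unfolding inner_product_on_def by (elim conjE)
  then show "u \<in> T \<Longrightarrow> v \<in> T \<Longrightarrow> w \<in> T \<Longrightarrow> g (u + v) w = g u w + g v w" by simp
  have "\<forall>r. \<forall>u\<in>T. \<forall>w\<in>T. g (r *\<^sub>R u) w = r * g u w"
    using inner_product unfolding inner_product_on_def by (elim conjE)
  then show "u \<in> T \<Longrightarrow> w \<in> T \<Longrightarrow> g (r *\<^sub>R u) w = r * g u w" by simp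
  have "\<forall>u\<in>T. u \<noteq> 0 \<longrightarrow> g u u > 0"
    using inner_product unfolding inner_product_on_def by (elim conjE)
  then show "u \<in> T \<Longrightarrow> u \<noteq> 0 \<Longrightarrow> g u u > 0" by simp
qed

lemma inner_scaleR_right: "u \<in> T \<Longrightarrow> w \<in> T \<Longrightarrow> g w (r *\<^sub>R u) = r * g w u"
  using inner_scaleR_left[of u w r] inner_commute[of w u] inner_commute[of w "r *\<^sub>R u"] by simp

lemma inner_zero_left: "w \<in> T \<Longrightarrow> g 0 w = 0"
  using inner_scaleR_left[of 0 w 0] by simp

lemma inner_diff_left: "u \<in> T \<Longrightarrow> v \<in> T \<Longrightarrow> w \<in> T \<Longrightarrow> g (u - v) w = g u w - g v w"
  using inner_add_left[of "u - v" v w] by auto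

lemma inner_sum_left: "(\<And>i. i \<in> A \<Longrightarrow> f i \<in> T) \<Longrightarrow> w \<in> T \<Longrightarrow> g (sum f A) w = (\<Sum>i\<in>A. g (f i) w)"
  by (induction A rule: infinite_finite_induct) (auto simp: inner_zero_left inner_add_left sum_in)

lemma inner_sum_scaleR_left:
  "(\<And>i. i \<in> A \<Longrightarrow> f i \<in> T) \<Longrightarrow> w \<in> T \<Longrightarrow> g (\<Sum>i\<in>A. r i *\<^sub>R f i) w = (\<Sum>i\<in>A. r i * g (f i) w)"
  by (simp add: inner_sum_left inner_scaleR_left)

lemma inner_sum_scaleR_right:
  assumes "\<And>i. i \<in> A \<Longrightarrow> f i \<in> T" "w \<in> T"
  shows "g w (\<Sum>i\<in>A. r i *\<^sub>R f i) = (\<Sum>i\<in>A. r i * g w (f i))"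
proof -
  have "g w (\<Sum>i\<in>A. r i *\<^sub>R f i) = g (\<Sum>i\<in>A. r i *\<^sub>R f i) w"
    using assms by (intro inner_commute sum_in) auto
  also have "\<dots> = (\<Sum>i\<in>A. r i * g w (f i))"
    using assms by (subst inner_sum_scaleR_left) (auto intro!: sum.cong simp: inner_commute)
  finally show ?thesis .
qed

text \<open>Pairing a linear relation with one of its members \<open>y\<close> isolates the
  coefficient of \<open>y\<close>.\<close>

lemma orthogonal_independent:
  assumes "finite S" "S \<subseteq> T" "0 \<notin> S" and orth: "\<And>x y. x \<in> S \<Longrightarrow> y \<in> S \<Longrightarrow> x \<noteq> y \<Longrightarrow> g x y = 0"
  shows "independent S"
proof
  assume "dependent S"
  then obtain u y where y: "y \<in> S" "u y \<noteq> 0" and 0: "(\<Sum>v\<in>S. u v *\<^sub>R v) = 0"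
    using dependent_finite[OF assms(1)] by auto
  have "0 = g (\<Sum>v\<in>S. u v *\<^sub>R v) y"
    using 0 y(1) assms(2) by (simp add: inner_zero_left subset_iff)
  also have "\<dots> = (\<Sum>v\<in>S. u v * g v y)"
    using y(1) assms(2) by (intro inner_sum_scaleR_left) auto
  also have "\<dots> = (\<Sum>v\<in>S. if v = y then u y * g y y else 0)"
    using y(1) orth by (intro sum.cong) auto
  also have "\<dots> = u y * g y y"
    using y(1) assms(1) by simp
  finally show False
    using y assms(2,3) inner_pos[of y] by auto
qed

definition orthonormal :: "nat \<Rightarrow> (nat \<Rightarrow> 'v) \<Rightarrow> bool" where
  "orthonormal k b \<longleftrightarrow> (\<forall>i\<in>{1..k}. b i \<in> T) \<and>
     (\<forall>i\<in>{1..k}. \<forall>j\<in>{1..k}. g (b i) (b j) = (if i = j then 1 else 0))"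

lemma orthonormalD:
  assumes "orthonormal k b"
  shows "1 \<le> i \<Longrightarrow> i \<le> k \<Longrightarrow> b i \<in> T"
    "1 \<le> i \<Longrightarrow> i \<le> k \<Longrightarrow> 1 \<le> j \<Longrightarrow> j \<le> k \<Longrightarrow> g (b i) (b j) = (if i = j then 1 else 0)"
  using assms by (auto simp: orthonormal_def)

lemma orthonormal_mono: "orthonormal k b \<Longrightarrow> l \<le> k \<Longrightarrow> orthonormal l b"
  by (auto simp: orthonormal_def)

lemma orthonormal_inj: "orthonormal k b \<Longrightarrow> inj_on b {1..k}"
proof (rule inj_onI)
  fix i j assume b: "orthonormal k b" and ij: "i \<in> {1..k}" "j \<in> {1..k}" "b i = b j"
  then have "g (b i) (b j) = 1"
    using orthonormalD(2)[OF b, of j j] by simp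
  then show "i = j"
    using orthonormalD(2)[OF b, of i j] ij by (auto split: if_splits)
qed

lemma orthonormal_coefficient:
  assumes "orthonormal k b" "1 \<le> j" "j \<le> k"
  shows "g (\<Sum>i=1..k. r i *\<^sub>R b i) (b j) = r j"
proof -
  have "g (\<Sum>i=1..k. r i *\<^sub>R b i) (b j) = (\<Sum>i=1..k. r i * g (b i) (b j))"
    using assms by (intro inner_sum_scaleR_left) (auto simp: orthonormalD)
  also have "\<dots> = (\<Sum>i=1..k. if i = j then r j else 0)"
    using assms by (intro sum.cong) (auto simp: orthonormalD)
  finally show ?thesis using assms by simp
qed

lemma orthonormal_residual:
  assumes "orthonormal k b" "v \<in> T" "1 \<le> j" "j \<le> k"
  shows "g (v - (\<Sum>i=1..k. g v (b i) *\<^sub>R b i)) (b j) = 0"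
proof -
  have "(\<Sum>i=1..k. g v (b i) *\<^sub>R b i) \<in> T"
    using assms by (intro sum_in scaleR_in) (auto simp: orthonormalD)
  then show ?thesis
    using assms orthonormal_coefficient[of k b j "\<lambda>i. g v (b i)"]
    by (subst inner_diff_left) (auto simp: orthonormalD)
qed

text \<open>If the residual \<open>w\<close> of \<open>v\<close> were nonzero, \<open>w\<close> and
  the \<open>b i\<close> would be \<open>card B + 1\<close> independent vectors in the span of
  \<open>B\<close>.\<close>

lemma orthonormal_expansion:
  assumes b: "orthonormal (card B) b" and v: "v \<in> T"
  shows "v = (\<Sum>i=1..card B. g v (b i) *\<^sub>R b i)"
proof (rule ccontr)
  define w where "w = v - (\<Sum>i=1..card B. g v (b i) *\<^sub>R b i)"
  assume "\<not> ?thesis"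
  then have w0: "w \<noteq> 0" by (simp add: w_def)
  have wT: "w \<in> T"
    unfolding w_def using b v by (intro diff_in sum_in scaleR_in) (auto simp: orthonormalD)
  have bT: "b ` {1..card B} \<subseteq> T"
    using b by (auto simp: orthonormalD)
  have wb: "g w (b j) = 0" if "j \<in> {1..card B}" for j
    unfolding w_def using orthonormal_residual[OF b v] that by auto
  have bw: "g (b j) w = 0" if "j \<in> {1..card B}" for j
    using wb[OF that] that bT wT by (subst inner_commute) auto
  have b1: "g (b j) (b j) = 1" if "j \<in> {1..card B}" for j
    using b that by (simp add: orthonormalD)
  let ?S = "insert w (b ` {1..card B})"
  have wnot: "w \<notin> b ` {1..card B}"
    using wb b1 by force
  have "0 \<notin> b ` {1..card B}"
  proof
    assume "0 \<in> b ` {1..card B}"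
    then obtain j where j: "j \<in> {1..card B}" "b j = 0" by (metis imageE)
    then show False using b1[OF j(1)] inner_zero_left[of 0] by simp
  qed
  then have "independent ?S"
    using w0 wT bT wb bw b
    by (intro orthogonal_independent) (auto simp: orthonormalD)
  moreover have "?S \<subseteq> span B"
    using wT bT basis(3) by auto
  ultimately have "card ?S \<le> card B"
    using basis(2) independent_span_bound by blast
  then show False
    using wnot card_image[OF orthonormal_inj[OF b]] by simp
qed

text \<open>The \<open>k\<close> vectors \<open>b i\<close> are too few to span \<open>T\<close>, so
  some member of \<open>B\<close> lies outside their span; its residual is nonzero and gets
  normalised.\<close>

lemma orthonormal_extension:
  assumes b: "orthonormal k b" and k: "Suc k = card B"
  shows "\<exists>u. orthonormal (card B) (b(card B := u))"
proof -
  have bT: "b ` {1..k} \<subseteq> T"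
    using b by (auto simp: orthonormalD)
  obtain v where v: "v \<in> B" "v \<notin> span (b ` {1..k})"
  proof (rule ccontr)
    assume "\<not> thesis"
    then have "B \<subseteq> span (b ` {1..k})" using that by blast
    then have "card B \<le> card (b ` {1..k})"
      using independent_span_bound[OF _ basis(1)] by auto
    also have "\<dots> \<le> k" using card_image_le[of "{1..k}" b] by simp
    finally show False using k by simp
  qed
  define w where "w = v - (\<Sum>i=1..k. g v (b i) *\<^sub>R b i)"
  have vT: "v \<in> T" using v(1) basis(3) span_base by blast
  have wT: "w \<in> T"
    unfolding w_def using b vT by (intro diff_in sum_in scaleR_in) (auto simp: orthonormalD)
  have "w \<noteq> 0"
  proof
    assume "w = 0"
    then have "v = (\<Sum>i=1..k. g v (b i) *\<^sub>R b i)" by (simp add: w_def)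
    also have "\<dots> \<in> span (b ` {1..k})"
      by (intro span_sum span_scale span_base) auto
    finally show False using v(2) by simp
  qed
  then have pos: "g w w > 0" using wT inner_pos by blast
  have wb: "g w (b j) = 0" if "1 \<le> j" "j \<le> k" for j
    unfolding w_def using orthonormal_residual[OF b vT] that by auto
  have bw: "g (b j) w = 0" if "1 \<le> j" "j \<le> k" for j
    using wb[OF that] that b wT by (subst inner_commute) (auto simp: orthonormalD)
  define u where "u = (1 / sqrt (g w w)) *\<^sub>R w"
  have uT: "u \<in> T" by (simp add: u_def wT)
  have "g u u = 1"
    using pos wT by (simp add: u_def inner_scaleR_left inner_scaleR_right)
  moreover have "g u (b j) = 0" "g (b j) u = 0" if "1 \<le> j" "j \<le> k" for j
    using wb[OF that] bw[OF that] that b wT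
    by (auto simp: u_def inner_scaleR_left inner_scaleR_right orthonormalD)
  moreover have "i \<le> card B \<longleftrightarrow> i \<le> k \<or> i = card B" "i \<le> k \<Longrightarrow> i \<noteq> card B" for i
    using k by auto
  ultimately show ?thesis
    using uT b k unfolding orthonormal_def by (intro exI[of _ u]) auto
qed

text \<open>In the basis ending in \<open>u\<close>, all coordinates of \<open>u'\<close> except the
  last vanish by orthogonality, and the last has square 1.\<close>

lemma orthonormal_top_unique:
  assumes b: "orthonormal (card B) (b(card B := u))" and b': "orthonormal (card B) (b(card B := u'))"
    and n: "card B \<ge> 1"
  shows "u' = u \<or> u' = - u"
proof -
  let ?n = "card B"
  have uT: "u \<in> T" "u' \<in> T" and uu: "g u u = 1" "g u' u' = 1"
    using orthonormalD[OF b, of ?n] orthonormalD[OF b', of ?n] n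
      orthonormalD(2)[OF b, of ?n ?n] orthonormalD(2)[OF b', of ?n ?n] by auto
  have "u' = (\<Sum>i=1..?n. g u' ((b(?n := u)) i) *\<^sub>R (b(?n := u)) i)"
    by (rule orthonormal_expansion[OF b uT(2)])
  also have "\<dots> = (\<Sum>i=1..?n. if i = ?n then g u' u *\<^sub>R u else 0)"
  proof (intro sum.cong refl)
    fix i assume i: "i \<in> {1..?n}"
    show "g u' ((b(?n := u)) i) *\<^sub>R (b(?n := u)) i = (if i = ?n then g u' u *\<^sub>R u else 0)"
      using orthonormalD(2)[OF b', of ?n i] i by auto
  qed
  also have "\<dots> = g u' u *\<^sub>R u"
    using n by simp
  finally have eq: "u' = g u' u *\<^sub>R u" .
  define q where "q = g u' u"
  have "u' = q *\<^sub>R u" using eq by (simp add: q_def)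
  then have "1 = q * q"
    using uu uT by (simp add: inner_scaleR_left inner_scaleR_right)
  then have "q = 1 \<or> q = -1"
    using square_eq_1_iff[of q] by simp
  then show ?thesis using \<open>u' = q *\<^sub>R u\<close> by auto
qed

text \<open>Expanding in one of the bases factors a determinant through the change-of-basis
  determinant \<open>q\<close>. The second claim serves the orientation, with \<open>L i\<close> a
  coordinate in a chart. The third compares coordinate determinants in the two bases; its case
  \<open>v = b\<close> says that \<open>q\<close> times the determinant of the transposed matrix is
  1, whence the first claim.\<close>

lemma det_change_of_orthonormal_basis:
  assumes b: "orthonormal (card B) b" and b': "orthonormal (card B) b'"
  defines "q \<equiv> Determinant.det (Matrix.mat (card B) (card B) (\<lambda>(i, j). g (b (i + 1)) (b' (j + 1))))"
  shows "q\<^sup>2 = 1"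
    and "\<And>L. (\<And>i. linear (L i)) \<Longrightarrow>
      Determinant.det (Matrix.mat (card B) (card B) (\<lambda>(i, j). L (i + 1) (b' (j + 1)) :: real)) =
      Determinant.det (Matrix.mat (card B) (card B) (\<lambda>(i, j). L (i + 1) (b (j + 1)))) * q"
    and "\<And>v. (\<And>j. 1 \<le> j \<Longrightarrow> j \<le> card B \<Longrightarrow> v j \<in> T) \<Longrightarrow>
      Determinant.det (Matrix.mat (card B) (card B) (\<lambda>(i, j). g (b (i + 1)) (v (j + 1)))) =
      q * Determinant.det (Matrix.mat (card B) (card B) (\<lambda>(i, j). g (b' (i + 1)) (v (j + 1))))"
proof -
  let ?n = "card B"
  have exp: "v = (\<Sum>i=1..?n. g (b i) v *\<^sub>R b i)" if "v \<in> T" for v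
  proof -
    have "(\<Sum>i=1..?n. g v (b i) *\<^sub>R b i) = (\<Sum>i=1..?n. g (b i) v *\<^sub>R b i)"
      using that b by (intro sum.cong) (auto simp: inner_commute orthonormalD)
    then show ?thesis using orthonormal_expansion[OF b that] by simp
  qed
  have exp': "v = (\<Sum>i=1..?n. g (b' i) v *\<^sub>R b' i)" if "v \<in> T" for v
  proof -
    have "(\<Sum>i=1..?n. g v (b' i) *\<^sub>R b' i) = (\<Sum>i=1..?n. g (b' i) v *\<^sub>R b' i)"
      using that b' by (intro sum.cong) (auto simp: inner_commute orthonormalD)
    then show ?thesis using orthonormal_expansion[OF b' that] by simp
  qed
  show L: "Determinant.det (Matrix.mat ?n ?n (\<lambda>(i, j). L (i + 1) (b' (j + 1)))) =
      Determinant.det (Matrix.mat ?n ?n (\<lambda>(i, j). L (i + 1) (b (j + 1)))) * q"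
    if lin: "\<And>i. linear (L i)" for L :: "nat \<Rightarrow> 'v \<Rightarrow> real"
  proof -
    have "L i (b' j) = (\<Sum>k=1..?n. L i (b k) * g (b k) (b' j))" if "1 \<le> j" "j \<le> ?n" for i j
    proof -
      have "L i (b' j) = L i (\<Sum>k=1..?n. g (b k) (b' j) *\<^sub>R b k)"
        using exp[of "b' j"] that b' by (simp add: orthonormalD)
      then show ?thesis
        using lin[of i] by (simp add: linear_sum linear_scale mult.commute)
    qed
    then have "Matrix.mat ?n ?n (\<lambda>(i, j). L (i + 1) (b' (j + 1))) =
        Matrix.mat ?n ?n (\<lambda>(i, j). \<Sum>k=1..?n. L (i + 1) (b k) * g (b k) (b' (j + 1)))"
      by (intro eq_matI) auto
    then show ?thesis
      by (simp only: det_mat_mult[of ?n "\<lambda>i k. L i (b k)" "\<lambda>k j. g (b k) (b' j)"] q_def)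
  qed
  show V: "Determinant.det (Matrix.mat ?n ?n (\<lambda>(i, j). g (b (i + 1)) (v (j + 1)))) =
      q * Determinant.det (Matrix.mat ?n ?n (\<lambda>(i, j). g (b' (i + 1)) (v (j + 1))))"
    if v: "\<And>j. 1 \<le> j \<Longrightarrow> j \<le> ?n \<Longrightarrow> v j \<in> T" for v
  proof -
    have "g (b i) (v j) = (\<Sum>k=1..?n. g (b i) (b' k) * g (b' k) (v j))"
      if "1 \<le> i" "i \<le> ?n" "1 \<le> j" "j \<le> ?n" for i j
    proof -
      have "g (b i) (v j) = g (b i) (\<Sum>k=1..?n. g (b' k) (v j) *\<^sub>R b' k)"
        using exp'[of "v j"] that v by simp
      also have "\<dots> = (\<Sum>k=1..?n. g (b' k) (v j) * g (b i) (b' k))"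
        using b b' that by (intro inner_sum_scaleR_right) (auto simp: orthonormalD)
      finally show ?thesis by (simp add: mult.commute)
    qed
    then have "Matrix.mat ?n ?n (\<lambda>(i, j). g (b (i + 1)) (v (j + 1))) =
        Matrix.mat ?n ?n (\<lambda>(i, j). \<Sum>k=1..?n. g (b (i + 1)) (b' k) * g (b' k) (v (j + 1)))"
      by (intro eq_matI) auto
    then show ?thesis
      by (simp only: det_mat_mult[of ?n "\<lambda>i k. g (b i) (b' k)" "\<lambda>k j. g (b' k) (v j)"] q_def)
  qed
  have "Matrix.mat ?n ?n (\<lambda>(i, j). g (b (i + 1)) (b (j + 1))) = 1\<^sub>m ?n"
    using b by (intro eq_matI) (auto simp: orthonormalD)
  then have "1 = q * Determinant.det (Matrix.mat ?n ?n (\<lambda>(i, j). g (b' (i + 1)) (b (j + 1))))"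
    using V[of b] b by (simp add: orthonormalD)
  also have "Matrix.mat ?n ?n (\<lambda>(i, j). g (b' (i + 1)) (b (j + 1))) =
      Matrix.mat ?n ?n (\<lambda>(i, j). g (b (j + 1)) (b' (i + 1)))"
    using b b' by (intro eq_matI) (auto simp: inner_commute orthonormalD)
  also have "Determinant.det \<dots> = q"
    unfolding q_def using det_mat_transpose[of ?n "\<lambda>i j. g (b (i + 1)) (b' (j + 1))"] by simp
  finally show "q\<^sup>2 = 1"
    by (simp add: power2_eq_square)
qed

text \<open>The span clause carries the induction: it puts the sum subtracted from
  \<open>v (Suc k)\<close> into the span of the preceding vectors, so that independence makes the
  residual \<open>w\<close> nonzero. The coefficient of \<open>v (Suc k)\<close> at the new vector
  is then the length of \<open>w\<close>, hence positive.\<close>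

lemma gram_schmidt:
  assumes vT: "\<And>i. 1 \<le> i \<Longrightarrow> i \<le> m \<Longrightarrow> v i \<in> T"
    and inj: "inj_on v {1..m}" and ind: "independent (v ` {1..m})"
  defines "e \<equiv> gram_schmidt_onb g v"
  shows "k \<le> m \<Longrightarrow> orthonormal k e \<and>
    (\<forall>i\<in>{1..k}. v i = (\<Sum>j=1..i. g (v i) (e j) *\<^sub>R e j) \<and> g (v i) (e i) > 0 \<and> e i \<in> span (v ` {1..i}))"
proof (induction k)
  case 0
  then show ?case by (simp add: orthonormal_def)
next
  case (Suc k)
  then have on: "orthonormal k e"
    and IH: "\<And>i. i \<in> {1..k} \<Longrightarrow> v i = (\<Sum>j=1..i. g (v i) (e j) *\<^sub>R e j)"
      "\<And>i. i \<in> {1..k} \<Longrightarrow> g (v i) (e i) > 0" "\<And>i. i \<in> {1..k} \<Longrightarrow> e i \<in> span (v ` {1..i})"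
    by auto
  let ?v = "v (Suc k)"
  define w where "w = ?v - (\<Sum>j=1..k. g ?v (e j) *\<^sub>R e j)"
  have vS: "?v \<in> T" using vT Suc.prems by simp
  have eq: "e (Suc k) = (1 / sqrt (g w w)) *\<^sub>R w"
    unfolding e_def gram_schmidt_onb.simps[of g v "Suc k"]
    by (simp add: Let_def w_def e_def atLeastLessThanSuc_atLeastAtMost)
  have wT: "w \<in> T"
    unfolding w_def using on vS by (intro diff_in sum_in scaleR_in) (auto simp: orthonormalD)
  have esp: "e j \<in> span (v ` {1..k})" if "j \<in> {1..k}" for j
    using IH(3)[OF that] that span_mono[of "v ` {1..j}" "v ` {1..k}"] by fastforce
  have sum_sp: "(\<Sum>j=1..k. g ?v (e j) *\<^sub>R e j) \<in> span (v ` {1..k})"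
    using esp by (intro span_sum span_scale) auto
  have "w \<noteq> 0"
  proof
    assume "w = 0"
    then have "?v \<in> span (v ` {1..k})" using sum_sp by (simp add: w_def)
    \<comment> \<open>Injectivity ensures that no earlier vector is removed together with
      \<open>?v\<close>.\<close>
    moreover have "v ` {1..k} \<subseteq> v ` {1..m} - {?v}"
    proof (rule image_subsetI)
      fix i assume "i \<in> {1..k}"
      then show "v i \<in> v ` {1..m} - {?v}"
        using Suc.prems inj_onD[OF inj, of i "Suc k"] by auto
    qed
    ultimately have "?v \<in> span (v ` {1..m} - {?v})"
      using span_mono by blast
    moreover have "?v \<in> v ` {1..m}" using Suc.prems by auto
    ultimately show False using ind dependent_def by blast
  qed
  then have pos: "g w w > 0" using wT inner_pos by blast
  have we: "g w (e j) = 0" if "1 \<le> j" "j \<le> k" for j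
    unfolding w_def using orthonormal_residual[OF on vS] that by auto
  have ew: "g (e j) w = 0" if "1 \<le> j" "j \<le> k" for j
    using we[OF that] that on wT by (subst inner_commute) (auto simp: orthonormalD)
  have eT: "e (Suc k) \<in> T" by (simp add: eq wT)
  have e1: "g (e (Suc k)) (e (Suc k)) = 1"
    using pos wT by (simp add: eq inner_scaleR_left inner_scaleR_right)
  have e0: "g (e (Suc k)) (e j) = 0" "g (e j) (e (Suc k)) = 0" if "1 \<le> j" "j \<le> k" for j
    using we[OF that] ew[OF that] that on wT
    by (auto simp: eq inner_scaleR_left inner_scaleR_right orthonormalD)
  have on': "orthonormal (Suc k) e"
    unfolding orthonormal_def using on eT e1 e0
    by (auto simp: orthonormalD le_Suc_eq)
  have wsq: "w = sqrt (g w w) *\<^sub>R e (Suc k)"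
    using pos by (simp add: eq)
  have v_eq: "?v = (\<Sum>j=1..k. g ?v (e j) *\<^sub>R e j) + sqrt (g w w) *\<^sub>R e (Suc k)"
    using wsq by (simp add: w_def)
  \<comment> \<open>The expansion of \<open>?v\<close> with a single coefficient function, so that
    \<open>orthonormal_coefficient\<close> reads off the last coefficient.\<close>
  define r where "r = (\<lambda>j. if j = Suc k then sqrt (g w w) else g ?v (e j))"
  have "?v = (\<Sum>j=1..Suc k. r j *\<^sub>R e j)"
    unfolding r_def using v_eq by simp
  then have "g ?v (e (Suc k)) = r (Suc k)"
    using orthonormal_coefficient[OF on', of "Suc k" r] by simp
  then have l: "g ?v (e (Suc k)) = sqrt (g w w)"
    by (simp add: r_def)
  have "?v = (\<Sum>j=1..Suc k. g ?v (e j) *\<^sub>R e j)"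
    using v_eq l by simp
  moreover have "g ?v (e (Suc k)) > 0" using l pos by simp
  moreover have "e (Suc k) \<in> span (v ` {1..Suc k})"
  proof -
    have "v ` {1..k} \<subseteq> v ` {1..Suc k}" by (intro image_mono) simp
    then have "(\<Sum>j=1..k. g ?v (e j) *\<^sub>R e j) \<in> span (v ` {1..Suc k})"
      using sum_sp span_mono by blast
    then have "w \<in> span (v ` {1..Suc k})"
      unfolding w_def by (intro span_diff) (simp_all add: span_base)
    then show ?thesis by (simp add: eq span_scale)
  qed
  ultimately have new: "?v = (\<Sum>j=1..Suc k. g ?v (e j) *\<^sub>R e j) \<and> g ?v (e (Suc k)) > 0 \<and>
      e (Suc k) \<in> span (v ` {1..Suc k})"
    by blast
  have "v i = (\<Sum>j=1..i. g (v i) (e j) *\<^sub>R e j) \<and> g (v i) (e i) > 0 \<and> e i \<in> span (v ` {1..i})"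
    if "i \<in> {1..Suc k}" for i
  proof (cases "i = Suc k")
    case True
    then show ?thesis using new by blast
  next
    case False
    then have "i \<in> {1..k}" using that by simp
    then show ?thesis using IH by blast
  qed
  then show ?case
    using on' by blast
qed

text \<open>The vectors \<open>e j\<close> with \<open>j <= i\<close>, which suffice to expand
  \<open>v i\<close>, are orthogonal to \<open>e l\<close>.\<close>

lemma gram_schmidt_triangular:
  assumes "orthonormal m e" "v i = (\<Sum>j=1..i. g (v i) (e j) *\<^sub>R e j)" "i < l" "l \<le> m"
  shows "g (v i) (e l) = 0"
proof -
  have "g (v i) (e l) = g (\<Sum>j=1..i. g (v i) (e j) *\<^sub>R e j) (e l)"
    using assms(2) by simp
  also have "\<dots> = (\<Sum>j=1..i. g (v i) (e j) * g (e j) (e l))"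
    using assms by (intro inner_sum_scaleR_left) (auto simp: orthonormalD)
  also have "\<dots> = 0"
    using assms by (intro sum.neutral) (auto simp: orthonormalD)
  finally show ?thesis .
qed

text \<open>The Gram matrix is L times its transpose, where L, with entries
  \<open>g (v i) (e l)\<close>, is lower triangular.\<close>

lemma det_gram_matrix:
  assumes on: "orthonormal k e" and v: "\<And>i. i \<in> {1..k} \<Longrightarrow> v i = (\<Sum>j=1..i. g (v i) (e j) *\<^sub>R e j)"
  shows "Determinant.det (Matrix.mat k k (\<lambda>(i, j). g (v (i + 1)) (v (j + 1)))) =
    (\<Prod>i=1..k. g (v i) (e i))\<^sup>2"
proof -
  have vT: "v i \<in> T" if "i \<in> {1..k}" for i
    by (subst v[OF that], intro sum_in scaleR_in) (use that on in \<open>auto simp: orthonormalD\<close>)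
  have tri: "g (v i) (e l) = 0" if "1 \<le> i" "i < l" "l \<le> k" for i l
    using gram_schmidt_triangular[OF on, where v = v and i = i and l = l] v that by auto
  have exp: "v i = (\<Sum>j=1..k. g (v i) (e j) *\<^sub>R e j)" if "i \<in> {1..k}" for i
  proof -
    have "(\<Sum>j=1..k. g (v i) (e j) *\<^sub>R e j) = (\<Sum>j=1..i. g (v i) (e j) *\<^sub>R e j)"
      using that tri by (intro sum.mono_neutral_right) auto
    then show ?thesis using v[OF that] by simp
  qed
  have "g (v i) (v j) = (\<Sum>l=1..k. g (v i) (e l) * g (v j) (e l))"
    if "i \<in> {1..k}" "j \<in> {1..k}" for i j
  proof -
    have "g (v i) (v j) = g (v i) (\<Sum>l=1..k. g (v j) (e l) *\<^sub>R e l)"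
      using exp[OF that(2)] by simp
    also have "\<dots> = (\<Sum>l=1..k. g (v j) (e l) * g (v i) (e l))"
      using that vT on by (intro inner_sum_scaleR_right) (auto simp: orthonormalD)
    finally show ?thesis by (simp add: mult.commute)
  qed
  then have "Matrix.mat k k (\<lambda>(i, j). g (v (i + 1)) (v (j + 1))) =
      Matrix.mat k k (\<lambda>(i, j). \<Sum>l=1..k. g (v (i + 1)) (e l) * g (v (j + 1)) (e l))"
    by (intro eq_matI) auto
  also have "Determinant.det \<dots> =
      Determinant.det (Matrix.mat k k (\<lambda>(i, j). g (v (i + 1)) (e (j + 1)))) *
      Determinant.det (Matrix.mat k k (\<lambda>(i, j). g (v (j + 1)) (e (i + 1))))"
    by (rule det_mat_mult[of k "\<lambda>i l. g (v i) (e l)" "\<lambda>l j. g (v j) (e l)"])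
  also have "\<dots> = (\<Prod>i=1..k. g (v i) (e i)) * (\<Prod>i=1..k. g (v i) (e i))"
    using tri det_mat_lower_triangular[of k "\<lambda>i l. g (v i) (e l)"]
      det_mat_upper_triangular[of k "\<lambda>l i. g (v i) (e l)"] by simp
  finally show ?thesis by (simp add: power2_eq_square)
qed

end

subsection \<open>Repeated differentiability\<close>

text \<open>A form of $k$-fold differentiability that, unlike \<^const>\<open>Ck_on\<close>, asks for no continuity of
  the last derivative and does not fix a choice of the derivative.\<close>

primrec times_differentiable ::
    "nat \<Rightarrow> 'v::real_normed_vector set \<Rightarrow> ('v \<Rightarrow> 'w::real_normed_vector) \<Rightarrow> bool" where
  "times_differentiable 0 S f \<longleftrightarrow> True"
| "times_differentiable (Suc k) S f \<longleftrightarrow> (\<exists>f'. (\<forall>x\<in>S. (f has_derivative f' x) (at x within S)) \<and>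
     (\<forall>v. times_differentiable k S (\<lambda>x. f' x v)))"

lemma Ck_on_times_differentiable: "Ck_on k S f \<Longrightarrow> times_differentiable k S f"
proof (induction k arbitrary: f)
  case (Suc k)
  then have "f differentiable_on S" and d: "\<And>v. Ck_on k S (\<lambda>x. frechet_derivative f (at x within S) v)"
    by auto
  then have "\<forall>x\<in>S. (f has_derivative frechet_derivative f (at x within S)) (at x within S)"
    using frechet_derivative_works by (auto simp: differentiable_on_def)
  then show ?case
    using Suc.IH[OF d] unfolding times_differentiable.simps
    by (intro exI[of _ "\<lambda>x. frechet_derivative f (at x within S)"] conjI) auto
qed simp

lemma smooth_on_times_differentiable: "smooth_on S f \<Longrightarrow> times_differentiable k S f"
  by (simp add: smooth_on_def Ck_on_times_differentiable)

lemma times_differentiable_cong: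
  assumes "\<And>x. x \<in> S \<Longrightarrow> f x = h x" "times_differentiable k S f"
  shows "times_differentiable k S h"
proof (cases k)
  case (Suc m)
  then obtain f' where f': "\<forall>x\<in>S. (f has_derivative f' x) (at x within S)"
      "\<forall>v. times_differentiable m S (\<lambda>x. f' x v)"
    using assms(2) by auto
  have "(h has_derivative f' x) (at x within S)" if "x \<in> S" for x
    using f'(1) that assms(1) has_derivative_transform[of x S h f "f' x"] by auto
  then show ?thesis using f'(2) Suc by auto
qed simp

lemma times_differentiable_Suc: "times_differentiable (Suc k) S f \<Longrightarrow> times_differentiable k S f"
proof (induction k arbitrary: f)
  case (Suc k)
  obtain f' where f': "\<forall>x\<in>S. (f has_derivative f' x) (at x within S)"
      "\<forall>v. times_differentiable (Suc k) S (\<lambda>x. f' x v)"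
    using Suc.prems unfolding times_differentiable.simps(2)[of "Suc k"] by (elim exE conjE)
  show ?case
    unfolding times_differentiable.simps(2)[of k] using f' Suc.IH by blast
qed simp

lemma times_differentiable_mono: "times_differentiable k S f \<Longrightarrow> m \<le> k \<Longrightarrow> times_differentiable m S f"
proof (induction k)
  case (Suc k)
  then show ?case
    using times_differentiable_Suc[of k S f] by (cases "m = Suc k") auto
qed simp

lemma times_differentiable_const: "times_differentiable k S (\<lambda>x. c)"
proof (induction k arbitrary: c)
  case (Suc k)
  show ?case
    unfolding times_differentiable.simps using Suc.IH by (intro exI[of _ "\<lambda>x v. 0"]) auto
qed simp

lemma times_differentiable_add:
  "times_differentiable k S f \<Longrightarrow> times_differentiable k S h \<Longrightarrow> times_differentiable k S (\<lambda>x. f x + h x)"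
proof (induction k arbitrary: f h)
  case (Suc k)
  obtain f' where f': "\<forall>x\<in>S. (f has_derivative f' x) (at x within S)"
      "\<forall>v. times_differentiable k S (\<lambda>x. f' x v)"
    using Suc.prems(1) by auto
  obtain h' where h': "\<forall>x\<in>S. (h has_derivative h' x) (at x within S)"
      "\<forall>v. times_differentiable k S (\<lambda>x. h' x v)"
    using Suc.prems(2) by auto
  have "times_differentiable k S (\<lambda>x. f' x v + h' x v)" for v
    using Suc.IH f'(2) h'(2) by blast
  moreover have "\<forall>x\<in>S. ((\<lambda>x. f x + h x) has_derivative (\<lambda>v. f' x v + h' x v)) (at x within S)"
    using f'(1) h'(1) by (auto intro: has_derivative_add)
  ultimately show ?case
    unfolding times_differentiable.simps by (intro exI[of _ "\<lambda>x v. f' x v + h' x v"]) simp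
qed simp

lemma times_differentiable_bounded_linear:
  assumes "bounded_linear L"
  shows "times_differentiable k S f \<Longrightarrow> times_differentiable k S (\<lambda>x. L (f x))"
proof (induction k arbitrary: f)
  case (Suc k)
  obtain f' where f': "\<forall>x\<in>S. (f has_derivative f' x) (at x within S)"
      "\<forall>v. times_differentiable k S (\<lambda>x. f' x v)"
    using Suc.prems(1) by auto
  have "\<forall>x\<in>S. ((\<lambda>x. L (f x)) has_derivative (\<lambda>v. L (f' x v))) (at x within S)"
    using f'(1) by (auto intro: bounded_linear.has_derivative[OF assms])
  moreover have "times_differentiable k S (\<lambda>x. L (f' x v))" for v
    using Suc.IH f'(2) by blast
  ultimately show ?case
    unfolding times_differentiable.simps by (intro exI[of _ "\<lambda>x v. L (f' x v)"]) simp
qed simp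

lemma times_differentiable_scaleR:
  fixes f :: "'v::real_normed_vector \<Rightarrow> real"
  shows "times_differentiable k S f \<Longrightarrow> times_differentiable k S h \<Longrightarrow>
    times_differentiable k S (\<lambda>x. f x *\<^sub>R h x)"
proof (induction k arbitrary: f h)
  case (Suc k)
  obtain f' where f': "\<forall>x\<in>S. (f has_derivative f' x) (at x within S)"
      "\<forall>v. times_differentiable k S (\<lambda>x. f' x v)"
    using Suc.prems(1) unfolding times_differentiable.simps by (elim exE conjE)
  obtain h' where h': "\<forall>x\<in>S. (h has_derivative h' x) (at x within S)"
      "\<forall>v. times_differentiable k S (\<lambda>x. h' x v)"
    using Suc.prems(2) unfolding times_differentiable.simps by (elim exE conjE)
  have "times_differentiable k S (\<lambda>x. f x *\<^sub>R h' x v + f' x v *\<^sub>R h x)" for v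
    by (rule times_differentiable_add[OF Suc.IH[OF times_differentiable_Suc[OF Suc.prems(1)] h'(2)[rule_format]]
          Suc.IH[OF f'(2)[rule_format] times_differentiable_Suc[OF Suc.prems(2)]]])
  moreover have "\<forall>x\<in>S. ((\<lambda>x. f x *\<^sub>R h x) has_derivative (\<lambda>v. f x *\<^sub>R h' x v + f' x v *\<^sub>R h x)) (at x within S)"
    using f'(1) h'(1) by (auto intro!: has_derivative_scaleR)
  ultimately show ?case
    unfolding times_differentiable.simps
    by (intro exI[of _ "\<lambda>x v. f x *\<^sub>R h' x v + f' x v *\<^sub>R h x"]) simp
qed simp

lemma times_differentiable_mult:
  fixes f h :: "'v::real_normed_vector \<Rightarrow> real"
  shows "times_differentiable k S f \<Longrightarrow> times_differentiable k S h \<Longrightarrow>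
    times_differentiable k S (\<lambda>x. f x * h x)"
  using times_differentiable_scaleR[of k S f h] by simp

lemma times_differentiable_cmult:
  fixes f :: "'v::real_normed_vector \<Rightarrow> real"
  shows "times_differentiable k S f \<Longrightarrow> times_differentiable k S (\<lambda>x. r * f x)"
  by (intro times_differentiable_mult times_differentiable_const)

lemma times_differentiable_diff:
  fixes f h :: "'v::real_normed_vector \<Rightarrow> real"
  assumes "times_differentiable k S f" "times_differentiable k S h"
  shows "times_differentiable k S (\<lambda>x. f x - h x)"
  using times_differentiable_add[OF assms(1) times_differentiable_cmult[OF assms(2), of "-1"]] by simp

lemma times_differentiable_sum:
  "(\<And>i. i \<in> A \<Longrightarrow> times_differentiable k S (f i)) \<Longrightarrow> times_differentiable k S (\<lambda>x. \<Sum>i\<in>A. f i x)"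
  by (induction A rule: infinite_finite_induct)
    (auto intro: times_differentiable_add times_differentiable_const)

lemma times_differentiable_prod:
  fixes f :: "'i \<Rightarrow> 'v::real_normed_vector \<Rightarrow> real"
  shows "(\<And>i. i \<in> A \<Longrightarrow> times_differentiable k S (f i)) \<Longrightarrow> times_differentiable k S (\<lambda>x. \<Prod>i\<in>A. f i x)"
  by (induction A rule: infinite_finite_induct)
    (auto intro: times_differentiable_mult times_differentiable_const)

lemma times_differentiable_inverse:
  fixes f :: "'v::real_normed_vector \<Rightarrow> real"
  assumes "\<And>x. x \<in> S \<Longrightarrow> f x \<noteq> 0"
  shows "times_differentiable k S f \<Longrightarrow> times_differentiable k S (\<lambda>x. inverse (f x))"
proof (induction k)
  case (Suc k)
  obtain f' where f': "\<forall>x\<in>S. (f has_derivative f' x) (at x within S)"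
      "\<forall>v. times_differentiable k S (\<lambda>x. f' x v)"
    using Suc.prems(1) by auto
  have inv: "times_differentiable k S (\<lambda>x. inverse (f x))"
    using Suc.IH times_differentiable_Suc[OF Suc.prems] by blast
  have "times_differentiable k S (\<lambda>x. - 1 * (inverse (f x) * f' x v * inverse (f x)))" for v
    by (intro times_differentiable_cmult times_differentiable_mult inv) (use f'(2) in blast)
  then have "times_differentiable k S (\<lambda>x. - (inverse (f x) * f' x v * inverse (f x)))" for v
    by simp
  moreover have "\<forall>x\<in>S. ((\<lambda>x. inverse (f x)) has_derivative (\<lambda>v. - (inverse (f x) * f' x v * inverse (f x)))) (at x within S)"
    using f'(1) assms by (auto intro!: has_derivative_inverse)
  ultimately show ?case
    unfolding times_differentiable.simps
    by (intro exI[of _ "\<lambda>x v. - (inverse (f x) * f' x v * inverse (f x))"]) simp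
qed simp

text \<open>The derivative \<open>h' (f x) (f' x v)\<close> evaluates \<open>h'\<close> in a
  direction that varies with \<open>x\<close>, while the definition controls \<open>h'\<close> in
  fixed directions; expanding \<open>f' x v\<close> over \<open>Basis\<close> restores these. The
  induction keeps \<open>f\<close> fixed and varies \<open>h\<close>, so that \<open>h'\<close>
  along a basis vector falls under the induction hypothesis.\<close>

lemma times_differentiable_compose:
  fixes h :: "'b::euclidean_space \<Rightarrow> 'c::real_normed_vector"
  assumes "f ` S \<subseteq> U" and f: "times_differentiable k S f"
  shows "times_differentiable k U h \<Longrightarrow> times_differentiable k S (\<lambda>x. h (f x))"
  using f
proof (induction k arbitrary: h)
  case (Suc k)
  obtain f' where f': "\<forall>x\<in>S. (f has_derivative f' x) (at x within S)"
      "\<forall>v. times_differentiable k S (\<lambda>x. f' x v)"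
    using Suc.prems(2) by auto
  obtain h' where h': "\<forall>x\<in>U. (h has_derivative h' x) (at x within U)"
      "\<forall>v. times_differentiable k U (\<lambda>x. h' x v)"
    using Suc.prems(1) by auto
  define d where "d = (\<lambda>x v. \<Sum>b\<in>Basis. (f' x v \<bullet> b) *\<^sub>R h' (f x) b)"
  have "((\<lambda>x. h (f x)) has_derivative d x) (at x within S)" if x: "x \<in> S" for x
  proof -
    have hx: "(h has_derivative h' (f x)) (at (f x) within U)"
      using h'(1) assms(1) x by blast
    then have lin: "linear (h' (f x))"
      using has_derivative_bounded_linear bounded_linear.linear by blast
    have "((\<lambda>x. h (f x)) has_derivative (\<lambda>v. h' (f x) (f' x v))) (at x within S)"
      using f'(1) x assms(1) hx has_derivative_in_compose[of f "f' x" x S h "h' (f x)"]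
        has_derivative_subset by blast
    moreover have "h' (f x) (f' x v) = d x v" for v
    proof -
      have "h' (f x) (f' x v) = h' (f x) (\<Sum>b\<in>Basis. (f' x v \<bullet> b) *\<^sub>R b)"
        by (simp add: euclidean_representation)
      then show ?thesis
        by (simp add: d_def linear_sum[OF lin] linear_scale[OF lin])
    qed
    ultimately show ?thesis by (simp add: fun_eq_iff)
  qed
  moreover have "times_differentiable k S (\<lambda>x. d x v)" for v
    unfolding d_def
  proof (intro times_differentiable_sum times_differentiable_scaleR)
    fix b :: 'b
    show "times_differentiable k S (\<lambda>x. f' x v \<bullet> b)"
      using f'(2) times_differentiable_bounded_linear[OF bounded_linear_inner_left] by blast
    show "times_differentiable k S (\<lambda>x. h' (f x) b)"
      using Suc.IH h'(2) times_differentiable_Suc[OF Suc.prems(2)] by blast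
  qed
  ultimately show ?case
    unfolding times_differentiable.simps by (intro exI[of _ d]) blast
qed simp

lemma times_differentiable_component:
  fixes f :: "'v::real_normed_vector \<Rightarrow> real ^ 'n"
  shows "times_differentiable k S f \<Longrightarrow> times_differentiable k S (\<lambda>x. f x $ i)"
  using times_differentiable_bounded_linear[OF bounded_linear_vec_nth] by blast

lemma times_differentiable_vec:
  fixes f :: "'v::real_normed_vector \<Rightarrow> real ^ 'n"
  assumes "\<And>i. times_differentiable k S (\<lambda>x. f x $ i)"
  shows "times_differentiable k S f"
proof -
  have "times_differentiable k S (\<lambda>x. \<Sum>i\<in>UNIV. f x $ i *\<^sub>R axis i (1::real))"
    by (intro times_differentiable_sum times_differentiable_scaleR assms times_differentiable_const)
  moreover have "(\<Sum>i\<in>UNIV. f x $ i *\<^sub>R axis i (1::real)) = f x" for x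
    using basis_expansion[of "f x"] by (simp add: scalar_mult_eq_scaleR)
  ultimately show ?thesis by (rule times_differentiable_cong[rotated])
qed

lemma times_differentiable_det:
  fixes G :: "'v::real_normed_vector \<Rightarrow> real ^ 'n ^ 'n"
  assumes "\<And>i j. times_differentiable k S (\<lambda>x. G x $ i $ j)"
  shows "times_differentiable k S (\<lambda>x. Determinants.det (G x))"
  unfolding Determinants.det_def
  by (intro times_differentiable_sum times_differentiable_mult times_differentiable_prod
      times_differentiable_const assms)

section \<open>Differentiable dependence of the inverse matrix\<close>

lemma matrix_inv_right:
  fixes A :: "real ^ 'n ^ 'n"
  assumes "invertible A"
  shows "A ** matrix_inv A = Finite_Cartesian_Product.mat 1"
  using someI_ex[OF assms[unfolded invertible_def]] unfolding matrix_inv_def by (rule conjunct1)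

text \<open>\<open>matrix_inv\<close> is defined by a choice; Cramer's rule turns its entries into
  quotients of determinants, whose differentiability can be read off.\<close>

lemma matrix_inv_cramer:
  fixes A :: "real ^ 'n ^ 'n"
  assumes "Determinants.det A \<noteq> 0"
  shows "matrix_inv A $ i $ j =
    Determinants.det (\<chi> r s. if s = i then axis j 1 $ r else A $ r $ s) * inverse (Determinants.det A)"
proof -
  have "A ** matrix_inv A = Finite_Cartesian_Product.mat 1"
    using assms invertible_det_nz[of A] matrix_inv_right by blast
  then have "A *v (matrix_inv A *v axis j 1) = axis j 1"
    by (simp add: matrix_vector_mul_assoc)
  then have "matrix_inv A *v axis j 1 =
      (\<chi> k. Determinants.det (\<chi> r s. if s = k then axis j 1 $ r else A $ r $ s) / Determinants.det A)"
    using cramer[OF assms] by blast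
  moreover have "(matrix_inv A *v axis j 1) $ i = matrix_inv A $ i $ j"
    by (simp add: matrix_vector_mult_basis column_def)
  ultimately show ?thesis by (simp add: divide_inverse)
qed

lemma times_differentiable_matrix_inv:
  fixes G :: "'v::real_normed_vector \<Rightarrow> real ^ 'n ^ 'n"
  assumes G: "\<And>i j. times_differentiable k S (\<lambda>x. G x $ i $ j)"
    and nz: "\<And>x. x \<in> S \<Longrightarrow> Determinants.det (G x) \<noteq> 0"
  shows "times_differentiable k S (\<lambda>x. matrix_inv (G x) $ i $ j)"
proof -
  have "times_differentiable k S (\<lambda>x. Determinants.det (\<chi> r s. if s = i then axis j 1 $ r else G x $ r $ s) *
      inverse (Determinants.det (G x)))"
  proof (intro times_differentiable_mult times_differentiable_inverse times_differentiable_det nz G)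
    fix r s
    show "times_differentiable k S (\<lambda>x. (\<chi> r s. if s = i then axis j 1 $ r else G x $ r $ s) $ r $ s)"
      using G by (cases "s = i") (auto simp: times_differentiable_const)
  qed auto
  then show ?thesis
    by (rule times_differentiable_cong[rotated]) (simp add: matrix_inv_cramer nz)
qed

text \<open>With p(s) = f(x + s u + h v) - f(x + s u), the second difference is p(h) - p(0). The
  mean value theorem turns it into h times a difference of first derivatives along \<open>u\<close>,
  and differentiability of these at \<open>x\<close> approximates that difference by h A v up to a
  small multiple of h.\<close>

lemma second_difference:
  fixes f :: "'v::real_normed_vector \<Rightarrow> real"
  assumes U: "open U" "x \<in> U" and f': "\<And>y. y \<in> U \<Longrightarrow> (f has_derivative f' y) (at y)"
    and A: "((\<lambda>y. f' y u) has_derivative A) (at x)" and e: "e > 0"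
  shows "\<exists>d>0. \<forall>h. 0 < h \<longrightarrow> h < d \<longrightarrow>
    \<bar>f (x + h *\<^sub>R u + h *\<^sub>R v) - f (x + h *\<^sub>R u) - f (x + h *\<^sub>R v) + f x - h\<^sup>2 * A v\<bar> \<le> e * h\<^sup>2"
proof -
  \<comment> \<open>The displacements z u + h v and z u, with 0 < z < h, have norms adding up to at
    most h (2 norm u + norm v); the summand 1 makes \<open>?K\<close> positive. A relative error of
    \<open>e / ?K\<close> at each then yields a total of at most e h.\<close>
  let ?K = "2 * norm u + norm v + 1"
  have K: "?K > 0" by (simp add: add_nonneg_pos)
  then have eK: "e / ?K > 0" using e by simp
  obtain d1 where d1: "d1 > 0" and err: "\<And>y. norm (y - x) < d1 \<Longrightarrow>
      \<bar>f' y u - f' x u - A (y - x)\<bar> \<le> e / ?K * norm (y - x)"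
    using A eK unfolding has_derivative_at_alt by (auto simp: real_norm_def)
  obtain d2 where d2: "d2 > 0" "ball x d2 \<subseteq> U"
    using U open_contains_ball by blast
  have linA: "linear A" using A has_derivative_bounded_linear bounded_linear.linear by blast
  define d where "d = min d1 d2 / ?K"
  have "d > 0" using d1 d2 K by (simp add: d_def)
  moreover have "\<bar>f (x + h *\<^sub>R u + h *\<^sub>R v) - f (x + h *\<^sub>R u) - f (x + h *\<^sub>R v) + f x - h\<^sup>2 * A v\<bar> \<le> e * h\<^sup>2"
    if h: "0 < h" "h < d" for h
  proof -
    have hK: "h * ?K < min d1 d2" using h K by (simp add: d_def pos_less_divide_eq)
    have small: "norm (s *\<^sub>R u + t *\<^sub>R v) \<le> h * (norm u + norm v)" "h * (norm u + norm v) < min d1 d2"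
      if "0 \<le> s" "s \<le> h" "0 \<le> t" "t \<le> h" for s t
    proof -
      have "norm (s *\<^sub>R u + t *\<^sub>R v) \<le> s * norm u + t * norm v"
        using norm_triangle_ineq[of "s *\<^sub>R u" "t *\<^sub>R v"] that by simp
      also have "\<dots> \<le> h * norm u + h * norm v"
        using that by (intro add_mono mult_right_mono) auto
      finally show "norm (s *\<^sub>R u + t *\<^sub>R v) \<le> h * (norm u + norm v)" by (simp add: algebra_simps)
      have "h * (norm u + norm v) \<le> h * ?K" using h by (intro mult_left_mono) auto
      then show "h * (norm u + norm v) < min d1 d2" using hK by linarith
    qed
    have inU: "x + s *\<^sub>R u + t *\<^sub>R v \<in> U" if "0 \<le> s" "s \<le> h" "0 \<le> t" "t \<le> h" for s t
    proof -
      have "norm (s *\<^sub>R u + t *\<^sub>R v) < d2" using small[OF that] by linarith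
      then show ?thesis using d2(2) by (auto simp: dist_norm subset_iff norm_minus_commute add.assoc)
    qed
    \<comment> \<open>The vanishing multiple of \<open>v\<close> keeps both terms in the shape x + s
      u + t v, so that \<open>line\<close>, \<open>inU\<close> and \<open>E\<close> apply with t = h
      and with t = 0.\<close>
    define p where "p = (\<lambda>s. f (x + s *\<^sub>R u + h *\<^sub>R v) - f (x + s *\<^sub>R u + 0 *\<^sub>R v))"
    have line: "((\<lambda>s. f (x + s *\<^sub>R u + t *\<^sub>R v)) has_derivative (\<lambda>r. f' (x + s *\<^sub>R u + t *\<^sub>R v) (r *\<^sub>R u))) (at s)"
      if "0 \<le> s" "s \<le> h" "0 \<le> t" "t \<le> h" for s t
    proof -
      have "((\<lambda>s. x + s *\<^sub>R u + t *\<^sub>R v) has_derivative (\<lambda>r. r *\<^sub>R u)) (at s)"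
        by (auto intro!: derivative_eq_intros)
      then show ?thesis
        using has_derivative_compose f'[OF inU[OF that]] by blast
    qed
    have scale: "f' y (r *\<^sub>R u) = f' y u * r" if "y \<in> U" for y r
      using linear_scale[OF bounded_linear.linear[OF has_derivative_bounded_linear[OF f'[OF that]]]] by simp
    have "(p has_real_derivative f' (x + s *\<^sub>R u + h *\<^sub>R v) u - f' (x + s *\<^sub>R u + 0 *\<^sub>R v) u) (at s)"
      if "0 \<le> s" "s \<le> h" for s
      unfolding p_def
    proof (rule DERIV_diff)
      show "((\<lambda>s. f (x + s *\<^sub>R u + h *\<^sub>R v)) has_real_derivative f' (x + s *\<^sub>R u + h *\<^sub>R v) u) (at s)"
        unfolding has_field_derivative_def
        using line[of s h] scale[OF inU[of s h]] that h by (simp add: fun_eq_iff)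
      show "((\<lambda>s. f (x + s *\<^sub>R u + 0 *\<^sub>R v)) has_real_derivative f' (x + s *\<^sub>R u + 0 *\<^sub>R v) u) (at s)"
        unfolding has_field_derivative_def
        using line[of s 0] scale[OF inU[of s 0]] that h by (simp add: fun_eq_iff)
    qed
    then obtain z where z: "0 < z" "z < h"
      and pz: "p h - p 0 = (h - 0) * (f' (x + z *\<^sub>R u + h *\<^sub>R v) u - f' (x + z *\<^sub>R u + 0 *\<^sub>R v) u)"
      using MVT2[of 0 h p "\<lambda>s. f' (x + s *\<^sub>R u + h *\<^sub>R v) u - f' (x + s *\<^sub>R u + 0 *\<^sub>R v) u"] h by blast
    have E: "\<bar>f' (x + z *\<^sub>R u + t *\<^sub>R v) u - f' x u - A (z *\<^sub>R u + t *\<^sub>R v)\<bar> \<le> e / ?K * norm (z *\<^sub>R u + t *\<^sub>R v)"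
      if "0 \<le> t" "t \<le> h" for t
    proof -
      have eq: "x + z *\<^sub>R u + t *\<^sub>R v - x = z *\<^sub>R u + t *\<^sub>R v" by simp
      have "norm (z *\<^sub>R u + t *\<^sub>R v) < d1" using small[of z t] z that by linarith
      then show ?thesis using err[of "x + z *\<^sub>R u + t *\<^sub>R v"] unfolding eq by blast
    qed
    let ?a = "f' (x + z *\<^sub>R u + h *\<^sub>R v) u" and ?b = "f' (x + z *\<^sub>R u + 0 *\<^sub>R v) u"
    have Ah: "A (z *\<^sub>R u + h *\<^sub>R v) = A (z *\<^sub>R u) + h * A v" "A (z *\<^sub>R u + 0 *\<^sub>R v) = A (z *\<^sub>R u)"
      by (simp_all add: linear_add[OF linA] linear_scale[OF linA])
    have n1: "norm (z *\<^sub>R u + h *\<^sub>R v) \<le> h * (norm u + norm v)" using small[of z h] z h by auto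
    have n2: "norm (z *\<^sub>R u + 0 *\<^sub>R v) \<le> h * norm u" using z h by (simp add: mult_right_mono)
    have "\<bar>?a - ?b - h * A v\<bar> \<le> e / ?K * norm (z *\<^sub>R u + h *\<^sub>R v) + e / ?K * norm (z *\<^sub>R u + 0 *\<^sub>R v)"
      using E[of h] E[of 0] h unfolding Ah by linarith
    also have "\<dots> \<le> e / ?K * (h * (norm u + norm v)) + e / ?K * (h * norm u)"
      using n1 n2 eK by (intro add_mono mult_left_mono) auto
    also have "\<dots> = e / ?K * (h * (?K - 1))"
    proof -
      have "c * (h * (a + b)) + c * (h * a) = c * (h * (2 * a + b + 1 - 1))" for a b c :: real
        by (simp add: algebra_simps)
      then show ?thesis by blast
    qed
    also have "\<dots> \<le> e / ?K * (h * ?K)"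
      using eK h by (intro mult_left_mono) auto
    also have "\<dots> = e * h" using K by simp
    finally have ab: "\<bar>?a - ?b - h * A v\<bar> \<le> e * h" .
    have "f (x + h *\<^sub>R u + h *\<^sub>R v) - f (x + h *\<^sub>R u) - f (x + h *\<^sub>R v) + f x - h\<^sup>2 * A v =
        h * (?a - ?b - h * A v)"
      using pz by (simp add: p_def algebra_simps power2_eq_square)
    also have "\<bar>\<dots>\<bar> = h * \<bar>?a - ?b - h * A v\<bar>" using h by (simp add: abs_mult)
    also have "\<dots> \<le> h * (e * h)" using ab h by (intro mult_left_mono) auto
    finally show ?thesis by (simp add: power2_eq_square mult_ac)
  qed
  ultimately show ?thesis by blast
qed

text \<open>The second difference is symmetric in \<open>u\<close> and \<open>v\<close>, so h^2 A v
  and h^2 B u both approximate it. Allowing each an error of a third of the supposed discrepancy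
  gives a contradiction.\<close>

theorem second_derivative_symmetric_real:
  fixes f :: "'v::real_normed_vector \<Rightarrow> real"
  assumes U: "open U" "x \<in> U" and f': "\<And>y. y \<in> U \<Longrightarrow> (f has_derivative f' y) (at y)"
    and A: "((\<lambda>y. f' y u) has_derivative A) (at x)" and B: "((\<lambda>y. f' y v) has_derivative B) (at x)"
  shows "A v = B u"
proof (rule ccontr)
  assume "A v \<noteq> B u"
  then have e: "\<bar>A v - B u\<bar> / 3 > 0" by simp
  obtain d1 where d1: "d1 > 0" "\<And>h. 0 < h \<Longrightarrow> h < d1 \<Longrightarrow>
    \<bar>f (x + h *\<^sub>R u + h *\<^sub>R v) - f (x + h *\<^sub>R u) - f (x + h *\<^sub>R v) + f x - h\<^sup>2 * A v\<bar> \<le> \<bar>A v - B u\<bar> / 3 * h\<^sup>2"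
    using second_difference[OF U f' A e, of v] by blast
  obtain d2 where d2: "d2 > 0" "\<And>h. 0 < h \<Longrightarrow> h < d2 \<Longrightarrow>
    \<bar>f (x + h *\<^sub>R v + h *\<^sub>R u) - f (x + h *\<^sub>R v) - f (x + h *\<^sub>R u) + f x - h\<^sup>2 * B u\<bar> \<le> \<bar>A v - B u\<bar> / 3 * h\<^sup>2"
    using second_difference[OF U f' B e, of u] by blast
  define h where "h = min d1 d2 / 2"
  have h: "0 < h" "h < d1" "h < d2" using d1 d2 by (auto simp: h_def)
  have sw: "x + h *\<^sub>R v + h *\<^sub>R u = x + h *\<^sub>R u + h *\<^sub>R v" by simp
  have "h\<^sup>2 * \<bar>A v - B u\<bar> = \<bar>h\<^sup>2 * A v - h\<^sup>2 * B u\<bar>"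
    by (simp add: abs_mult flip: right_diff_distrib)
  also have "\<dots> \<le> 2 * (\<bar>A v - B u\<bar> / 3 * h\<^sup>2)"
    using d1(2)[OF h(1,2)] d2(2)[OF h(1,3)] unfolding sw by linarith
  also have "\<dots> < h\<^sup>2 * \<bar>A v - B u\<bar>"
    using h(1) \<open>A v \<noteq> B u\<close> by (simp add: field_simps)
  finally show False by simp
qed

theorem second_derivative_symmetric:
  fixes f :: "'v::real_normed_vector \<Rightarrow> real ^ 'n"
  assumes U: "open U" "x \<in> U" and f': "\<And>y. y \<in> U \<Longrightarrow> (f has_derivative f' y) (at y)"
    and A: "((\<lambda>y. f' y u) has_derivative A) (at x)" and B: "((\<lambda>y. f' y v) has_derivative B) (at x)"
  shows "A v = B u"
  unfolding Finite_Cartesian_Product.vec_eq_iff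
proof (rule allI)
  fix k
  show "A v $ k = B u $ k"
    using second_derivative_symmetric_real[OF U, of "\<lambda>y. f y $ k" "\<lambda>y w. f' y w $ k" u "\<lambda>w. A w $ k" v "\<lambda>w. B w $ k"]
      bounded_linear.has_derivative[OF bounded_linear_vec_nth] f' A B by blast
qed

text \<open>As \<open>U\<close> is open, the filters within \<open>I \<inter> U\<close> and within
  \<open>I\<close> coincide at the points considered, and \<open>I\<close> makes derivatives there
  unique. So the unspecified derivative in \<open>times_differentiable\<close> is the
  \<open>vector_derivative\<close> along the whole interval.\<close>

lemma times_differentiable_vector_derivative:
  fixes f :: "real \<Rightarrow> 'w::real_normed_vector"
  assumes f: "times_differentiable (Suc k) (I \<inter> U) f" and U: "open U"
    and I: "\<And>t. t \<in> I \<Longrightarrow> at t within I \<noteq> bot"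
  shows "\<And>t. t \<in> I \<inter> U \<Longrightarrow> (f has_vector_derivative vector_derivative f (at t within I)) (at t within I)"
    and "times_differentiable k (I \<inter> U) (\<lambda>t. vector_derivative f (at t within I))"
proof -
  obtain f' where f': "\<forall>t\<in>I \<inter> U. (f has_derivative f' t) (at t within I \<inter> U)"
      "\<forall>v. times_differentiable k (I \<inter> U) (\<lambda>t. f' t v)"
    using f by auto
  have d: "(f has_vector_derivative f' t 1) (at t within I)" if t: "t \<in> I \<inter> U" for t
  proof -
    have "at t within I \<inter> U = at t within I"
      using t U by (intro at_within_nhd[of _ U]) auto
    then have *: "(f has_derivative f' t) (at t within I)"
      using f'(1) t by metis
    have "f' t r = r *\<^sub>R f' t 1" for r
      using linear_scale[OF bounded_linear.linear[OF has_derivative_bounded_linear[OF *]], of r 1] by simp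
    then have "f' t = (\<lambda>r. r *\<^sub>R f' t 1)" by blast
    then show ?thesis using * by (simp add: has_vector_derivative_def)
  qed
  then have eq: "vector_derivative f (at t within I) = f' t 1" if "t \<in> I \<inter> U" for t
    using that I by (auto intro!: vector_derivative_within)
  show "(f has_vector_derivative vector_derivative f (at t within I)) (at t within I)" if "t \<in> I \<inter> U" for t
    using d[OF that] eq[OF that] by simp
  show "times_differentiable k (I \<inter> U) (\<lambda>t. vector_derivative f (at t within I))"
    by (rule times_differentiable_cong[of _ "\<lambda>t. f' t 1"]) (use eq f'(2) in auto)
qed

lemma times_differentiable_derivative:
  assumes f: "times_differentiable (Suc k) U f" and U: "open U"
  shows "\<And>x. x \<in> U \<Longrightarrow> (f has_derivative frechet_derivative f (at x)) (at x)"
    and "times_differentiable k U (\<lambda>x. frechet_derivative f (at x) v)"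
proof -
  obtain f' where f': "\<forall>x\<in>U. (f has_derivative f' x) (at x within U)"
      "\<forall>v. times_differentiable k U (\<lambda>x. f' x v)"
    using f by auto
  have d: "(f has_derivative f' x) (at x)" if "x \<in> U" for x
    using f'(1) that U by (metis at_within_open)
  then have eq: "f' x = frechet_derivative f (at x)" if "x \<in> U" for x
    using that frechet_derivative_at by blast
  show "(f has_derivative frechet_derivative f (at x)) (at x)" if "x \<in> U" for x
    using d[OF that] eq[OF that] by simp
  show "times_differentiable k U (\<lambda>x. frechet_derivative f (at x) v)"
    by (rule times_differentiable_cong[of _ "\<lambda>x. f' x v"]) (use eq f'(2) in auto)
qed

subsection \<open>Charts and tangent spaces\<close>

text \<open>The inverse of evaluating a tangent vector in the chart \<open>a\<close>; it identifies
  coordinate space with the tangent space at \<open>p\<close>.\<close>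

definition tangent_lift ::
    "('a, 'n::finite) riem \<Rightarrow> ('a, 'n) chart \<Rightarrow> 'a \<Rightarrow> real ^ 'n \<Rightarrow> ('a, 'n) tangent" where
  "tangent_lift M a p w = (\<lambda>b. if b \<in> charts_at M p then transition_deriv a b p w else 0)"

lemma coord_vector_eq_tangent_lift: "coord_vector M a p i = tangent_lift M a p (axis i 1)"
  by (simp add: coord_vector_def tangent_lift_def)

locale oriented_riemannian =
  fixes M :: "('a, 'n::finite) riem"
  assumes manifold: "oriented_riemannian_manifold M"
begin

lemma charts_atD: "a \<in> charts_at M p \<Longrightarrow> a \<in> atlas M" "a \<in> charts_at M p \<Longrightarrow> p \<in> fst a"
  by (auto simp: charts_at_def)

lemma atlas_oriented: "oriented_atlas (underlying M) (atlas M)"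
  and coord_bij: "bij_betw (coord M) {1..CARD('n)} UNIV"
  using manifold unfolding oriented_riemannian_manifold_def by simp_all

lemma metric_inner_product: "p \<in> topspace (underlying M) \<Longrightarrow> inner_product_on (tangent_space M p) (metric M p)"
proof -
  have "\<forall>p\<in>topspace (underlying M). inner_product_on (tangent_space M p) (metric M p)"
    using manifold unfolding oriented_riemannian_manifold_def by (elim conjE)
  then show "p \<in> topspace (underlying M) \<Longrightarrow> ?thesis" by (elim ballE) auto
qed

lemma metric_coeff_smooth: "a \<in> atlas M \<Longrightarrow> smooth_on (snd a ` fst a) (metric_coeff M a)"
proof -
  have "\<forall>a\<in>atlas M. smooth_on (snd a ` fst a) (metric_coeff M a)"
    using manifold unfolding oriented_riemannian_manifold_def by (elim conjE)
  then show "a \<in> atlas M \<Longrightarrow> ?thesis" by (elim ballE) auto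
qed

lemma chart:
  assumes "a \<in> atlas M"
  shows "is_chart (underlying M) a"
  using atlas_oriented assms by (auto simp: oriented_atlas_def)

lemma charts_at_nonempty: "p \<in> topspace (underlying M) \<Longrightarrow> \<exists>a. a \<in> charts_at M p"
  using atlas_oriented by (auto simp: oriented_atlas_def charts_at_def)

lemma chart_domain_openin: "a \<in> atlas M \<Longrightarrow> openin (underlying M) (fst a)"
  using chart by (simp add: is_chart_def)

lemma chart_image_open:
  assumes a: "a \<in> atlas M" and V: "openin (underlying M) V" "V \<subseteq> fst a"
  shows "open (snd a ` V)"
proof -
  have hom: "homeomorphic_map (subtopology (underlying M) (fst a)) (top_of_set (snd a ` fst a)) (snd a)"
    and op: "open (snd a ` fst a)"
    using chart[OF a] by (auto simp: is_chart_def)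
  have "openin (subtopology (underlying M) (fst a)) V"
    using V by (simp add: openin_subtopology_alt) blast
  then have "openin (top_of_set (snd a ` fst a)) (snd a ` V)"
    using homeomorphic_imp_open_map[OF hom] by (simp add: open_map_def)
  then show ?thesis using op openin_open_trans by blast
qed

lemma chart_inj: "a \<in> atlas M \<Longrightarrow> inj_on (snd a) (fst a)"
proof -
  assume a: "a \<in> atlas M"
  have "topspace (subtopology (underlying M) (fst a)) = fst a"
    using chart_domain_openin[OF a] openin_subset by (auto simp: topspace_subtopology)
  then show ?thesis
    using chart[OF a] homeomorphic_imp_injective_map by (fastforce simp: is_chart_def)
qed

lemma chart_inv: "a \<in> atlas M \<Longrightarrow> p \<in> fst a \<Longrightarrow> chart_inv a (snd a p) = p"
  unfolding chart_inv_def using chart_inj by (rule inv_into_f_f)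

lemma transition_eq: "a \<in> atlas M \<Longrightarrow> p \<in> fst a \<Longrightarrow> transition a b (snd a p) = snd b p"
  by (simp add: transition_def chart_inv)

lemma overlap_open: "a \<in> atlas M \<Longrightarrow> b \<in> atlas M \<Longrightarrow> open (snd a ` (fst a \<inter> fst b))"
  by (intro chart_image_open openin_Int chart_domain_openin) auto

lemma transition_times_differentiable:
  "a \<in> atlas M \<Longrightarrow> b \<in> atlas M \<Longrightarrow> times_differentiable k (snd a ` (fst a \<inter> fst b)) (transition a b)"
  using atlas_oriented by (auto simp: oriented_atlas_def intro!: smooth_on_times_differentiable)

lemma transition_det_pos:
  "a \<in> charts_at M p \<Longrightarrow> b \<in> charts_at M p \<Longrightarrow> Determinants.det (matrix (transition_deriv a b p)) > 0"
  using atlas_oriented by (auto simp: oriented_atlas_def charts_at_def)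

lemma transition_has_derivative:
  assumes "a \<in> charts_at M p" "b \<in> charts_at M p"
  shows "(transition a b has_derivative transition_deriv a b p) (at (snd a p))"
  unfolding transition_deriv_def
  by (rule times_differentiable_derivative(1)[OF transition_times_differentiable[of a b "Suc 0"] overlap_open])
    (use assms in \<open>auto simp: charts_at_def\<close>)

lemma transition_deriv_linear:
  "a \<in> charts_at M p \<Longrightarrow> b \<in> charts_at M p \<Longrightarrow> linear (transition_deriv a b p)"
  using transition_has_derivative has_derivative_bounded_linear bounded_linear.linear by blast

text \<open>The chain rule, on the image of the triple overlap, where the composite of the
  transitions agrees with \<open>transition a c\<close>.\<close>

lemma transition_deriv_trans:
  assumes a: "a \<in> charts_at M p" and b: "b \<in> charts_at M p" and c: "c \<in> charts_at M p"
  shows "transition_deriv b c p (transition_deriv a b p v) = transition_deriv a c p v"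
proof -
  let ?W = "fst a \<inter> fst b \<inter> fst c"
  have at: "a \<in> atlas M" "b \<in> atlas M" "c \<in> atlas M" "p \<in> ?W"
    using a b c by (auto simp: charts_at_def)
  have op: "open (snd a ` ?W)"
    using at by (intro chart_image_open openin_Int chart_domain_openin) auto
  have "(transition b c has_derivative transition_deriv b c p) (at (transition a b (snd a p)))"
    using transition_has_derivative[OF b c] at by (simp add: transition_eq)
  then have "((\<lambda>x. transition b c (transition a b x)) has_derivative
      (\<lambda>v. transition_deriv b c p (transition_deriv a b p v))) (at (snd a p))"
    using has_derivative_compose[OF transition_has_derivative[OF a b]] by blast
  then have "(transition a c has_derivative (\<lambda>v. transition_deriv b c p (transition_deriv a b p v))) (at (snd a p))"
    by (rule has_derivative_transform_within_open[OF _ op]) (use at in \<open>auto simp: transition_eq\<close>)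
  from has_derivative_unique[OF this transition_has_derivative[OF a c]] show ?thesis
    by metis
qed

lemma transition_deriv_refl:
  assumes a: "a \<in> charts_at M p"
  shows "transition_deriv a a p v = v"
proof -
  have at: "a \<in> atlas M" "p \<in> fst a" using a by (auto simp: charts_at_def)
  have op: "open (snd a ` fst a)"
    using at by (intro chart_image_open chart_domain_openin) auto
  have "(transition a a has_derivative (\<lambda>v. v)) (at (snd a p))"
    by (rule has_derivative_transform_within_open[OF has_derivative_ident op])
      (use at in \<open>auto simp: transition_eq\<close>)
  from has_derivative_unique[OF this transition_has_derivative[OF a a]] show ?thesis
    by metis
qed

section \<open>The tangent space as a copy of coordinate space\<close>

lemma tangent_spaceD:
  assumes "v \<in> tangent_space M p"
  shows "a \<in> charts_at M p \<Longrightarrow> b \<in> charts_at M p \<Longrightarrow> v b = transition_deriv a b p (v a)"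
    and "a \<notin> charts_at M p \<Longrightarrow> v a = 0"
proof -
  have *: "\<forall>a\<in>charts_at M p. \<forall>b\<in>charts_at M p. v b = transition_deriv a b p (v a)"
    and **: "\<forall>a. a \<notin> charts_at M p \<longrightarrow> v a = 0"
    by (rule conjunct1[OF assms[unfolded tangent_space_def mem_Collect_eq]],
        rule conjunct2[OF assms[unfolded tangent_space_def mem_Collect_eq]])
  show "a \<in> charts_at M p \<Longrightarrow> b \<in> charts_at M p \<Longrightarrow> v b = transition_deriv a b p (v a)"
    by (rule *[rule_format])
  show "a \<notin> charts_at M p \<Longrightarrow> v a = 0"
    by (rule **[rule_format])
qed

lemma tangent_spaceI:
  assumes "\<And>a b. a \<in> charts_at M p \<Longrightarrow> b \<in> charts_at M p \<Longrightarrow> v b = transition_deriv a b p (v a)"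
    and "\<And>a. a \<notin> charts_at M p \<Longrightarrow> v a = 0"
  shows "v \<in> tangent_space M p"
  unfolding tangent_space_def mem_Collect_eq using assms by blast

lemma tangent_lift_in: "a \<in> charts_at M p \<Longrightarrow> tangent_lift M a p w \<in> tangent_space M p"
  by (rule tangent_spaceI) (auto simp: tangent_lift_def transition_deriv_trans)

lemma tangent_lift_self: "a \<in> charts_at M p \<Longrightarrow> tangent_lift M a p w a = w"
  by (simp add: tangent_lift_def transition_deriv_refl)

lemma tangent_lift_eval:
  assumes "v \<in> tangent_space M p" "a \<in> charts_at M p"
  shows "tangent_lift M a p (v a) = v"
proof
  fix b
  show "tangent_lift M a p (v a) b = v b"
    using tangent_spaceD(1)[OF assms(1) assms(2), of b] tangent_spaceD(2)[OF assms(1), of b]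
    by (cases "b \<in> charts_at M p") (simp_all add: tangent_lift_def)
qed

lemma tangent_lift_transition:
  "a \<in> charts_at M p \<Longrightarrow> b \<in> charts_at M p \<Longrightarrow>
    tangent_lift M b p (transition_deriv a b p w) = tangent_lift M a p w"
  by (auto simp: tangent_lift_def transition_deriv_trans)

lemma linear_tangent_lift:
  assumes "a \<in> charts_at M p"
  shows "linear (tangent_lift M a p)"
proof (rule linearI)
  fix x y
  show "tangent_lift M a p (x + y) = tangent_lift M a p x + tangent_lift M a p y"
  proof
    fix b
    show "tangent_lift M a p (x + y) b = (tangent_lift M a p x + tangent_lift M a p y) b"
      using linear_add[OF transition_deriv_linear[OF assms]] by (auto simp: tangent_lift_def)
  qed
next
  fix r x
  show "tangent_lift M a p (r *\<^sub>R x) = r *\<^sub>R tangent_lift M a p x"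
  proof
    fix b
    show "tangent_lift M a p (r *\<^sub>R x) b = (r *\<^sub>R tangent_lift M a p x) b"
      using linear_scale[OF transition_deriv_linear[OF assms]] by (auto simp: tangent_lift_def scaleR_fun_def)
  qed
qed

lemma sum_tangent_eval: "(\<Sum>i\<in>S. f i) a = (\<Sum>i\<in>S. f i a)" for f :: "_ \<Rightarrow> ('a, 'n) tangent"
  by (induction S rule: infinite_finite_induct) auto

text \<open>\<open>tangent_lift M a p\<close> is a linear isomorphism from coordinate space that
  takes the standard basis to the coordinate vectors. This makes the abstract linear algebra
  available at every point; the chart enters only through the choice of the basis.\<close>

lemma tangent_basis:
  assumes a: "a \<in> charts_at M p" and p: "p \<in> topspace (underlying M)"
  defines "B \<equiv> range (coord_vector M a p)"
  shows "inner_product_with_basis B (tangent_space M p) (metric M p)" and "card B = CARD('n)"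
proof -
  have B: "B = tangent_lift M a p ` range (\<lambda>i. axis i 1)"
    by (auto simp: B_def coord_vector_eq_tangent_lift image_image)
  have inj: "inj (tangent_lift M a p)"
    using tangent_lift_self[OF a] by (metis injI)
  have inj_ax: "inj (\<lambda>i::'n. axis i (1::real))"
    by (simp add: inj_def axis_eq_axis)
  have ax: "range (\<lambda>i::'n. axis i (1::real)) = Basis"
    by (auto simp: Basis_vec_def)
  have ind: "independent B"
    unfolding B ax by (rule linear_independent_injective_image[OF linear_tangent_lift[OF a] independent_Basis
        inj_on_subset[OF inj subset_UNIV]])
  have "span B = tangent_lift M a p ` UNIV"
    unfolding B ax by (simp add: linear_span_image[OF linear_tangent_lift[OF a]] span_Basis)
  also have "\<dots> = tangent_space M p"
    using tangent_lift_in[OF a] tangent_lift_eval[OF _ a] by (metis UNIV_I image_subset_iff image_eqI subsetI subset_antisym)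
  finally have sp: "span B = tangent_space M p" .
  show "inner_product_with_basis B (tangent_space M p) (metric M p)"
    by unfold_locales (use ind sp metric_inner_product[OF p] in \<open>auto simp: B_def\<close>)
  show "card B = CARD('n)"
    unfolding B using inj inj_ax by (metis card_image inj_on_subset subset_UNIV)
qed

text \<open>Expansion in coordinate vectors. It is the bridge from the metric at a point to the
  coefficient functions, whose smoothness is given.\<close>

lemma metric_in_chart:
  assumes a: "a \<in> charts_at M p" and p: "p \<in> topspace (underlying M)"
  shows "metric M p (tangent_lift M a p u) (tangent_lift M a p w) =
    (\<Sum>i\<in>UNIV. \<Sum>j\<in>UNIV. metric_coeff M a (snd a p) $ i $ j * u $ i * w $ j)"
proof -
  interpret inner_product_with_basis "range (coord_vector M a p)" "tangent_space M p" "metric M p"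
    by (rule tangent_basis[OF a p])
  have exp: "tangent_lift M a p u = (\<Sum>i\<in>UNIV. u $ i *\<^sub>R coord_vector M a p i)" for u
  proof -
    have "u = (\<Sum>i\<in>UNIV. u $ i *\<^sub>R axis i 1)"
      using basis_expansion[of u] by (simp add: scalar_mult_eq_scaleR)
    then have "tangent_lift M a p u = tangent_lift M a p (\<Sum>i\<in>UNIV. u $ i *\<^sub>R axis i 1)"
      by simp
    also have "\<dots> = (\<Sum>i\<in>UNIV. u $ i *\<^sub>R coord_vector M a p i)"
      using linear_tangent_lift[OF a]
      by (simp add: linear_sum linear_scale coord_vector_eq_tangent_lift)
    finally show ?thesis .
  qed
  have cv: "coord_vector M a p i \<in> tangent_space M p" for i
    by (simp add: coord_vector_eq_tangent_lift tangent_lift_in[OF a])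
  have "metric M p (tangent_lift M a p u) (tangent_lift M a p w) =
      (\<Sum>i\<in>UNIV. u $ i * metric M p (coord_vector M a p i) (\<Sum>j\<in>UNIV. w $ j *\<^sub>R coord_vector M a p j))"
    unfolding exp using cv by (intro inner_sum_scaleR_left sum_in scaleR_in) auto
  also have "\<dots> = (\<Sum>i\<in>UNIV. u $ i * (\<Sum>j\<in>UNIV. w $ j * metric M p (coord_vector M a p i) (coord_vector M a p j)))"
    using cv by (intro sum.cong refl arg_cong2[of _ _ _ _ "(*)"] inner_sum_scaleR_right) auto
  also have "\<dots> = (\<Sum>i\<in>UNIV. \<Sum>j\<in>UNIV. metric_coeff M a (snd a p) $ i $ j * u $ i * w $ j)"
    using chart_inv[OF charts_atD[OF a]]
    by (simp add: metric_coeff_def Let_def sum_distrib_left mult_ac)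
  finally show ?thesis .
qed

lemma atlas_point:
  assumes "a \<in> atlas M" "x \<in> snd a ` fst a"
  obtains p where "a \<in> charts_at M p" "p \<in> topspace (underlying M)" "x = snd a p"
  using assms openin_subset[OF chart_domain_openin[OF assms(1)]] by (auto simp: charts_at_def)

text \<open>A nonzero kernel vector of the coefficient matrix would lift to a nonzero tangent vector
  of length 0, against positive definiteness.\<close>

lemma metric_coeff_det_nonzero:
  assumes "a \<in> atlas M" "x \<in> snd a ` fst a"
  shows "Determinants.det (metric_coeff M a x) \<noteq> 0"
proof -
  obtain p where p: "a \<in> charts_at M p" "p \<in> topspace (underlying M)" "x = snd a p"
    using assms by (rule atlas_point)
  interpret inner_product_with_basis "range (coord_vector M a p)" "tangent_space M p" "metric M p"
    by (rule tangent_basis[OF p(1,2)])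
  have "w = 0" if w: "metric_coeff M a x *v w = 0" for w
  proof (rule ccontr)
    assume "w \<noteq> 0"
    then have "tangent_lift M a p w \<noteq> 0"
      using tangent_lift_self[OF p(1), of w] by (metis zero_fun_def)
    then have "metric M p (tangent_lift M a p w) (tangent_lift M a p w) > 0"
      using inner_pos tangent_lift_in[OF p(1)] by blast
    moreover have "metric M p (tangent_lift M a p w) (tangent_lift M a p w) =
        (\<Sum>i\<in>UNIV. w $ i * (metric_coeff M a x *v w) $ i)"
      unfolding metric_in_chart[OF p(1,2)]
      by (simp add: matrix_vector_mult_def p(3) sum_distrib_left mult_ac)
    ultimately show False by (simp add: w)
  qed
  then have "\<exists>B. B ** metric_coeff M a x = Finite_Cartesian_Product.mat 1"
    using matrix_left_invertible_ker by blast
  then show ?thesis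
    using invertible_left_inverse invertible_det_nz by blast
qed

lemma metric_coeff_times_differentiable:
  "a \<in> atlas M \<Longrightarrow> times_differentiable k (snd a ` fst a) (\<lambda>x. metric_coeff M a x $ i $ j)"
  by (rule times_differentiable_component[OF times_differentiable_bounded_linear[OF bounded_linear_vec_nth
        smooth_on_times_differentiable[OF metric_coeff_smooth]]])

lemma chart_range_open: "a \<in> atlas M \<Longrightarrow> open (snd a ` fst a)"
  by (intro chart_image_open chart_domain_openin) auto

lemma christoffel_times_differentiable:
  assumes a: "a \<in> atlas M"
  shows "times_differentiable m (snd a ` fst a) (\<lambda>x. christoffel M a x k i j)"
proof -
  have p: "times_differentiable m (snd a ` fst a) (\<lambda>x. partial i (\<lambda>y. metric_coeff M a y $ r $ s) x)" for i r s
    unfolding partial_def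
    using times_differentiable_derivative(2)[OF metric_coeff_times_differentiable[OF a] chart_range_open[OF a]] .
  have i: "times_differentiable m (snd a ` fst a) (\<lambda>x. matrix_inv (metric_coeff M a x) $ r $ s)" for r s
    using a by (intro times_differentiable_matrix_inv metric_coeff_times_differentiable metric_coeff_det_nonzero)
  have "times_differentiable m (snd a ` fst a) (\<lambda>x. 1 / 2 * (\<Sum>l\<in>UNIV. matrix_inv (metric_coeff M a x) $ k $ l *
        (partial i (\<lambda>y. metric_coeff M a y $ j $ l) x + partial j (\<lambda>y. metric_coeff M a y $ i $ l) x -
         partial l (\<lambda>y. metric_coeff M a y $ i $ j) x)))"
    by (intro times_differentiable_cmult times_differentiable_sum times_differentiable_mult
        times_differentiable_diff times_differentiable_add p i)
  then show ?thesis by (simp add: christoffel_def Let_def)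
qed

end

subsection \<open>Christoffel symbols in two charts\<close>

lemma sum_rotate3:
  "(\<Sum>i\<in>A. \<Sum>j\<in>B. \<Sum>l\<in>C. f i j l) = (\<Sum>l\<in>C. \<Sum>i\<in>A. \<Sum>j\<in>B. f i j l)"
proof -
  have "(\<Sum>i\<in>A. \<Sum>j\<in>B. \<Sum>l\<in>C. f i j l) = (\<Sum>i\<in>A. \<Sum>l\<in>C. \<Sum>j\<in>B. f i j l)"
    by (intro sum.cong refl sum.swap)
  also have "\<dots> = (\<Sum>l\<in>C. \<Sum>i\<in>A. \<Sum>j\<in>B. f i j l)"
    by (rule sum.swap)
  finally show ?thesis .
qed

text \<open>The product rule for g(U, W) with all three factors varying. It is applied to constant
  \<open>U\<close> and \<open>W\<close> in one chart and, in the other, to vectors moved by the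
  derivative of the transition map.\<close>

lemma has_derivative_bilinear_form:
  fixes U W :: "'v::real_normed_vector \<Rightarrow> real ^ 'n"
  assumes g: "\<And>i j. ((\<lambda>y. g y i j) has_derivative (\<lambda>z. g' z i j)) (at x)"
    and U: "(U has_derivative U') (at x)" and W: "(W has_derivative W') (at x)"
  shows "((\<lambda>y. \<Sum>i\<in>UNIV. \<Sum>j\<in>UNIV. g y i j * U y $ i * W y $ j) has_derivative
    (\<lambda>z. (\<Sum>i\<in>UNIV. \<Sum>j\<in>UNIV. g' z i j * U x $ i * W x $ j) +
      (\<Sum>i\<in>UNIV. \<Sum>j\<in>UNIV. g x i j * U' z $ i * W x $ j) +
      (\<Sum>i\<in>UNIV. \<Sum>j\<in>UNIV. g x i j * U x $ i * W' z $ j))) (at x)"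
proof -
  have Ui: "((\<lambda>y. U y $ i) has_derivative (\<lambda>z. U' z $ i)) (at x)"
    and Wi: "((\<lambda>y. W y $ i) has_derivative (\<lambda>z. W' z $ i)) (at x)" for i
    using U W by (auto intro: bounded_linear.has_derivative[OF bounded_linear_vec_nth])
  have "((\<lambda>y. \<Sum>i\<in>UNIV. \<Sum>j\<in>UNIV. g y i j * U y $ i * W y $ j) has_derivative
    (\<lambda>z. \<Sum>i\<in>UNIV. \<Sum>j\<in>UNIV. (g x i j * U x $ i) * W' z $ j +
      (g x i j * U' z $ i + g' z i j * U x $ i) * W x $ j)) (at x)"
    by (intro has_derivative_sum has_derivative_mult g Ui Wi)
  then show ?thesis
    by (rule has_derivative_eq_rhs) (simp add: sum.distrib algebra_simps)
qed

context oriented_riemannian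
begin

text \<open>This form and the next two bundle the coefficients, so that the transformation law can
  be derived with vectors instead of indices.\<close>

definition chart_metric :: "('a, 'n) chart \<Rightarrow> real ^ 'n \<Rightarrow> real ^ 'n \<Rightarrow> real ^ 'n \<Rightarrow> real" where
  "chart_metric a x u w = (\<Sum>i\<in>UNIV. \<Sum>j\<in>UNIV. metric_coeff M a x $ i $ j * u $ i * w $ j)"

text \<open>The derivative of g(u, w) along \<open>z\<close>, with the coordinate vectors
  \<open>u\<close> and \<open>w\<close> held constant.\<close>

definition chart_metric_deriv ::
    "('a, 'n) chart \<Rightarrow> real ^ 'n \<Rightarrow> real ^ 'n \<Rightarrow> real ^ 'n \<Rightarrow> real ^ 'n \<Rightarrow> real" where
  "chart_metric_deriv a x z u w =
     (\<Sum>i\<in>UNIV. \<Sum>j\<in>UNIV. frechet_derivative (\<lambda>y. metric_coeff M a y $ i $ j) (at x) z * u $ i * w $ j)"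

definition christoffel_form ::
    "('a, 'n) chart \<Rightarrow> real ^ 'n \<Rightarrow> real ^ 'n \<Rightarrow> real ^ 'n \<Rightarrow> real ^ 'n" where
  "christoffel_form a x u w = (\<chi> k. \<Sum>i\<in>UNIV. \<Sum>j\<in>UNIV. christoffel M a x k i j * u $ i * w $ j)"

lemma metric_coeff_has_derivative:
  assumes "a \<in> atlas M" "x \<in> snd a ` fst a"
  shows "((\<lambda>y. metric_coeff M a y $ i $ j) has_derivative
    frechet_derivative (\<lambda>y. metric_coeff M a y $ i $ j) (at x)) (at x)"
  by (rule times_differentiable_derivative(1)[OF metric_coeff_times_differentiable[OF assms(1), of "Suc 0"]
        chart_range_open[OF assms(1)] assms(2)])

lemma chart_metric_deriv_partial:
  assumes "a \<in> atlas M" "x \<in> snd a ` fst a"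
  shows "chart_metric_deriv a x z u w = (\<Sum>l\<in>UNIV. \<Sum>i\<in>UNIV. \<Sum>j\<in>UNIV.
    partial l (\<lambda>y. metric_coeff M a y $ i $ j) x * z $ l * u $ i * w $ j)"
proof -
  have d: "frechet_derivative (\<lambda>y. metric_coeff M a y $ i $ j) (at x) z =
      (\<Sum>l\<in>UNIV. z $ l * partial l (\<lambda>y. metric_coeff M a y $ i $ j) x)" for i j
  proof -
    have lin: "linear (frechet_derivative (\<lambda>y. metric_coeff M a y $ i $ j) (at x))"
      using metric_coeff_has_derivative[OF assms] has_derivative_bounded_linear bounded_linear.linear by blast
    have "z = (\<Sum>l\<in>UNIV. z $ l *\<^sub>R axis l 1)"
      using basis_expansion[of z] by (simp add: scalar_mult_eq_scaleR)
    then have "frechet_derivative (\<lambda>y. metric_coeff M a y $ i $ j) (at x) z =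
        frechet_derivative (\<lambda>y. metric_coeff M a y $ i $ j) (at x) (\<Sum>l\<in>UNIV. z $ l *\<^sub>R axis l 1)"
      by simp
    then show ?thesis
      by (simp add: linear_sum[OF lin] linear_scale[OF lin] partial_def)
  qed
  have "chart_metric_deriv a x z u w = (\<Sum>i\<in>UNIV. \<Sum>j\<in>UNIV. \<Sum>l\<in>UNIV.
      partial l (\<lambda>y. metric_coeff M a y $ i $ j) x * z $ l * u $ i * w $ j)"
    unfolding chart_metric_deriv_def d by (simp add: sum_distrib_right sum_distrib_left mult_ac)
  then show ?thesis by (rule trans[OF _ sum_rotate3])
qed

text \<open>The Koszul formula for vector fields with constant coordinates. Pairing with
  \<open>z\<close> lowers the upper index of the Christoffel symbols, which cancels the inverse
  matrix in their definition.\<close>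

lemma chart_metric_christoffel:
  assumes a: "a \<in> atlas M" and x: "x \<in> snd a ` fst a"
  shows "chart_metric a x z (christoffel_form a x u w) =
    (chart_metric_deriv a x u w z + chart_metric_deriv a x w u z - chart_metric_deriv a x z u w) / 2"
proof -
  define P where "P = (\<lambda>l i j. partial l (\<lambda>y. metric_coeff M a y $ i $ j) x)"
  let ?G = "metric_coeff M a x"
  have low: "(\<Sum>k\<in>UNIV. ?G $ l $ k * christoffel M a x k i j) = (P i j l + P j i l - P l i j) / 2" for l i j
  proof -
    define Q where "Q = (\<chi> m. P i j m + P j i m - P m i j)"
    have "?G ** matrix_inv ?G = Finite_Cartesian_Product.mat 1"
      using metric_coeff_det_nonzero[OF a x] invertible_det_nz[of ?G] matrix_inv_right by blast
    then have GQ: "?G *v (matrix_inv ?G *v Q) = Q"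
      by (simp add: matrix_vector_mul_assoc)
    have cQ: "christoffel M a x k i j = (matrix_inv ?G *v Q) $ k / 2" for k
      by (simp add: christoffel_def Let_def Q_def P_def matrix_vector_mult_def)
    have "(\<Sum>k\<in>UNIV. ?G $ l $ k * christoffel M a x k i j) = (?G *v (matrix_inv ?G *v Q)) $ l / 2"
      unfolding cQ matrix_vector_mult_def[of ?G] by (simp add: sum_divide_distrib)
    then show ?thesis unfolding GQ by (simp add: Q_def)
  qed
  have "chart_metric a x z (christoffel_form a x u w) =
      (\<Sum>l\<in>UNIV. \<Sum>k\<in>UNIV. \<Sum>i\<in>UNIV. \<Sum>j\<in>UNIV. ?G $ l $ k * christoffel M a x k i j * (z $ l * u $ i * w $ j))"
    by (simp add: chart_metric_def christoffel_form_def sum_distrib_left mult_ac)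
  also have "\<dots> = (\<Sum>l\<in>UNIV. \<Sum>i\<in>UNIV. \<Sum>j\<in>UNIV. \<Sum>k\<in>UNIV. ?G $ l $ k * christoffel M a x k i j * (z $ l * u $ i * w $ j))"
    by (intro sum.cong refl sum_rotate3[symmetric])
  also have "\<dots> = (\<Sum>l\<in>UNIV. \<Sum>i\<in>UNIV. \<Sum>j\<in>UNIV. (P i j l + P j i l - P l i j) / 2 * (z $ l * u $ i * w $ j))"
    by (simp only: low flip: sum_distrib_right)
  also have "\<dots> = ((\<Sum>l\<in>UNIV. \<Sum>i\<in>UNIV. \<Sum>j\<in>UNIV. P i j l * u $ i * w $ j * z $ l) +
      (\<Sum>l\<in>UNIV. \<Sum>i\<in>UNIV. \<Sum>j\<in>UNIV. P j i l * w $ j * u $ i * z $ l) -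
      (\<Sum>l\<in>UNIV. \<Sum>i\<in>UNIV. \<Sum>j\<in>UNIV. P l i j * z $ l * u $ i * w $ j)) / 2"
    by (simp add: sum_divide_distrib flip: sum.distrib sum_subtractf)
      (intro sum.cong refl, simp add: field_simps)
  also have "(\<Sum>l\<in>UNIV. \<Sum>i\<in>UNIV. \<Sum>j\<in>UNIV. P i j l * u $ i * w $ j * z $ l) = chart_metric_deriv a x u w z"
    unfolding chart_metric_deriv_partial[OF a x] P_def
    by (rule sum_rotate3[symmetric])
  also have "(\<Sum>l\<in>UNIV. \<Sum>i\<in>UNIV. \<Sum>j\<in>UNIV. P j i l * w $ j * u $ i * z $ l) = chart_metric_deriv a x w u z"
  proof -
    have "(\<Sum>l\<in>UNIV. \<Sum>i\<in>UNIV. \<Sum>j\<in>UNIV. P j i l * w $ j * u $ i * z $ l) =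
        (\<Sum>l\<in>UNIV. \<Sum>j\<in>UNIV. \<Sum>i\<in>UNIV. P j i l * w $ j * u $ i * z $ l)"
      by (intro sum.cong refl sum.swap)
    also have "\<dots> = (\<Sum>j\<in>UNIV. \<Sum>i\<in>UNIV. \<Sum>l\<in>UNIV. P j i l * w $ j * u $ i * z $ l)"
      by (rule sum_rotate3[symmetric])
    finally show ?thesis
      unfolding chart_metric_deriv_partial[OF a x] P_def .
  qed
  also have "(\<Sum>l\<in>UNIV. \<Sum>i\<in>UNIV. \<Sum>j\<in>UNIV. P l i j * z $ l * u $ i * w $ j) = chart_metric_deriv a x z u w"
    unfolding chart_metric_deriv_partial[OF a x] P_def ..
  finally show ?thesis .
qed

section \<open>The chart metric and the Christoffel symbols under a change of chart\<close>

lemma chart_metric_eq_metric: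
  assumes "a \<in> charts_at M p" "p \<in> topspace (underlying M)"
  shows "chart_metric a (snd a p) u w = metric M p (tangent_lift M a p u) (tangent_lift M a p w)"
  unfolding chart_metric_def metric_in_chart[OF assms] ..

lemma chart_metric_linear_right: "linear (chart_metric a x u)"
  by (rule linearI)
    (simp_all add: chart_metric_def algebra_simps sum.distrib sum_distrib_left)

lemma chart_metric_commute:
  assumes "a \<in> charts_at M p" "p \<in> topspace (underlying M)"
  shows "chart_metric a (snd a p) u w = chart_metric a (snd a p) w u"
proof -
  interpret inner_product_with_basis "range (coord_vector M a p)" "tangent_space M p" "metric M p"
    by (rule tangent_basis[OF assms])
  show ?thesis
    unfolding chart_metric_eq_metric[OF assms] by (intro inner_commute tangent_lift_in assms)
qed

lemma chart_metric_nondegenerate: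
  assumes "a \<in> charts_at M p" "p \<in> topspace (underlying M)" "chart_metric a (snd a p) w w = 0"
  shows "w = 0"
proof (rule ccontr)
  interpret inner_product_with_basis "range (coord_vector M a p)" "tangent_space M p" "metric M p"
    by (rule tangent_basis[OF assms(1,2)])
  assume "w \<noteq> 0"
  then have "tangent_lift M a p w \<noteq> 0"
    using tangent_lift_self[OF assms(1), of w] by (metis zero_fun_def)
  then show False
    using inner_pos[OF tangent_lift_in[OF assms(1)]] assms(3)
    unfolding chart_metric_eq_metric[OF assms(1,2)] by force
qed

lemma chart_metric_transition:
  assumes "a \<in> charts_at M p" "b \<in> charts_at M p" "p \<in> topspace (underlying M)"
  shows "chart_metric a (snd a p) u w =
    chart_metric b (snd b p) (transition_deriv a b p u) (transition_deriv a b p w)"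
  using assms by (simp add: chart_metric_eq_metric tangent_lift_transition)

lemma charts_at_topspace: "a \<in> charts_at M p \<Longrightarrow> p \<in> topspace (underlying M)"
  using openin_subset[OF chart_domain_openin[OF charts_atD(1)]] charts_atD(2) by blast

text \<open>\<open>H u w\<close> is the second derivative of the transition map, first along
  \<open>u\<close> and then along \<open>w\<close>. It exists by smoothness of the atlas, and the
  symmetry of second derivatives applies on the open image of the overlap.\<close>

lemma transition_second_derivative:
  assumes a: "a \<in> charts_at M p" and b: "b \<in> charts_at M p"
  obtains H where
    "\<And>u. ((\<lambda>y. frechet_derivative (transition a b) (at y) u) has_derivative H u) (at (snd a p))"
    "\<And>u w. H u w = H w u"
proof -
  let ?U = "snd a ` (fst a \<inter> fst b)"
  let ?H = "\<lambda>u. frechet_derivative (\<lambda>y. frechet_derivative (transition a b) (at y) u) (at (snd a p))"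
  have at: "a \<in> atlas M" "b \<in> atlas M" and x: "snd a p \<in> ?U"
    using a b by (auto simp: charts_at_def)
  note op = overlap_open[OF at]
  have d1: "(transition a b has_derivative frechet_derivative (transition a b) (at y)) (at y)" if "y \<in> ?U" for y
    using times_differentiable_derivative(1)[OF transition_times_differentiable[OF at, of "Suc 0"] op that] .
  have d2: "((\<lambda>y. frechet_derivative (transition a b) (at y) u) has_derivative ?H u) (at (snd a p))" for u
    using times_differentiable_derivative(1)[OF
        times_differentiable_derivative(2)[OF transition_times_differentiable[OF at, of "Suc (Suc 0)"] op] op x] .
  have "?H u w = ?H w u" for u w
    using second_derivative_symmetric[OF op x d1 d2 d2] .
  with d2 show ?thesis by (rule that)
qed

text \<open>The transformation law of the Christoffel symbols, obtained by differentiating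
  $g_a(u,w) = g_b(\varphi' u, \varphi' w)$ and permuting the three vectors.\<close>

lemma christoffel_form_transition:
  assumes a: "a \<in> charts_at M p" and b: "b \<in> charts_at M p"
    and H: "\<And>u. ((\<lambda>y. frechet_derivative (transition a b) (at y) u) has_derivative H u) (at (snd a p))"
    and sym: "\<And>u w. H u w = H w u"
  shows "transition_deriv a b p (christoffel_form a (snd a p) u w) =
    christoffel_form b (snd b p) (transition_deriv a b p u) (transition_deriv a b p w) + H u w"
proof -
  let ?x = "snd a p" and ?y = "snd b p" and ?A = "transition_deriv a b p"
  let ?F = "\<lambda>y. frechet_derivative (transition a b) (at y)"
  have p: "p \<in> topspace (underlying M)" using charts_at_topspace[OF a] .
  have at: "a \<in> atlas M" "b \<in> atlas M" "p \<in> fst a \<inter> fst b"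
    using a b by (auto simp: charts_at_def)
  have xy: "?x \<in> snd a ` fst a" "?y \<in> snd b ` fst b" "transition a b ?x = ?y"
    using at by (auto simp: transition_eq)
  have FA: "?F ?x = ?A" by (simp add: transition_deriv_def)
  \<comment> \<open>The identity g_a(u, w) = g_b(A u, A w), differentiated along \<open>z\<close>,
    where A is the derivative of the transition map at the moving point. The two terms with
    \<open>H\<close> come from differentiating A.\<close>
  have D: "chart_metric_deriv a ?x z u w = chart_metric_deriv b ?y (?A z) (?A u) (?A w) +
      chart_metric b ?y (H u z) (?A w) + chart_metric b ?y (?A u) (H w z)" for z u w
  proof -
    have l: "(chart_metric a y u w) = (\<Sum>i\<in>UNIV. \<Sum>j\<in>UNIV.
        metric_coeff M b (transition a b y) $ i $ j * ?F y u $ i * ?F y w $ j)"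
      if y: "y \<in> snd a ` (fst a \<inter> fst b)" for y
    proof -
      obtain q where q: "q \<in> fst a \<inter> fst b" "y = snd a q" using y by blast
      then have aq: "a \<in> charts_at M q" "b \<in> charts_at M q" using at by (auto simp: charts_at_def)
      show ?thesis
        using chart_metric_transition[OF aq charts_at_topspace[OF aq(1)], of u w] q at
        by (simp add: chart_metric_def transition_deriv_def transition_eq)
    qed
    have Ga: "((\<lambda>y. chart_metric a y u w) has_derivative (\<lambda>z. chart_metric_deriv a ?x z u w)) (at ?x)"
      using has_derivative_bilinear_form[OF metric_coeff_has_derivative[OF at(1) xy(1)]
          has_derivative_const[of u] has_derivative_const[of w]]
      by (simp add: chart_metric_def chart_metric_deriv_def)
    have dG: "((\<lambda>y. metric_coeff M b (transition a b y) $ i $ j) has_derivative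
        (\<lambda>z. frechet_derivative (\<lambda>y. metric_coeff M b y $ i $ j) (at ?y) (?A z))) (at ?x)" for i j
      using has_derivative_compose[OF transition_has_derivative[OF a b], of "\<lambda>y. metric_coeff M b y $ i $ j"]
        metric_coeff_has_derivative[OF at(2) xy(2)] by (simp add: xy(3))
    have "((\<lambda>y. \<Sum>i\<in>UNIV. \<Sum>j\<in>UNIV. metric_coeff M b (transition a b y) $ i $ j * ?F y u $ i * ?F y w $ j)
        has_derivative (\<lambda>z. chart_metric_deriv b ?y (?A z) (?A u) (?A w) +
          chart_metric b ?y (H u z) (?A w) + chart_metric b ?y (?A u) (H w z))) (at ?x)"
      using has_derivative_bilinear_form[OF dG H[of u] H[of w]]
      unfolding FA xy(3) chart_metric_def chart_metric_deriv_def .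
    then have "((\<lambda>y. chart_metric a y u w) has_derivative (\<lambda>z. chart_metric_deriv b ?y (?A z) (?A u) (?A w) +
          chart_metric b ?y (H u z) (?A w) + chart_metric b ?y (?A u) (H w z))) (at ?x)"
      by (rule has_derivative_transform_within_open[OF _ overlap_open[OF at(1,2)]])
        (use at in \<open>auto simp: l\<close>)
    from has_derivative_unique[OF Ga this] show ?thesis by metis
  qed
  \<comment> \<open>The defect of the claimed law. It is orthogonal to every \<open>?A z\<close>,
    hence to itself, because \<open>?A\<close> has the right inverse
    \<open>transition_deriv b a p\<close>.\<close>
  let ?d = "?A (christoffel_form a ?x u w) - christoffel_form b ?y (?A u) (?A w) - H u w"
  note lin = linear_diff[OF chart_metric_linear_right]
  have *: "chart_metric b ?y (?A z) ?d = 0" for z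
  proof -
    have comm: "chart_metric b ?y v v' = chart_metric b ?y v' v" for v v'
      by (rule chart_metric_commute[OF b p])
    have "chart_metric b ?y (?A z) (?A (christoffel_form a ?x u w)) = chart_metric a ?x z (christoffel_form a ?x u w)"
      using chart_metric_transition[OF a b p] by simp
    \<comment> \<open>In the Koszul combination the terms with \<open>H u z\<close> and
      \<open>H w z\<close> cancel by symmetry of \<open>H\<close>; the term with
      \<open>H u w\<close> occurs twice and is halved.\<close>
    also have "\<dots> = (chart_metric_deriv b ?y (?A u) (?A w) (?A z) + chart_metric_deriv b ?y (?A w) (?A u) (?A z) -
        chart_metric_deriv b ?y (?A z) (?A u) (?A w)) / 2 + chart_metric b ?y (?A z) (H u w)"
      unfolding chart_metric_christoffel[OF at(1) xy(1)] D
      using sym[of w u] sym[of z u] sym[of z w] comm[of "H u w" "?A z"]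
        comm[of "H u z" "?A w"] comm[of "H w z" "?A u"] by (simp add: field_simps)
    also have "\<dots> = chart_metric b ?y (?A z) (christoffel_form b ?y (?A u) (?A w)) + chart_metric b ?y (?A z) (H u w)"
      unfolding chart_metric_christoffel[OF at(2) xy(2)] ..
    finally show ?thesis by (simp add: lin)
  qed
  have "?A (transition_deriv b a p ?d) = ?d"
    using transition_deriv_trans[OF b a b] transition_deriv_refl[OF b] by simp
  then have "chart_metric b ?y ?d ?d = 0" using *[of "transition_deriv b a p ?d"] by simp
  then have "?d = 0" by (rule chart_metric_nondegenerate[OF b p])
  then show ?thesis by (simp add: algebra_simps)
qed

text \<open>Near \<open>t\<close> the curve stays in both charts, so that V_b = A V_a with A the
  transition derivative along the curve. Besides A V_a', the product rule produces the derivative of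
  A, the term \<open>H x' (V t a)\<close>; it is the reason why coordinatewise differentiation does
  not give tangent vectors.\<close>

lemma vector_field_in_other_chart:
  assumes c: "continuous_map (top_of_set I) (underlying M) c" and t: "t \<in> I"
    and a: "a \<in> charts_at M (c t)" and b: "b \<in> charts_at M (c t)"
    and x: "((\<lambda>s. snd a (c s)) has_vector_derivative x') (at t within I)"
  shows "((\<lambda>s. snd b (c s)) has_vector_derivative transition_deriv a b (c t) x') (at t within I)"
    and "\<And>V V' H. (\<And>s. s \<in> I \<Longrightarrow> V s \<in> tangent_space M (c s)) \<Longrightarrow>
      ((\<lambda>s. V s a) has_vector_derivative V') (at t within I) \<Longrightarrow>
      (\<And>u. ((\<lambda>y. frechet_derivative (transition a b) (at y) u) has_derivative H u) (at (snd a (c t)))) \<Longrightarrow>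
      (\<And>u w. H u w = H w u) \<Longrightarrow>
      ((\<lambda>s. V s b) has_vector_derivative transition_deriv a b (c t) V' + H x' (V t a)) (at t within I)"
proof -
  let ?A = "transition_deriv a b (c t)" and ?F = "\<lambda>y. frechet_derivative (transition a b) (at y)"
  have at: "a \<in> atlas M" "b \<in> atlas M" "c t \<in> fst a \<inter> fst b"
    using a b by (auto simp: charts_at_def)
  have "openin (top_of_set I) {s \<in> topspace (top_of_set I). c s \<in> fst a \<inter> fst b}"
    by (rule openin_continuous_map_preimage[OF c openin_Int[OF chart_domain_openin[OF at(1)] chart_domain_openin[OF at(2)]]])
  then obtain O' where O': "open O'" "{s \<in> I. c s \<in> fst a \<inter> fst b} = I \<inter> O'"
    by (auto simp: openin_open)
  then obtain d where d: "d > 0" "ball t d \<subseteq> O'"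
    using t at(3) open_contains_ball by blast
  have near: "c s \<in> fst a \<inter> fst b" if "s \<in> I" "dist s t < d" for s
    using O'(2) d(2) that by (auto simp: dist_commute subset_iff)
  have "((\<lambda>s. transition a b (snd a (c s))) has_vector_derivative ?A x') (at t within I)"
    using vector_derivative_diff_chain_within[OF x, of "transition a b" ?A]
      has_derivative_at_withinI[OF transition_has_derivative[OF a b]] by (simp add: o_def)
  then show "((\<lambda>s. snd b (c s)) has_vector_derivative ?A x') (at t within I)"
    by (rule has_vector_derivative_transform_within[OF _ d(1) t])
      (use near at in \<open>auto simp: transition_eq\<close>)
  fix V V' H
  assume V: "\<And>s. s \<in> I \<Longrightarrow> V s \<in> tangent_space M (c s)"
    and V': "((\<lambda>s. V s a) has_vector_derivative V') (at t within I)"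
    and H: "\<And>u. ((\<lambda>y. ?F y u) has_derivative H u) (at (snd a (c t)))"
    and sym: "\<And>u w. H u w = H w u"
  have exp: "L v = (\<Sum>i\<in>UNIV. v $ i *\<^sub>R L (axis i 1))" if "linear L" for L :: "real ^ 'n \<Rightarrow> real ^ 'n" and v
  proof -
    have "v = (\<Sum>i\<in>UNIV. v $ i *\<^sub>R axis i 1)"
      using basis_expansion[of v] by (simp add: scalar_mult_eq_scaleR)
    then have "L v = L (\<Sum>i\<in>UNIV. v $ i *\<^sub>R axis i 1)" by simp
    then show ?thesis by (simp add: linear_sum[OF that] linear_scale[OF that])
  qed
  \<comment> \<open>Written over the standard basis, because \<open>H\<close> describes the
    derivative of A on a fixed vector; the coordinates of \<open>V\<close> then vary as scalar
    factors.\<close>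
  have Vb: "V s b = (\<Sum>i\<in>UNIV. V s a $ i *\<^sub>R ?F (snd a (c s)) (axis i 1))" if "s \<in> I" "dist s t < d" for s
  proof -
    have ch: "a \<in> charts_at M (c s)" "b \<in> charts_at M (c s)"
      using near[OF that] at by (auto simp: charts_at_def)
    have "V s b = transition_deriv a b (c s) (V s a)"
      using tangent_spaceD(1)[OF V[OF that(1)] ch] .
    then show ?thesis
      using exp[OF transition_deriv_linear[OF ch], of "V s a"] by (simp only: transition_deriv_def)
  qed
  have "((\<lambda>s. \<Sum>i\<in>UNIV. V s a $ i *\<^sub>R ?F (snd a (c s)) (axis i 1)) has_vector_derivative
      (\<Sum>i\<in>UNIV. V t a $ i *\<^sub>R H (axis i 1) x' + V' $ i *\<^sub>R ?F (snd a (c t)) (axis i 1))) (at t within I)"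
  proof (intro has_vector_derivative_sum has_vector_derivative_scaleR)
    fix i
    show "((\<lambda>s. V s a $ i) has_field_derivative V' $ i) (at t within I)"
      using bounded_linear.has_vector_derivative[OF bounded_linear_vec_nth V']
      by (simp add: has_real_derivative_iff_has_vector_derivative)
    show "((\<lambda>s. ?F (snd a (c s)) (axis i 1)) has_vector_derivative H (axis i 1) x') (at t within I)"
      using vector_derivative_diff_chain_within[OF x, of "\<lambda>y. ?F y (axis i 1)" "H (axis i 1)"]
        has_derivative_at_withinI[OF H[of "axis i 1"]] by (simp add: o_def)
  qed
  also have "(\<Sum>i\<in>UNIV. V t a $ i *\<^sub>R H (axis i 1) x' + V' $ i *\<^sub>R ?F (snd a (c t)) (axis i 1)) =
      ?A V' + H x' (V t a)"
  proof -
    have "linear (H x')"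
      using has_derivative_bounded_linear[OF H] bounded_linear.linear by blast
    from exp[OF this, of "V t a"] exp[OF transition_deriv_linear[OF a b], of V'] show ?thesis
      by (simp only: sum.distrib sym[of _ x'] transition_deriv_def add.commute)
  qed
  finally show "((\<lambda>s. V s b) has_vector_derivative ?A V' + H x' (V t a)) (at t within I)"
    by (rule has_vector_derivative_transform_within[OF _ d(1) t]) (use Vb in auto)
qed

lemma velocity_in_tangent_space:
  assumes c: "continuous_map (top_of_set I) (underlying M) c" and t: "t \<in> I" and I: "at t within I \<noteq> bot"
    and x: "\<And>a. a \<in> charts_at M (c t) \<Longrightarrow> (\<lambda>s. snd a (c s)) differentiable at t within I"
  shows "velocity M I c t \<in> tangent_space M (c t)"
proof (rule tangent_spaceI)
  fix a b assume ab: "a \<in> charts_at M (c t)" "b \<in> charts_at M (c t)"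
  have "((\<lambda>s. snd a (c s)) has_vector_derivative velocity M I c t a) (at t within I)"
    using x[OF ab(1)] ab(1) vector_derivative_works by (auto simp: velocity_def)
  from vector_field_in_other_chart(1)[OF c t ab this] show
    "velocity M I c t b = transition_deriv a b (c t) (velocity M I c t a)"
    using vector_derivative_within[OF I] ab by (simp add: velocity_def)
qed (simp add: velocity_def)

text \<open>The extra term \<open>H\<close> in the coordinatewise derivative reappears with the
  opposite sign in the transformation law of the Christoffel term, so the two cancel in the
  sum.\<close>

lemma cov_deriv_in_tangent_space:
  assumes c: "continuous_map (top_of_set I) (underlying M) c" and t: "t \<in> I" and I: "at t within I \<noteq> bot"
    and x: "\<And>a. a \<in> charts_at M (c t) \<Longrightarrow> (\<lambda>s. snd a (c s)) differentiable at t within I"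
    and V: "\<And>s. s \<in> I \<Longrightarrow> V s \<in> tangent_space M (c s)"
    and V': "\<And>a. a \<in> charts_at M (c t) \<Longrightarrow> (\<lambda>s. V s a) differentiable at t within I"
  shows "cov_deriv M I c V t \<in> tangent_space M (c t)"
proof (rule tangent_spaceI)
  fix a b assume ab: "a \<in> charts_at M (c t)" "b \<in> charts_at M (c t)"
  let ?A = "transition_deriv a b (c t)" and ?v = "velocity M I c t"
  have cov: "cov_deriv M I c V t a = vector_derivative (\<lambda>s. V s a) (at t within I) +
      christoffel_form a (snd a (c t)) (?v a) (V t a)" if "a \<in> charts_at M (c t)" for a
    using that by (simp add: cov_deriv_def christoffel_form_def)
  have xa: "((\<lambda>s. snd a (c s)) has_vector_derivative ?v a) (at t within I)"
    using x[OF ab(1)] ab(1) vector_derivative_works by (auto simp: velocity_def)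
  have Va: "((\<lambda>s. V s a) has_vector_derivative vector_derivative (\<lambda>s. V s a) (at t within I)) (at t within I)"
    using V'[OF ab(1)] vector_derivative_works by blast
  obtain H where H: "\<And>u. ((\<lambda>y. frechet_derivative (transition a b) (at y) u) has_derivative H u) (at (snd a (c t)))"
      "\<And>u w. H u w = H w u"
    using transition_second_derivative[OF ab] by blast
  have vb: "?v b = ?A (?v a)"
    using tangent_spaceD(1)[OF velocity_in_tangent_space[OF c t I x] ab] .
  have Vtb: "V t b = ?A (V t a)"
    using tangent_spaceD(1)[OF V[OF t] ab] .
  have "vector_derivative (\<lambda>s. V s b) (at t within I) =
      ?A (vector_derivative (\<lambda>s. V s a) (at t within I)) + H (?v a) (V t a)"
    by (rule vector_derivative_within[OF I vector_field_in_other_chart(2)[OF c t ab xa V Va H]])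
  then show "cov_deriv M I c V t b = ?A (cov_deriv M I c V t a)"
    using cov[OF ab(1)] cov[OF ab(2)] vb Vtb christoffel_form_transition[OF ab H, of "?v a" "V t a"]
      linear_add[OF transition_deriv_linear[OF ab]] by (simp add: algebra_simps)
qed (simp add: cov_deriv_def)

end

subsection \<open>Positive orthonormal bases of a tangent space\<close>

context oriented_riemannian
begin

text \<open>The determinant whose sign decides positivity in
  \<open>positive_orthonormal_basis\<close>: the columns are the vectors in the chart
  \<open>a\<close>, the rows are ordered by \<open>coord M\<close>.\<close>

definition chart_det :: "('a, 'n) chart \<Rightarrow> (nat \<Rightarrow> ('a, 'n) tangent) \<Rightarrow> real" where
  "chart_det a b = Determinant.det (Matrix.mat CARD('n) CARD('n) (\<lambda>(i, j). b (j + 1) a $ coord M (i + 1)))"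

text \<open>Coordinates transform by the matrix of the transition derivative. Its determinant is
  positive on an oriented atlas, so the sign of \<open>chart_det\<close> does not depend on the
  chart and can be tested in a single one.\<close>

lemma chart_det_transition:
  assumes a: "a \<in> charts_at M p" and a': "a' \<in> charts_at M p"
    and b: "\<And>j. 1 \<le> j \<Longrightarrow> j \<le> CARD('n) \<Longrightarrow> b j \<in> tangent_space M p"
  shows "chart_det a' b = Determinants.det (matrix (transition_deriv a a' p)) * chart_det a b"
proof -
  let ?A = "matrix (transition_deriv a a' p)"
  have eq: "b j a' $ coord M i = (\<Sum>k=1..CARD('n). ?A $ coord M i $ coord M k * b j a $ coord M k)"
    if "1 \<le> j" "j \<le> CARD('n)" for i j
  proof -
    have "b j a' = ?A *v b j a"
      using tangent_spaceD(1)[OF b[OF that] a a'] fun_cong[OF matrix_vector_mul(2)[OF transition_deriv_linear[OF a a']], of "b j a"] by simp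
    then have "b j a' $ coord M i = (\<Sum>k\<in>UNIV. ?A $ coord M i $ k * b j a $ k)"
      by (simp add: matrix_vector_mult_def)
    also have "\<dots> = (\<Sum>k=1..CARD('n). ?A $ coord M i $ coord M k * b j a $ coord M k)"
      by (rule sum.reindex_bij_betw[OF coord_bij, symmetric])
    finally show ?thesis .
  qed
  have "Matrix.mat CARD('n) CARD('n) (\<lambda>(i, j). b (j + 1) a' $ coord M (i + 1)) =
      Matrix.mat CARD('n) CARD('n) (\<lambda>(i, j). \<Sum>k=1..CARD('n).
        ?A $ coord M (i + 1) $ coord M k * b (j + 1) a $ coord M k)"
    by (intro eq_matI) (auto simp: eq)
  then have "chart_det a' b = Determinant.det (Matrix.mat CARD('n) CARD('n) (\<lambda>(i, j). \<Sum>k=1..CARD('n).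
        ?A $ coord M (i + 1) $ coord M k * b (j + 1) a $ coord M k))"
    by (simp only: chart_det_def)
  also have "\<dots> = Determinant.det (Matrix.mat CARD('n) CARD('n) (\<lambda>(i, j). ?A $ coord M (i + 1) $ coord M (j + 1))) *
      chart_det a b"
    unfolding chart_det_def
    by (rule det_mat_mult[of _ "\<lambda>i k. ?A $ coord M i $ coord M k" "\<lambda>k j. b j a $ coord M k"])
  finally show ?thesis
    by (simp only: det_jordan_normal_form[OF coord_bij])
qed

lemma positive_orthonormal_basis_iff:
  assumes a: "a \<in> charts_at M p"
  shows "positive_orthonormal_basis M p b \<longleftrightarrow>
    inner_product_with_basis.orthonormal (tangent_space M p) (metric M p) CARD('n) b \<and> chart_det a b > 0"
proof -
  interpret inner_product_with_basis "range (coord_vector M a p)" "tangent_space M p" "metric M p"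
    by (rule tangent_basis[OF a charts_at_topspace[OF a]])
  have "chart_det a' b > 0" if "orthonormal CARD('n) b" "chart_det a b > 0" "a' \<in> charts_at M p" for a'
    using chart_det_transition[OF a that(3), of b] transition_det_pos[OF a that(3)] that(1,2)
    by (simp add: orthonormalD)
  then show ?thesis
    using a unfolding positive_orthonormal_basis_def orthonormal_def chart_det_def[symmetric] by blast
qed

context
  fixes p a
  assumes a: "a \<in> charts_at M p"
begin

interpretation inner_product_with_basis "range (coord_vector M a p)" "tangent_space M p" "metric M p"
  rewrites "card (range (coord_vector M a p)) = CARD('n)"
  using tangent_basis[OF a charts_at_topspace[OF a]] by simp_all

lemma linear_chart_component: "linear (\<lambda>v :: ('a, 'n) tangent. v a $ i)"
  by (rule linearI) (simp_all add: scaleR_fun_def)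

lemma chart_det_change:
  assumes "orthonormal CARD('n) b" "orthonormal CARD('n) b'"
  shows "chart_det a b' = chart_det a b *
    Determinant.det (Matrix.mat CARD('n) CARD('n) (\<lambda>(i, j). metric M p (b (i + 1)) (b' (j + 1))))"
  unfolding chart_det_def
  using det_change_of_orthonormal_basis(2)[OF assms, of "\<lambda>i v. v a $ coord M i"] linear_chart_component
  by simp

text \<open>The coordinate vectors of \<open>a\<close> have the identity as their matrix in
  \<open>a\<close>; expanding them in \<open>b\<close> factors 1 as \<open>chart_det a b\<close>
  times another determinant.\<close>

lemma chart_det_nonzero:
  assumes b: "orthonormal CARD('n) b"
  shows "chart_det a b \<noteq> 0"
proof -
  let ?v = "\<lambda>j. coord_vector M a p (coord M j)"
  have v: "?v j \<in> tangent_space M p" for j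
    by (simp add: coord_vector_eq_tangent_lift tangent_lift_in[OF a])
  have "?v j a $ coord M i = (\<Sum>k=1..CARD('n). b k a $ coord M i * metric M p (?v j) (b k))" for i j
  proof -
    have "?v j a = (\<Sum>k=1..CARD('n). metric M p (?v j) (b k) *\<^sub>R b k) a"
      using orthonormal_expansion[OF b v[of j]] by (rule arg_cong)
    then show ?thesis
      by (simp add: sum_tangent_eval scaleR_fun_def mult.commute)
  qed
  then have "Matrix.mat CARD('n) CARD('n) (\<lambda>(i, j). ?v (j + 1) a $ coord M (i + 1)) =
      Matrix.mat CARD('n) CARD('n) (\<lambda>(i, j). \<Sum>k=1..CARD('n). b k a $ coord M (i + 1) * metric M p (?v (j + 1)) (b k))"
    by (intro eq_matI) auto
  also have "Determinant.det \<dots> = chart_det a b *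
      Determinant.det (Matrix.mat CARD('n) CARD('n) (\<lambda>(i, j). metric M p (?v (j + 1)) (b (i + 1))))"
    unfolding chart_det_def
    by (rule det_mat_mult[of _ "\<lambda>i k. b k a $ coord M i" "\<lambda>k j. metric M p (?v j) (b k)"])
  finally have *: "Determinant.det (Matrix.mat CARD('n) CARD('n) (\<lambda>(i, j). ?v (j + 1) a $ coord M (i + 1))) = \<dots>" .
  have inj: "coord M i = coord M j \<longleftrightarrow> i = j" if "i \<in> {1..CARD('n)}" "j \<in> {1..CARD('n)}" for i j
    using inj_on_eq_iff[OF bij_betw_imp_inj_on[OF coord_bij] that] .
  have "Matrix.mat CARD('n) CARD('n) (\<lambda>(i, j). ?v (j + 1) a $ coord M (i + 1)) = 1\<^sub>m CARD('n)"
  proof (rule eq_matI)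
    fix i j assume "i < dim_row (1\<^sub>m CARD('n) :: real mat)" "j < dim_col (1\<^sub>m CARD('n) :: real mat)"
    then have ij: "i < CARD('n)" "j < CARD('n)" by auto
    then show "Matrix.mat CARD('n) CARD('n) (\<lambda>(i, j). ?v (j + 1) a $ coord M (i + 1)) $$ (i, j) = 1\<^sub>m CARD('n) $$ (i, j)"
      using inj[of "i + 1" "j + 1"]
      by (simp add: coord_vector_eq_tangent_lift tangent_lift_self[OF a] axis_def)
  qed auto
  then show ?thesis using * by auto
qed

text \<open>The change of basis is the diagonal matrix with entries 1, ..., 1, -1.\<close>

lemma chart_det_negate_top:
  assumes b: "orthonormal CARD('n) (b(CARD('n) := u))"
  shows "orthonormal CARD('n) (b(CARD('n) := - u))"
    and "chart_det a (b(CARD('n) := - u)) = - chart_det a (b(CARD('n) := u))"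
proof -
  let ?n = "CARD('n)"
  define s where "s = (\<lambda>i. if i = ?n then - 1 else 1 :: real)"
  define bu where "bu = b(?n := u)"
  have b': "b(?n := - u) = (\<lambda>i. s i *\<^sub>R bu i)"
    by (simp add: fun_eq_iff s_def bu_def)
  note bu = b[folded bu_def]
  have g: "metric M p (bu i) (s j *\<^sub>R bu j) = (if i = j then s j else 0)"
    if "1 \<le> i" "i \<le> ?n" "1 \<le> j" "j \<le> ?n" for i j
    using orthonormalD[OF bu] that by (simp add: inner_scaleR_right)
  have "s i * s i = 1" for i by (simp add: s_def)
  then show on: "orthonormal ?n (b(?n := - u))"
    unfolding b' orthonormal_def using orthonormalD(1)[OF bu] g by (simp add: inner_scaleR_left)
  have "Determinant.det (Matrix.mat ?n ?n (\<lambda>(i, j). metric M p (bu (i + 1)) (s (j + 1) *\<^sub>R bu (j + 1)))) =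
      (\<Prod>i=1..?n. metric M p (bu i) (s i *\<^sub>R bu i))"
    by (rule det_mat_lower_triangular[of _ "\<lambda>i j. metric M p (bu i) (s j *\<^sub>R bu j)"]) (simp add: g)
  also have "\<dots> = (\<Prod>i\<in>{1..?n}. s i)"
    by (intro prod.cong refl) (simp add: g)
  also have "\<dots> = -1" unfolding s_def by (subst prod.delta) auto
  finally show "chart_det a (b(?n := - u)) = - chart_det a (b(?n := u))"
    using chart_det_change[OF bu on[unfolded b']] unfolding b' bu_def[symmetric] by simp
qed

text \<open>The unit completions of \<open>e\<close> are some u and -u; their chart determinants are
  nonzero and opposite, so exactly one is positive. This gives the \<open>THE\<close> in
  \<open>frenet\<close> its meaning.\<close>

lemma positive_top_ex1:
  assumes e: "orthonormal (CARD('n) - 1) e"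
  shows "\<exists>!u. positive_orthonormal_basis M p (e(CARD('n) := u))"
proof -
  let ?n = "CARD('n)"
  have n: "?n \<ge> 1" by simp
  then have "Suc (?n - 1) = ?n" by simp
  from orthonormal_extension[OF e this] obtain u where u: "orthonormal ?n (e(?n := u))" by blast
  have "\<exists>u. orthonormal ?n (e(?n := u)) \<and> chart_det a (e(?n := u)) > 0"
  proof (cases "chart_det a (e(?n := u)) > 0")
    case True
    then show ?thesis using u by blast
  next
    case False
    then have "chart_det a (e(?n := - u)) > 0"
      using chart_det_nonzero[OF u] chart_det_negate_top(2)[OF u] by linarith
    then show ?thesis using chart_det_negate_top(1)[OF u] by blast
  qed
  then obtain w where w: "orthonormal ?n (e(?n := w))" "chart_det a (e(?n := w)) > 0" by blast
  show ?thesis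
  proof (rule ex1I[of _ w])
    show "positive_orthonormal_basis M p (e(?n := w))"
      using w positive_orthonormal_basis_iff[OF a] by blast
  next
    fix w' assume "positive_orthonormal_basis M p (e(?n := w'))"
    then have w': "orthonormal ?n (e(?n := w'))" "chart_det a (e(?n := w')) > 0"
      using positive_orthonormal_basis_iff[OF a] by blast+
    from orthonormal_top_unique[OF w(1) w'(1) n] show "w' = w"
      using chart_det_negate_top(2)[OF w(1)] w(2) w'(2) by auto
  qed
qed

text \<open>Gives the \<open>THE\<close> in \<open>tangent_det\<close> its meaning: between two
  positive orthonormal bases the change-of-basis determinant has square 1 and is positive by
  orientation, so it is 1.\<close>

lemma tangent_det_eq:
  assumes b: "positive_orthonormal_basis M p b"
    and v: "\<And>j. 1 \<le> j \<Longrightarrow> j \<le> CARD('n) \<Longrightarrow> v j \<in> tangent_space M p"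
  shows "tangent_det M p v =
    Determinant.det (Matrix.mat CARD('n) CARD('n) (\<lambda>(i, j). metric M p (b (i + 1)) (v (j + 1))))"
  unfolding tangent_det_def
proof (rule the_equality)
  let ?n = "CARD('n)"
  have on: "orthonormal ?n b" and pos: "chart_det a b > 0"
    using b positive_orthonormal_basis_iff[OF a] by blast+
  let ?d = "Determinant.det (Matrix.mat ?n ?n (\<lambda>(i, j). metric M p (b (i + 1)) (v (j + 1))))"
  show "\<forall>b x. positive_orthonormal_basis M p b \<and>
      (\<forall>j\<in>{1..?n}. v j = (\<Sum>i=1..?n. x i j *\<^sub>R b i)) \<longrightarrow>
      ?d = Determinant.det (Matrix.mat ?n ?n (\<lambda>(i, j). x (i + 1) (j + 1)))"
  proof (intro allI impI, elim conjE)
    fix b' x assume b': "positive_orthonormal_basis M p b'"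
      and x: "\<forall>j\<in>{1..?n}. v j = (\<Sum>i=1..?n. x i j *\<^sub>R b' i)"
    have on': "orthonormal ?n b'" and pos': "chart_det a b' > 0"
      using b' positive_orthonormal_basis_iff[OF a] by blast+
    define q where "q = Determinant.det (Matrix.mat ?n ?n (\<lambda>(i, j). metric M p (b (i + 1)) (b' (j + 1))))"
    have "q\<^sup>2 = 1" unfolding q_def by (rule det_change_of_orthonormal_basis(1)[OF on on'])
    moreover have "q > 0"
      using chart_det_change[OF on on'] pos pos' by (simp add: q_def zero_less_mult_iff)
    ultimately have q: "q = 1" by (simp add: power2_eq_1_iff)
    have xij: "metric M p (b' i) (v j) = x i j" if "1 \<le> i" "i \<le> ?n" "1 \<le> j" "j \<le> ?n" for i j
    proof -
      have "metric M p (b' i) (v j) = metric M p (v j) (b' i)"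
        using that on' v by (intro inner_commute) (auto simp: orthonormalD)
      also have "\<dots> = metric M p (\<Sum>i=1..?n. x i j *\<^sub>R b' i) (b' i)"
        using x that by simp
      also have "\<dots> = x i j"
        using that by (intro orthonormal_coefficient[OF on'])
      finally show ?thesis .
    qed
    have "?d = q * Determinant.det (Matrix.mat ?n ?n (\<lambda>(i, j). metric M p (b' (i + 1)) (v (j + 1))))"
      unfolding q_def by (rule det_change_of_orthonormal_basis(3)[OF on on' v])
    also have "Matrix.mat ?n ?n (\<lambda>(i, j). metric M p (b' (i + 1)) (v (j + 1))) =
        Matrix.mat ?n ?n (\<lambda>(i, j). x (i + 1) (j + 1))"
      by (intro eq_matI) (auto simp: xij)
    finally show "?d = Determinant.det (Matrix.mat ?n ?n (\<lambda>(i, j). x (i + 1) (j + 1)))"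
      by (simp add: q)
  qed
  have exp: "\<forall>j\<in>{1..?n}. v j = (\<Sum>i=1..?n. metric M p (b i) (v j) *\<^sub>R b i)"
  proof
    fix j assume j: "j \<in> {1..?n}"
    have "v j = (\<Sum>i=1..?n. metric M p (v j) (b i) *\<^sub>R b i)"
      using orthonormal_expansion[OF on, of "v j"] v j by simp
    also have "\<dots> = (\<Sum>i=1..?n. metric M p (b i) (v j) *\<^sub>R b i)"
      using on v j by (intro sum.cong refl arg_cong2[of _ _ _ _ scaleR] inner_commute) (auto simp: orthonormalD)
    finally show "v j = (\<Sum>i=1..?n. metric M p (b i) (v j) *\<^sub>R b i)" .
  qed
  \<comment> \<open>The given basis \<open>b\<close> keeps the defining implication from being
    vacuous and thereby pins down \<open>d\<close>.\<close>
  show "d = ?d" if "\<forall>b x. positive_orthonormal_basis M p b \<and>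
      (\<forall>j\<in>{1..?n}. v j = (\<Sum>i=1..?n. x i j *\<^sub>R b i)) \<longrightarrow>
      d = Determinant.det (Matrix.mat ?n ?n (\<lambda>(i, j). x (i + 1) (j + 1)))" for d
    using that[rule_format, of b "\<lambda>i j. metric M p (b i) (v j)"] b exp by blast
qed

end

section \<open>The Leibniz rule for the covariant derivative\<close>

lemma christoffel_form_linear_right: "linear (christoffel_form a x u)"
  by (rule linearI)
    (simp_all add: christoffel_form_def Finite_Cartesian_Product.vec_eq_iff algebra_simps sum.distrib sum_distrib_left)

text \<open>Rests on the linearity of the Christoffel term in the field. In a chart not containing
  \<open>c t\<close> the covariant derivative is 0 by definition, and \<open>V0\<close> makes the
  other terms vanish there too.\<close>

lemma cov_deriv_linear_combination:
  assumes t: "t \<in> I" and I: "at t within I \<noteq> bot"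
    and W: "\<And>s. s \<in> I \<Longrightarrow> W s = (\<Sum>k\<in>K. f k s *\<^sub>R V k s)"
    and f: "\<And>k. k \<in> K \<Longrightarrow> (f k has_real_derivative f' k) (at t within I)"
    and V: "\<And>k a. k \<in> K \<Longrightarrow> a \<in> charts_at M (c t) \<Longrightarrow> (\<lambda>s. V k s a) differentiable at t within I"
    and V0: "\<And>k a. k \<in> K \<Longrightarrow> a \<notin> charts_at M (c t) \<Longrightarrow> V k t a = 0"
  shows "cov_deriv M I c W t = (\<Sum>k\<in>K. f' k *\<^sub>R V k t + f k t *\<^sub>R cov_deriv M I c (V k) t)"
proof
  fix a
  let ?G = "christoffel_form a (snd a (c t)) (velocity M I c t a)"
  show "cov_deriv M I c W t a = (\<Sum>k\<in>K. f' k *\<^sub>R V k t + f k t *\<^sub>R cov_deriv M I c (V k) t) a"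
  proof (cases "a \<in> charts_at M (c t)")
    case True
    have cov: "cov_deriv M I c V t a = vector_derivative (\<lambda>s. V s a) (at t within I) + ?G (V t a)" for V
      using True by (simp add: cov_deriv_def christoffel_form_def)
    have "((\<lambda>s. \<Sum>k\<in>K. f k s *\<^sub>R V k s a) has_vector_derivative
        (\<Sum>k\<in>K. f k t *\<^sub>R vector_derivative (\<lambda>s. V k s a) (at t within I) + f' k *\<^sub>R V k t a)) (at t within I)"
      using f V[OF _ True] by (intro has_vector_derivative_sum has_vector_derivative_scaleR) (auto simp: vector_derivative_works)
    then have "((\<lambda>s. W s a) has_vector_derivative
        (\<Sum>k\<in>K. f k t *\<^sub>R vector_derivative (\<lambda>s. V k s a) (at t within I) + f' k *\<^sub>R V k t a)) (at t within I)"
      by (rule has_vector_derivative_transform[OF t, rotated]) (simp add: W sum_tangent_eval scaleR_fun_def)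
    from vector_derivative_within[OF I this]
    have 1: "vector_derivative (\<lambda>s. W s a) (at t within I) =
        (\<Sum>k\<in>K. f k t *\<^sub>R vector_derivative (\<lambda>s. V k s a) (at t within I) + f' k *\<^sub>R V k t a)" .
    have 2: "?G (W t a) = (\<Sum>k\<in>K. f k t *\<^sub>R ?G (V k t a))"
      by (simp only: W[OF t] sum_tangent_eval scaleR_fun_def linear_sum[OF christoffel_form_linear_right]
          linear_scale[OF christoffel_form_linear_right])
    show ?thesis
      unfolding cov 1 2 sum_tangent_eval plus_fun_apply
      by (simp add: cov scaleR_fun_def scaleR_add_right sum.distrib)
  next
    case False
    then show ?thesis
      using V0 by (simp add: cov_deriv_def sum_tangent_eval scaleR_fun_def)
  qed
qed

end

subsection \<open>The Frenet frame of a regular curve\<close>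

text \<open>The Frenet frame and the Gram-Schmidt family updated at n are compared only at the
  indices 1, ..., n.\<close>

lemma positive_orthonormal_basis_cong:
  fixes M :: "('a, 'n::finite) riem"
  assumes b: "\<And>i. 1 \<le> i \<Longrightarrow> i \<le> CARD('n) \<Longrightarrow> b i = b' i"
  shows "positive_orthonormal_basis M p b \<longleftrightarrow> positive_orthonormal_basis M p b'"
proof -
  have "Matrix.mat CARD('n) CARD('n) (\<lambda>(i, j). b (j + 1) a $ coord M (i + 1)) =
      Matrix.mat CARD('n) CARD('n) (\<lambda>(i, j). b' (j + 1) a $ coord M (i + 1))" for a
    by (intro eq_matI) (auto simp: b)
  then show ?thesis
    unfolding positive_orthonormal_basis_def by (simp add: b)
qed

locale regular_riemannian_curve = oriented_riemannian M
  for M :: "('a, 'n::finite) riem" +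
  fixes I :: "real set" and c :: "real \<Rightarrow> 'a"
  assumes dim: "CARD('n) \<ge> 2"
    and interval: "is_interval I" "interior I \<noteq> {}"
    and smooth: "Ck_curve CARD('n) M I c"
    and regular: "regular_curve M I c"
begin

abbreviation v :: "nat \<Rightarrow> real \<Rightarrow> ('a, 'n) tangent" where
  "v \<equiv> curve_deriv M I c"

abbreviation e :: "real \<Rightarrow> nat \<Rightarrow> ('a, 'n) tangent" where
  "e t \<equiv> gram_schmidt_onb (metric M (c t)) (\<lambda>k. v k t)"

section \<open>Differentiability and tangency of the covariant derivatives\<close>

lemma c_continuous: "continuous_map (top_of_set I) (underlying M) c"
  using smooth by (simp add: Ck_curve_def)

text \<open>A connected set with more than one point has no isolated points. This makes derivatives
  within \<open>I\<close> unique, also at end points.\<close>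

lemma at_within_nontrivial: "t \<in> I \<Longrightarrow> at t within I \<noteq> bot"
proof -
  assume t: "t \<in> I"
  have "connected I" using interval(1) is_interval_connected by blast
  moreover have "I \<noteq> {x}" for x using interval(2) by auto
  ultimately have "t islimpt I" using t connected_imp_perfect by blast
  then show ?thesis using trivial_limit_within by blast
qed

lemma c_in: "t \<in> I \<Longrightarrow> c t \<in> topspace (underlying M)"
  using c_continuous by (auto simp: continuous_map_def)

lemma preimage_chart:
  assumes "a \<in> atlas M"
  obtains U where "open U" "{t \<in> I. c t \<in> fst a} = I \<inter> U"
proof -
  have "openin (top_of_set I) {t \<in> topspace (top_of_set I). c t \<in> fst a}"
    by (rule openin_continuous_map_preimage[OF c_continuous chart_domain_openin[OF assms]])
  then show ?thesis using that by (auto simp: openin_open)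
qed

lemma curve_times_differentiable:
  assumes a: "a \<in> atlas M"
  shows "times_differentiable CARD('n) {t \<in> I. c t \<in> fst a} (\<lambda>t. snd a (c t))"
  using smooth a by (auto simp: Ck_curve_def intro: Ck_on_times_differentiable)

text \<open>Each covariant differentiation uses up one order: c^(k) keeps n - k orders, and c^(n)
  none. The Christoffel symbols along the curve keep n orders. Indexing by \<open>Suc k\<close>
  skips the dummy value at 0.\<close>

lemma curve_deriv_times_differentiable:
  assumes a: "a \<in> atlas M"
  shows "Suc k \<le> CARD('n) \<Longrightarrow>
    times_differentiable (CARD('n) - Suc k) {t \<in> I. c t \<in> fst a} (\<lambda>t. v (Suc k) t a)"
proof (induction k)
  let ?J = "{t \<in> I. c t \<in> fst a}"
  obtain U where U: "open U" "?J = I \<inter> U" using preimage_chart[OF a] by blast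
  have ch: "a \<in> charts_at M (c t)" if "t \<in> ?J" for t using a that by (simp add: charts_at_def)
  note deriv = times_differentiable_vector_derivative(2)[OF _ U(1) at_within_nontrivial, folded U(2)]
  {
    case 0
    have "times_differentiable (CARD('n) - 1) ?J (\<lambda>t. vector_derivative (\<lambda>s. snd a (c s)) (at t within I))"
      by (rule deriv) (use curve_times_differentiable[OF a] in auto)
    then have "times_differentiable (CARD('n) - 1) ?J (\<lambda>t. velocity M I c t a)"
      by (rule times_differentiable_cong[rotated]) (simp add: velocity_def ch)
    then show ?case by simp
  next
    case (Suc k)
    let ?m = "CARD('n) - Suc (Suc k)"
    have m: "Suc ?m = CARD('n) - Suc k" using Suc.prems by simp
    have IH: "times_differentiable (Suc ?m) ?J (\<lambda>t. v (Suc k) t a)"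
      unfolding m using Suc by simp
    have "times_differentiable (CARD('n) - 1) ?J (\<lambda>t. vector_derivative (\<lambda>s. snd a (c s)) (at t within I))"
      by (rule deriv) (use curve_times_differentiable[OF a] in auto)
    then have vel: "times_differentiable (CARD('n) - 1) ?J (\<lambda>t. velocity M I c t a)"
      by (rule times_differentiable_cong[rotated]) (simp add: velocity_def ch)
    have V1: "times_differentiable ?m ?J (\<lambda>t. velocity M I c t a $ i)" for i
      by (rule times_differentiable_component[OF times_differentiable_mono[OF vel]]) simp
    have V2: "times_differentiable ?m ?J (\<lambda>t. v (Suc k) t a $ i)" for i
      by (rule times_differentiable_component[OF times_differentiable_Suc[OF IH]])
    have G: "times_differentiable ?m ?J (\<lambda>t. christoffel M a (snd a (c t)) r i j)" for r i j
      by (rule times_differentiable_compose[of _ _ "snd a ` fst a", OF _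
            times_differentiable_mono[OF curve_times_differentiable[OF a]]
            christoffel_times_differentiable[OF a]]) auto
    have "times_differentiable ?m ?J (\<lambda>t. vector_derivative (\<lambda>s. v (Suc k) s a) (at t within I) +
        (\<chi> r. \<Sum>i\<in>UNIV. \<Sum>j\<in>UNIV. christoffel M a (snd a (c t)) r i j * velocity M I c t a $ i * v (Suc k) t a $ j))"
    proof (rule times_differentiable_add)
      show "times_differentiable ?m ?J (\<lambda>t. vector_derivative (\<lambda>s. v (Suc k) s a) (at t within I))"
        by (rule deriv) (use IH in auto)
      have "times_differentiable ?m ?J (\<lambda>t. \<Sum>i\<in>UNIV. \<Sum>j\<in>UNIV.
          christoffel M a (snd a (c t)) r i j * velocity M I c t a $ i * v (Suc k) t a $ j)" for r
        by (intro times_differentiable_sum times_differentiable_mult G V1 V2)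
      then show "times_differentiable ?m ?J (\<lambda>t. \<chi> r. \<Sum>i\<in>UNIV. \<Sum>j\<in>UNIV.
          christoffel M a (snd a (c t)) r i j * velocity M I c t a $ i * v (Suc k) t a $ j)"
        by (intro times_differentiable_vec) simp
    qed
    then show ?case
      by (rule times_differentiable_cong[rotated]) (simp add: cov_deriv_def ch)
  }
qed

lemma times_differentiable_imp_differentiable:
  assumes "a \<in> charts_at M (c t)" "t \<in> I" and f: "times_differentiable (Suc 0) {s \<in> I. c s \<in> fst a} f"
  shows "f differentiable at t within I"
proof -
  obtain U where U: "open U" "{t \<in> I. c t \<in> fst a} = I \<inter> U"
    using preimage_chart[OF charts_atD(1)[OF assms(1)]] by blast
  have "t \<in> I \<inter> U" using assms(1,2) unfolding U(2)[symmetric] by (simp add: charts_at_def)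
  from times_differentiable_vector_derivative(1)[OF f[unfolded U(2)] U(1) at_within_nontrivial this]
  show ?thesis using differentiableI_vector by blast
qed

lemma curve_differentiable:
  assumes "a \<in> charts_at M (c t)" "t \<in> I"
  shows "(\<lambda>s. snd a (c s)) differentiable at t within I"
  by (rule times_differentiable_imp_differentiable[OF assms times_differentiable_mono[OF
        curve_times_differentiable[OF charts_atD(1)[OF assms(1)]]]]) (use dim in simp)

lemma curve_deriv_once_differentiable:
  assumes "a \<in> atlas M" "1 \<le> k" "k < CARD('n)"
  shows "times_differentiable (Suc 0) {s \<in> I. c s \<in> fst a} (\<lambda>t. v k t a)"
  using times_differentiable_mono[OF curve_deriv_times_differentiable[OF assms(1), of "k - 1"], of "Suc 0"] assms(2,3)
  by simp

lemma curve_deriv_differentiable: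
  assumes "a \<in> charts_at M (c t)" "t \<in> I" "1 \<le> k" "k < CARD('n)"
  shows "(\<lambda>s. v k s a) differentiable at t within I"
  using times_differentiable_imp_differentiable[OF assms(1,2)
      curve_deriv_once_differentiable[OF charts_atD(1)[OF assms(1)] assms(3,4)]] .

text \<open>Reaches c^(n): its tangency needs c^(n-1) to be differentiable once, which the count of
  orders grants.\<close>

lemma curve_deriv_in: "Suc k \<le> CARD('n) \<Longrightarrow> t \<in> I \<Longrightarrow> v (Suc k) t \<in> tangent_space M (c t)"
proof (induction k arbitrary: t)
  case 0
  have "velocity M I c t \<in> tangent_space M (c t)"
    by (rule velocity_in_tangent_space[OF c_continuous 0(2) at_within_nontrivial[OF 0(2)]
          curve_differentiable[OF _ 0(2)]])
  then show ?case by simp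
next
  case (Suc k)
  have "cov_deriv M I c (v (Suc k)) t \<in> tangent_space M (c t)"
    by (rule cov_deriv_in_tangent_space[OF c_continuous Suc.prems(2) at_within_nontrivial[OF Suc.prems(2)]
          curve_differentiable[OF _ Suc.prems(2)]])
      (use Suc in \<open>auto simp del: curve_deriv.simps intro!: curve_deriv_differentiable\<close>)
  then show ?case by simp
qed

lemma curve_deriv_in_tangent_space:
  "1 \<le> k \<Longrightarrow> k \<le> CARD('n) \<Longrightarrow> t \<in> I \<Longrightarrow> v k t \<in> tangent_space M (c t)"
  using curve_deriv_in[of "k - 1" t] by simp

text \<open>The function is defined on all of \<open>I\<close>; only the proof is local, in the
  coordinates of a chart around \<open>c t\<close>. These entries carry the differentiability of the
  Gram-Schmidt coefficients.\<close>

lemma gram_entry_differentiable: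
  assumes "t \<in> I" "1 \<le> i" "i < CARD('n)" "1 \<le> j" "j < CARD('n)"
  shows "(\<lambda>s. metric M (c s) (v i s) (v j s)) differentiable at t within I"
proof -
  obtain a where a: "a \<in> charts_at M (c t)" using charts_at_nonempty[OF c_in[OF assms(1)]] by blast
  let ?J = "{s \<in> I. c s \<in> fst a}"
  note at = charts_atD(1)[OF a]
  have "times_differentiable (Suc 0) ?J (\<lambda>s. metric_coeff M a (snd a (c s)) $ k $ l)" for k l
    by (rule times_differentiable_compose[of _ _ "snd a ` fst a", OF _
          times_differentiable_mono[OF curve_times_differentiable[OF at]]
          metric_coeff_times_differentiable[OF at]]) (use dim in auto)
  moreover have "times_differentiable (Suc 0) ?J (\<lambda>s. v m s a $ k)" if "1 \<le> m" "m < CARD('n)" for m k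
    by (rule times_differentiable_component[OF curve_deriv_once_differentiable[OF at that]])
  ultimately have "times_differentiable (Suc 0) ?J (\<lambda>s. \<Sum>k\<in>UNIV. \<Sum>l\<in>UNIV.
      metric_coeff M a (snd a (c s)) $ k $ l * v i s a $ k * v j s a $ l)"
    using assms by (intro times_differentiable_sum times_differentiable_mult) auto
  then have "times_differentiable (Suc 0) ?J (\<lambda>s. metric M (c s) (v i s) (v j s))"
  proof (rule times_differentiable_cong[rotated])
    fix s assume s: "s \<in> ?J"
    then have ch: "a \<in> charts_at M (c s)" using at by (simp add: charts_at_def)
    have "v i s \<in> tangent_space M (c s)" "v j s \<in> tangent_space M (c s)"
      using s assms by (auto intro!: curve_deriv_in_tangent_space)
    then show "(\<Sum>k\<in>UNIV. \<Sum>l\<in>UNIV. metric_coeff M a (snd a (c s)) $ k $ l * v i s a $ k * v j s a $ l) =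
        metric M (c s) (v i s) (v j s)"
      using metric_in_chart[OF ch charts_at_topspace[OF ch], of "v i s a" "v j s a"]
      by (simp add: tangent_lift_eval ch)
  qed
  then show ?thesis by (rule times_differentiable_imp_differentiable[OF a assms(1)])
qed

section \<open>The Frenet frame at a fixed parameter\<close>

lemma frenet_gram_schmidt: "i < CARD('n) \<Longrightarrow> frenet M I c i t = e t i"
  by (simp add: frenet_def Let_def)

context
  fixes t a
  assumes t: "t \<in> I" and a: "a \<in> charts_at M (c t)"
begin

text \<open>The chart \<open>a\<close> supplies a basis and thereby the dimension; the inner product
  space itself depends on \<open>t\<close> alone.\<close>

interpretation T: inner_product_with_basis "range (coord_vector M a (c t))" "tangent_space M (c t)" "metric M (c t)"
  rewrites "card (range (coord_vector M a (c t))) = CARD('n)"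
  using tangent_basis[OF a charts_at_topspace[OF a]] by simp_all

lemma gram_schmidt_frame:
  "T.orthonormal (CARD('n) - 1) (e t)"
  "i \<in> {1..CARD('n) - 1} \<Longrightarrow> v i t = (\<Sum>j=1..i. metric M (c t) (v i t) (e t j) *\<^sub>R e t j)"
  "i \<in> {1..CARD('n) - 1} \<Longrightarrow> metric M (c t) (v i t) (e t i) > 0"
proof -
  have r: "inj_on (\<lambda>k. v k t) {1..CARD('n) - 1}" "independent ((\<lambda>k. v k t) ` {1..CARD('n) - 1})"
    using regular t by (auto simp: regular_curve_def)
  have "T.orthonormal (CARD('n) - 1) (e t) \<and> (\<forall>i\<in>{1..CARD('n) - 1}.
      v i t = (\<Sum>j=1..i. metric M (c t) (v i t) (e t j) *\<^sub>R e t j) \<and>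
      metric M (c t) (v i t) (e t i) > 0 \<and> e t i \<in> span ((\<lambda>k. v k t) ` {1..i}))"
    by (rule T.gram_schmidt[OF _ r]) (use t in \<open>auto intro!: curve_deriv_in_tangent_space\<close>)
  then show "T.orthonormal (CARD('n) - 1) (e t)"
    "i \<in> {1..CARD('n) - 1} \<Longrightarrow> v i t = (\<Sum>j=1..i. metric M (c t) (v i t) (e t j) *\<^sub>R e t j)"
    "i \<in> {1..CARD('n) - 1} \<Longrightarrow> metric M (c t) (v i t) (e t i) > 0"
    by blast+
qed

lemma frenet_positive_orthonormal_basis: "positive_orthonormal_basis M (c t) (\<lambda>i. frenet M I c i t)"
proof -
  let ?n = "CARD('n)"
  have "positive_orthonormal_basis M (c t) ((e t)(?n := frenet M I c ?n t))"
    using theI'[OF positive_top_ex1[OF a gram_schmidt_frame(1)]] by (simp add: frenet_def Let_def)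
  moreover have "((e t)(?n := frenet M I c ?n t)) i = frenet M I c i t" if "i \<le> ?n" for i
    using that by (auto simp: frenet_gram_schmidt)
  ultimately show ?thesis
    by (subst positive_orthonormal_basis_cong[symmetric]) auto
qed

lemma frenet_orthonormal: "T.orthonormal CARD('n) (\<lambda>i. frenet M I c i t)"
  using frenet_positive_orthonormal_basis positive_orthonormal_basis_iff[OF a] by blast

lemma curve_deriv_expansion:
  assumes "i \<in> {1..CARD('n) - 1}"
  shows "v i t = (\<Sum>j=1..i. metric M (c t) (v i t) (frenet M I c j t) *\<^sub>R frenet M I c j t)"
proof -
  have "(\<Sum>j=1..i. metric M (c t) (v i t) (frenet M I c j t) *\<^sub>R frenet M I c j t) =
      (\<Sum>j=1..i. metric M (c t) (v i t) (e t j) *\<^sub>R e t j)"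
    using assms by (intro sum.cong refl) (auto simp: frenet_gram_schmidt)
  then show ?thesis using gram_schmidt_frame(2)[OF assms] by simp
qed

lemma curve_deriv_frenet_orthogonal:
  assumes "1 \<le> i" "i < l" "l \<le> CARD('n)"
  shows "metric M (c t) (v i t) (frenet M I c l t) = 0"
  by (rule T.gram_schmidt_triangular[OF frenet_orthonormal, where v = "\<lambda>i. v i t" and i = i])
    (use assms curve_deriv_expansion[of i] in auto)

lemma frenet_in_tangent_space: "1 \<le> i \<Longrightarrow> i \<le> CARD('n) \<Longrightarrow> frenet M I c i t \<in> tangent_space M (c t)"
  using T.orthonormalD(1)[OF frenet_orthonormal] .

text \<open>The square root and the square cancel because every factor is positive, which regularity
  provides up to the index n - 1.\<close>

lemma vol_curve_deriv:
  assumes "k \<le> CARD('n) - 1"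
  shows "vol M (c t) k (\<lambda>k. v k t) = (\<Prod>i=1..k. metric M (c t) (v i t) (frenet M I c i t))"
proof -
  have "Determinant.det (Matrix.mat k k (\<lambda>(i, j). metric M (c t) (v (i + 1) t) (v (j + 1) t))) =
      (\<Prod>i=1..k. metric M (c t) (v i t) (frenet M I c i t))\<^sup>2"
    by (rule T.det_gram_matrix[OF T.orthonormal_mono[OF frenet_orthonormal], where v = "\<lambda>i. v i t"])
      (use assms curve_deriv_expansion in auto)
  moreover have "(\<Prod>i=1..k. metric M (c t) (v i t) (frenet M I c i t)) > 0"
    using assms gram_schmidt_frame(3) by (intro prod_pos) (auto simp: frenet_gram_schmidt)
  ultimately show ?thesis by (simp add: vol_def)
qed

text \<open>In the Frenet frame, with c^(j) in column j, the coordinate matrix is upper triangular.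
  The last factor may have either sign, and the determinant retains it.\<close>

lemma tangent_det_curve_deriv:
  "tangent_det M (c t) (\<lambda>k. v k t) = (\<Prod>i=1..CARD('n). metric M (c t) (v i t) (frenet M I c i t))"
proof -
  let ?n = "CARD('n)"
  have sym: "metric M (c t) (frenet M I c i t) (v j t) = metric M (c t) (v j t) (frenet M I c i t)"
    if "1 \<le> i" "i \<le> ?n" "1 \<le> j" "j \<le> ?n" for i j
    using that t by (intro T.inner_commute frenet_in_tangent_space curve_deriv_in_tangent_space)
  have "tangent_det M (c t) (\<lambda>k. v k t) =
      Determinant.det (Matrix.mat ?n ?n (\<lambda>(i, j). metric M (c t) (frenet M I c (i + 1) t) (v (j + 1) t)))"
    by (rule tangent_det_eq[OF a frenet_positive_orthonormal_basis])
      (use t in \<open>auto intro: curve_deriv_in_tangent_space\<close>)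
  also have "\<dots> = (\<Prod>i=1..?n. metric M (c t) (frenet M I c i t) (v i t))"
    by (rule det_mat_upper_triangular[of _ "\<lambda>i j. metric M (c t) (frenet M I c i t) (v j t)"])
      (simp add: sym curve_deriv_frenet_orthogonal)
  also have "\<dots> = (\<Prod>i=1..?n. metric M (c t) (v i t) (frenet M I c i t))"
    by (intro prod.cong refl) (simp add: sym)
  finally show ?thesis .
qed

lemma metric_linear_combination:
  assumes "\<And>k. k \<in> K \<Longrightarrow> f k \<in> tangent_space M (c t)" "w \<in> tangent_space M (c t)"
  shows "metric M (c t) (\<Sum>k\<in>K. r k *\<^sub>R f k) w = (\<Sum>k\<in>K. r k * metric M (c t) (f k) w)"
    and "metric M (c t) w (\<Sum>k\<in>K. r k *\<^sub>R f k) = (\<Sum>k\<in>K. r k * metric M (c t) w (f k))"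
  by (intro T.inner_sum_scaleR_left T.inner_sum_scaleR_right assms; assumption)+

text \<open>That \<open>w\<close> has positive square length is inferred backwards: a zero residual
  would make the unit vector \<open>e t r\<close> vanish.\<close>

lemma gram_schmidt_step:
  assumes r: "1 \<le> r" "r < CARD('n)"
  defines "w \<equiv> v r t - (\<Sum>j\<in>{1..<r}. metric M (c t) (v r t) (e t j) *\<^sub>R e t j)"
  shows "e t r = (1 / sqrt (metric M (c t) w w)) *\<^sub>R w" and "metric M (c t) w w > 0"
    and "w \<in> tangent_space M (c t)" and "metric M (c t) (e t r) (e t r) = 1"
proof -
  show e: "e t r = (1 / sqrt (metric M (c t) w w)) *\<^sub>R w"
    by (subst gram_schmidt_onb.simps) (simp add: Let_def w_def)
  show w: "w \<in> tangent_space M (c t)"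
    unfolding w_def using r t T.orthonormalD(1)[OF gram_schmidt_frame(1)]
    by (intro T.diff_in T.sum_in T.scaleR_in curve_deriv_in_tangent_space) auto
  show one: "metric M (c t) (e t r) (e t r) = 1"
    using T.orthonormalD(2)[OF gram_schmidt_frame(1), of r r] r by simp
  have "w \<noteq> 0"
  proof
    assume "w = 0"
    then have "e t r = 0" unfolding e by simp
    then show False using one T.inner_zero_left[OF T.zero_in] by simp
  qed
  then show "metric M (c t) w w > 0" using w T.inner_pos by blast
qed

end

text \<open>Coefficients on the whole interval and free of charts, by strong induction along the
  Gram-Schmidt recursion. All sums run to n - 1 regardless of \<open>r\<close>, padded by zeros, so
  that sums for different vectors can be interchanged; the padding vanishes as a function, hence so
  does its derivative.\<close>

lemma frenet_coefficients:
  "1 \<le> r \<Longrightarrow> r < CARD('n) \<Longrightarrow>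
    \<exists>\<alpha>. (\<forall>k. r < k \<longrightarrow> \<alpha> k = (\<lambda>_. 0)) \<and> (\<forall>k. \<forall>t\<in>I. \<alpha> k differentiable at t within I) \<and>
      (\<forall>s\<in>I. e s r = (\<Sum>k=1..CARD('n) - 1. \<alpha> k s *\<^sub>R v k s))"
proof (induction r rule: less_induct)
  case (less r)
  let ?K = "{1..CARD('n) - 1}"
  \<comment> \<open>Bundled as a predicate so that \<open>choice\<close> selects the coefficients
    \<open>A j\<close> for all j < r at once.\<close>
  define P where "P = (\<lambda>j (\<alpha> :: nat \<Rightarrow> real \<Rightarrow> real). (\<forall>k. j < k \<longrightarrow> \<alpha> k = (\<lambda>_. 0)) \<and>
    (\<forall>k. \<forall>t\<in>I. \<alpha> k differentiable at t within I) \<and> (\<forall>s\<in>I. e s j = (\<Sum>k\<in>?K. \<alpha> k s *\<^sub>R v k s)))"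
  have "\<forall>j. \<exists>\<alpha>. j \<in> {1..<r} \<longrightarrow> P j \<alpha>"
    using less.IH less.prems unfolding P_def by fastforce
  from choice[OF this] obtain A where "\<forall>j. j \<in> {1..<r} \<longrightarrow> P j (A j)" ..
  then have A0: "\<And>j k. j \<in> {1..<r} \<Longrightarrow> j < k \<Longrightarrow> A j k = (\<lambda>_. 0)"
    and Ad: "\<And>j k t. j \<in> {1..<r} \<Longrightarrow> t \<in> I \<Longrightarrow> A j k differentiable at t within I"
    and Ae: "\<And>j s. j \<in> {1..<r} \<Longrightarrow> s \<in> I \<Longrightarrow> e s j = (\<Sum>k\<in>?K. A j k s *\<^sub>R v k s)"
    unfolding P_def by simp_all
  \<comment> \<open>\<open>h\<close> holds the Gram entries, \<open>b j\<close> is <c^(r), e_j>,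
    \<open>g k\<close> are the coefficients of the residual of c^(r) before normalisation, and
    \<open>N\<close> is its squared length; all are expressed through Gram entries and the earlier
    coefficients.\<close>
  define h where "h = (\<lambda>i j s. metric M (c s) (v i s) (v j s))"
  define b where "b = (\<lambda>j s. \<Sum>k\<in>?K. A j k s * h r k s)"
  define g where "g = (\<lambda>k s. (if k = r then 1 else 0) - (\<Sum>j\<in>{1..<r}. b j s * A j k s))"
  define N where "N = (\<lambda>s. \<Sum>k\<in>?K. g k s * (\<Sum>l\<in>?K. g l s * h k l s))"
  have rK: "r \<in> ?K" using less.prems by simp
  have hd: "h i j differentiable at t within I" if "t \<in> I" "i \<in> ?K" "j \<in> ?K" for t i j
    unfolding h_def using that dim by (intro gram_entry_differentiable) auto
  have bd: "b j differentiable at t within I" if "t \<in> I" "j \<in> {1..<r}" for t j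
    unfolding b_def using that rK by (intro differentiable_sum ballI differentiable_mult Ad hd) auto
  have gd: "g k differentiable at t within I" if "t \<in> I" for t k
    unfolding g_def using that by (intro differentiable_diff differentiable_const differentiable_sum ballI differentiable_mult Ad bd) auto
  have Nd: "N differentiable at t within I" if "t \<in> I" for t
    unfolding N_def using that by (intro differentiable_sum ballI differentiable_mult gd hd) auto
  have main: "e s r = (\<Sum>k\<in>?K. (g k s / sqrt (N s)) *\<^sub>R v k s)" "N s > 0" if s: "s \<in> I" for s
  proof -
    obtain a where a: "a \<in> charts_at M (c s)" using charts_at_nonempty[OF c_in[OF s]] by blast
    have vT: "v k s \<in> tangent_space M (c s)" if "k \<in> ?K" for k
      using that s by (intro curve_deriv_in_tangent_space) auto
    define w where "w = v r s - (\<Sum>j\<in>{1..<r}. metric M (c s) (v r s) (e s j) *\<^sub>R e s j)"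
    note step = gram_schmidt_step[OF s a less.prems, folded w_def]
    have bj: "metric M (c s) (v r s) (e s j) = b j s" if "j \<in> {1..<r}" for j
      unfolding Ae[OF that s] b_def h_def by (rule metric_linear_combination(2)[OF s a vT vT[OF rK]])
    have "(\<Sum>k\<in>?K. g k s *\<^sub>R v k s) =
        (\<Sum>k\<in>?K. (if k = r then 1 else 0) *\<^sub>R v k s) - (\<Sum>k\<in>?K. \<Sum>j\<in>{1..<r}. (b j s * A j k s) *\<^sub>R v k s)"
      by (simp only: g_def scaleR_diff_left sum_subtractf scaleR_sum_left)
    also have "(\<Sum>k\<in>?K. (if k = r then 1 else 0) *\<^sub>R v k s) = (\<Sum>k\<in>?K. if k = r then v r s else 0)"
      by (intro sum.cong refl) auto
    also have "\<dots> = v r s" using rK by simp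
    also have "(\<Sum>k\<in>?K. \<Sum>j\<in>{1..<r}. (b j s * A j k s) *\<^sub>R v k s) = (\<Sum>j\<in>{1..<r}. b j s *\<^sub>R (\<Sum>k\<in>?K. A j k s *\<^sub>R v k s))"
      by (subst sum.swap) (simp only: scaleR_sum_right scaleR_scaleR)
    also have "\<dots> = (\<Sum>j\<in>{1..<r}. metric M (c s) (v r s) (e s j) *\<^sub>R e s j)"
      by (intro sum.cong refl) (simp only: bj Ae[OF _ s, symmetric])
    finally have w: "w = (\<Sum>k\<in>?K. g k s *\<^sub>R v k s)" by (simp only: w_def)
    have "metric M (c s) w w = (\<Sum>k\<in>?K. g k s * metric M (c s) (v k s) w)"
      by (subst (1) w, rule metric_linear_combination(1)[OF s a vT step(3)])
    also have "\<dots> = N s"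
      unfolding N_def h_def
    proof (intro sum.cong refl arg_cong2[of _ _ _ _ "(*)"])
      fix k assume k: "k \<in> ?K"
      show "metric M (c s) (v k s) w = (\<Sum>l\<in>?K. g l s * metric M (c s) (v k s) (v l s))"
        by (subst w, rule metric_linear_combination(2)[OF s a vT vT[OF k]])
    qed
    finally have N: "metric M (c s) w w = N s" .
    show "N s > 0" using step(2) N by simp
    have "e s r = (1 / sqrt (N s)) *\<^sub>R (\<Sum>k\<in>?K. g k s *\<^sub>R v k s)"
      using step(1) unfolding N w[symmetric] .
    then show "e s r = (\<Sum>k\<in>?K. (g k s / sqrt (N s)) *\<^sub>R v k s)"
      by (simp only: scaleR_sum_right scaleR_scaleR) simp
  qed
  have "(\<lambda>s. g k s / sqrt (N s)) differentiable at t within I" if t: "t \<in> I" for t k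
  proof -
    obtain D1 where D1: "(g k has_real_derivative D1) (at t within I)"
      using gd[OF t] real_differentiable_def by blast
    obtain D2 where D2: "(N has_real_derivative D2) (at t within I)"
      using Nd[OF t] real_differentiable_def by blast
    have "((\<lambda>s. sqrt (N s)) has_real_derivative inverse (sqrt (N t)) / 2 * D2) (at t within I)"
      using DERIV_chain2[OF DERIV_real_sqrt[OF main(2)[OF t]] D2] .
    from DERIV_divide[OF D1 this] main(2)[OF t] show ?thesis
      using real_differentiable_def by fastforce
  qed
  \<comment> \<open>For k > r the Kronecker term and all earlier coefficients vanish
    identically.\<close>
  moreover have "(\<lambda>s. g k s / sqrt (N s)) = (\<lambda>_. 0)" if "r < k" for k
    using that A0[of _ k] by (simp add: g_def)
  ultimately show ?case
    using main(1) by (intro exI[of _ "\<lambda>k s. g k s / sqrt (N s)"]) blast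
qed

lemma frenet_cov_deriv:
  assumes t: "t \<in> I" and r: "1 \<le> r" "r < CARD('n)"
  shows "metric M (c t) (cov_deriv M I c (frenet M I c r) t) (frenet M I c (r + 1) t) =
    metric M (c t) (v (r + 1) t) (frenet M I c (r + 1) t) / metric M (c t) (v r t) (frenet M I c r t)"
proof -
  let ?K = "{1..CARD('n) - 1}" and ?E = "frenet M I c (r + 1) t"
  obtain a where a: "a \<in> charts_at M (c t)" using charts_at_nonempty[OF c_in[OF t]] by blast
  obtain \<alpha> where \<alpha>0: "\<And>k. r < k \<Longrightarrow> \<alpha> k = (\<lambda>_. 0)"
    and \<alpha>d: "\<And>k. \<alpha> k differentiable at t within I"
    and \<alpha>e: "\<And>s. s \<in> I \<Longrightarrow> e s r = (\<Sum>k\<in>?K. \<alpha> k s *\<^sub>R v k s)"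
    using frenet_coefficients[OF r] t by blast
  \<comment> \<open>Derivative 0 for the padded coefficients removes the terms with k > r, among
    them k = r + 1, where c^(k) need not be orthogonal to e_(r+1).\<close>
  have "\<exists>D. (\<alpha> k has_real_derivative D) (at t within I) \<and> (r < k \<longrightarrow> D = 0)" for k
    using \<alpha>0[of k] \<alpha>d[of k] real_differentiable_def by (cases "r < k") auto
  then obtain \<alpha>' where \<alpha>': "\<And>k. (\<alpha> k has_real_derivative \<alpha>' k) (at t within I)" "\<And>k. r < k \<Longrightarrow> \<alpha>' k = 0"
    by metis
  have E: "?E \<in> tangent_space M (c t)" using frenet_in_tangent_space[OF t a] r by simp
  have er: "frenet M I c r t \<in> tangent_space M (c t)" using frenet_in_tangent_space[OF t a] r by simp
  have vT: "v k t \<in> tangent_space M (c t)" if "1 \<le> k" "k \<le> CARD('n)" for k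
    using that t by (intro curve_deriv_in_tangent_space)
  have "cov_deriv M I c (frenet M I c r) t = (\<Sum>k\<in>?K. \<alpha>' k *\<^sub>R v k t + \<alpha> k t *\<^sub>R cov_deriv M I c (v k) t)"
  proof (rule cov_deriv_linear_combination[OF t at_within_nontrivial[OF t]])
    show "frenet M I c r s = (\<Sum>k\<in>?K. \<alpha> k s *\<^sub>R v k s)" if "s \<in> I" for s
      using \<alpha>e[OF that] r by (simp add: frenet_gram_schmidt)
    show "(\<lambda>s. v k s b) differentiable at t within I" if "k \<in> ?K" "b \<in> charts_at M (c t)" for k b
      using that t dim by (intro curve_deriv_differentiable) auto
    show "v k t b = 0" if "k \<in> ?K" "b \<notin> charts_at M (c t)" for k b
      by (rule tangent_spaceD(2)[OF vT that(2)]) (use that(1) in auto)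
  qed (rule \<alpha>'(1))
  also have "\<dots> = (\<Sum>k\<in>?K. \<alpha>' k *\<^sub>R v k t) + (\<Sum>k\<in>?K. \<alpha> k t *\<^sub>R v (Suc k) t)"
    unfolding sum.distrib[symmetric] by (intro sum.cong refl) simp
  finally have De: "cov_deriv M I c (frenet M I c r) t = \<dots>" .
  interpret T: inner_product_with_basis "range (coord_vector M a (c t))" "tangent_space M (c t)" "metric M (c t)"
    by (rule tangent_basis[OF a charts_at_topspace[OF a]])
  have "metric M (c t) (cov_deriv M I c (frenet M I c r) t) ?E =
      metric M (c t) (\<Sum>k\<in>?K. \<alpha>' k *\<^sub>R v k t) ?E + metric M (c t) (\<Sum>k\<in>?K. \<alpha> k t *\<^sub>R v (Suc k) t) ?E"
    unfolding De by (intro T.inner_add_left T.sum_in T.scaleR_in E) (auto intro!: vT simp del: curve_deriv.simps)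
  also have "metric M (c t) (\<Sum>k\<in>?K. \<alpha>' k *\<^sub>R v k t) ?E = (\<Sum>k\<in>?K. \<alpha>' k * metric M (c t) (v k t) ?E)"
    by (rule metric_linear_combination(1)[OF t a _ E]) (auto intro!: vT)
  also have "\<dots> = 0"
  proof (rule sum.neutral, rule ballI)
    fix k assume "k \<in> ?K"
    then show "\<alpha>' k * metric M (c t) (v k t) ?E = 0"
      using \<alpha>'(2)[of k] curve_deriv_frenet_orthogonal[OF t a, of k "r + 1"] r by (cases "r < k") auto
  qed
  also have "metric M (c t) (\<Sum>k\<in>?K. \<alpha> k t *\<^sub>R v (Suc k) t) ?E = (\<Sum>k\<in>?K. \<alpha> k t * metric M (c t) (v (Suc k) t) ?E)"
    by (rule metric_linear_combination(1)[OF t a _ E]) (auto intro!: vT simp del: curve_deriv.simps)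
  \<comment> \<open>Only k = r survives: above \<open>r\<close> the coefficient is 0, and below it
    c^(k+1) is orthogonal to e_(r+1).\<close>
  also have "\<dots> = (\<Sum>k\<in>?K. if k = r then \<alpha> r t * metric M (c t) (v (r + 1) t) ?E else 0)"
  proof (intro sum.cong refl)
    fix k assume "k \<in> ?K"
    then show "\<alpha> k t * metric M (c t) (v (Suc k) t) ?E = (if k = r then \<alpha> r t * metric M (c t) (v (r + 1) t) ?E else 0)"
      using \<alpha>0[of k] curve_deriv_frenet_orthogonal[OF t a, of "Suc k" "r + 1"] r
      by (cases "r < k"; cases "k = r") (auto simp del: curve_deriv.simps)
  qed
  also have "\<dots> = \<alpha> r t * metric M (c t) (v (r + 1) t) ?E"
    using r by simp
  finally have D: "metric M (c t) (cov_deriv M I c (frenet M I c r) t) ?E = \<alpha> r t * metric M (c t) (v (r + 1) t) ?E"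
    by simp
  \<comment> \<open>Pairing the expansion of e_r with e_r itself leaves only k = r and so determines
    \<open>\<alpha> r t\<close>.\<close>
  have "1 = metric M (c t) (frenet M I c r t) (frenet M I c r t)"
    using gram_schmidt_step(4)[OF t a r] r by (simp add: frenet_gram_schmidt)
  also have "\<dots> = metric M (c t) (\<Sum>k\<in>?K. \<alpha> k t *\<^sub>R v k t) (frenet M I c r t)"
    using \<alpha>e[OF t] r by (simp add: frenet_gram_schmidt)
  also have "\<dots> = (\<Sum>k\<in>?K. \<alpha> k t * metric M (c t) (v k t) (frenet M I c r t))"
    by (rule metric_linear_combination(1)[OF t a _ er]) (auto intro!: vT)
  also have "\<dots> = (\<Sum>k\<in>?K. if k = r then \<alpha> r t * metric M (c t) (v r t) (frenet M I c r t) else 0)"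
  proof (intro sum.cong refl)
    fix k assume "k \<in> ?K"
    then show "\<alpha> k t * metric M (c t) (v k t) (frenet M I c r t) =
        (if k = r then \<alpha> r t * metric M (c t) (v r t) (frenet M I c r t) else 0)"
      using \<alpha>0[of k] curve_deriv_frenet_orthogonal[OF t a, of k r] r
      by (cases "r < k"; cases "k = r") auto
  qed
  also have "\<dots> = \<alpha> r t * metric M (c t) (v r t) (frenet M I c r t)"
    using r by simp
  finally have "metric M (c t) (v r t) (frenet M I c r t) * \<alpha> r t = 1" by (simp only: mult.commute)
  from inverse_unique[OF this] show ?thesis
    unfolding D by (simp only: divide_inverse mult.commute)
qed

lemma curvature_formulas:
  assumes t: "t \<in> I"
  shows "\<And>r. r \<in> {1..CARD('n) - 2} \<Longrightarrow> curvature M I c r t =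
      vol M (c t) (r - 1) (\<lambda>k. v k t) * vol M (c t) (r + 1) (\<lambda>k. v k t) / (vol M (c t) r (\<lambda>k. v k t))\<^sup>2 *
      inverse (tangent_norm M (c t) (velocity M I c t))"
    and "curvature M I c (CARD('n) - 1) t =
      vol M (c t) (CARD('n) - 2) (\<lambda>k. v k t) * tangent_det M (c t) (\<lambda>k. v k t) /
      (vol M (c t) (CARD('n) - 1) (\<lambda>k. v k t))\<^sup>2 * inverse (tangent_norm M (c t) (velocity M I c t))"
proof -
  obtain a where a: "a \<in> charts_at M (c t)" using charts_at_nonempty[OF c_in[OF t]] by blast
  define l where "l = (\<lambda>i. metric M (c t) (v i t) (frenet M I c i t))"
  define P where "P = (\<lambda>k. \<Prod>i=1..k. l i)"
  have vol: "vol M (c t) k (\<lambda>k. v k t) = P k" if "k \<le> CARD('n) - 1" for k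
    unfolding P_def l_def by (rule vol_curve_deriv[OF t a that])
  have det: "tangent_det M (c t) (\<lambda>k. v k t) = P CARD('n)"
    unfolding P_def l_def by (rule tangent_det_curve_deriv[OF t a])
  have l: "l i \<noteq> 0" if "i \<in> {1..CARD('n) - 1}" for i
  proof -
    have "i < CARD('n)" using that dim by auto
    then show ?thesis
      using gram_schmidt_frame(3)[OF t a that] by (simp add: l_def frenet_gram_schmidt)
  qed
  \<comment> \<open>One computation covers all r < n: the quotient of the \<open>P\<close> reduces
    to \<open>l (r + 1) / l r\<close> by cancelling nonzero factors, while \<open>l (r + 1)\<close>,
    which may be 0 when r + 1 = n, is never divided by. The two claims then differ only in reading
    \<open>P (r + 1)\<close> as a volume or as the determinant.\<close>
  have curv: "curvature M I c r t =
      P (r - 1) * P (r + 1) / (P r)\<^sup>2 * inverse (tangent_norm M (c t) (velocity M I c t))"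
    if r: "1 \<le> r" "r < CARD('n)" for r
  proof -
    have "P (r - 1) \<noteq> 0" unfolding P_def using l r by auto
    moreover have "P r = P (r - 1) * l r" "P (r + 1) = P (r - 1) * l r * l (r + 1)"
      using r by (cases r; simp add: P_def)+
    moreover have "l r \<noteq> 0" using l r by simp
    ultimately have "P (r - 1) * P (r + 1) / (P r)\<^sup>2 = l (r + 1) / l r"
      by (simp add: power2_eq_square)
    then show ?thesis
      using frenet_cov_deriv[OF t r] by (simp add: curvature_def l_def divide_inverse)
  qed
  show "curvature M I c r t =
      vol M (c t) (r - 1) (\<lambda>k. v k t) * vol M (c t) (r + 1) (\<lambda>k. v k t) / (vol M (c t) r (\<lambda>k. v k t))\<^sup>2 *
      inverse (tangent_norm M (c t) (velocity M I c t))" if "r \<in> {1..CARD('n) - 2}" for r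
  proof -
    have "1 \<le> r" "r < CARD('n)" "r - 1 \<le> CARD('n) - 1" "r + 1 \<le> CARD('n) - 1" "r \<le> CARD('n) - 1"
      using that by auto
    then show ?thesis by (simp only: curv vol)
  qed
  have n: "1 \<le> CARD('n) - 1" "CARD('n) - 1 < CARD('n)" "CARD('n) - 2 \<le> CARD('n) - 1"
      "CARD('n) - 1 - 1 = CARD('n) - 2" "CARD('n) - 1 + 1 = CARD('n)"
    using dim by auto
  show "curvature M I c (CARD('n) - 1) t =
      vol M (c t) (CARD('n) - 2) (\<lambda>k. v k t) * tangent_det M (c t) (\<lambda>k. v k t) /
      (vol M (c t) (CARD('n) - 1) (\<lambda>k. v k t))\<^sup>2 * inverse (tangent_norm M (c t) (velocity M I c t))"
    using curv[OF n(1,2)] by (simp only: n(4,5) vol[OF n(3)] vol[OF order_refl] det)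
qed

end

theorem theorem4:
  fixes M :: "('a, 'n::finite) riem" and I :: "real set" and c :: "real \<Rightarrow> 'a"
  assumes "CARD('n) \<ge> 2"
    and "oriented_riemannian_manifold M"
    and "is_interval I" and "interior I \<noteq> {}"
    and "Ck_curve CARD('n) M I c"
    and "regular_curve M I c"
  shows "\<forall>t\<in>I.
     (\<forall>r\<in>{1..CARD('n) - 2}. curvature M I c r t =
        vol M (c t) (r - 1) (\<lambda>k. curve_deriv M I c k t) *
        vol M (c t) (r + 1) (\<lambda>k. curve_deriv M I c k t) /
        (vol M (c t) r (\<lambda>k. curve_deriv M I c k t))\<^sup>2 *
        inverse (tangent_norm M (c t) (velocity M I c t))) \<and>
     curvature M I c (CARD('n) - 1) t =
        vol M (c t) (CARD('n) - 2) (\<lambda>k. curve_deriv M I c k t) *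
        tangent_det M (c t) (\<lambda>k. curve_deriv M I c k t) /
        (vol M (c t) (CARD('n) - 1) (\<lambda>k. curve_deriv M I c k t))\<^sup>2 *
        inverse (tangent_norm M (c t) (velocity M I c t))"
proof -
  interpret regular_riemannian_curve M I c
    by unfold_locales (fact assms)+
  show ?thesis using curvature_formulas by blast
qed

end
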